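(* Let $B$ be a conilpotent cdg-Hopf algebra over $\Bbbk$. Then there is a natural isomorphism $\boldsymbol{\exp}:\mathrm{THom}_{\mathrm{ho}\,\mathrm{cdgA}(\Bbbk)}(B,-)\Rightarrow\mathrm{Hom}_{\mathrm{ho}\,\mathrm{cdgA}(\Bbbk)}(B,-)$ of functors $\mathrm{ho}\,\mathrm{cdgA}(\Bbbk)\to\mathrm{Set}$, with inverse $\boldsymbol{\ln}$, whose components at each cdg-algebra $A$ are given by $$\boldsymbol{\exp}_A([\upsilon])=\Big[u_A\circ\epsilon_B+\sum_{n=1}^\infty\frac1{n!}\,m_A^{(n)}\circ(\upsilon\otimes\cdots\otimes\upsilon)\circ\Delta_B^{(n)}\Big],$$ $$\boldsymbol{\ln}_A([g])=\Big[-\sum_{n=1}^\infty\frac{(-1)^n}{n}\,m_A^{(n)}\circ(\bar g\otimes\cdots\otimes\bar g)\circ\Delta_B^{(n)}\Big],$$ where $g\in\mathrm{Hom}_{\mathrm{cdgA}(\Bbbk)}(B,A)$ and $\upsilon\in\mathrm{THom}_{\mathrm{cdgA}(\Bbbk)}(B,A)$ are arbitrary representatives of $[g]$ and $[\upsilon]$, and $\bar g:=g-u_A\circ\epsilon_B$.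
   Context: $\Bbbk$ is a field of characteristic $0$; $\otimes=\otimes_{\Bbbk}$. Everything is $\mathbb Z$-graded, differentials have degree $+1$, Koszul sign convention. $\mathrm{Hom}(V,W)$ is the graded space of $\Bbbk$-linear maps, with $d_{V,W}f=d_W\circ f-(-1)^{|f|}f\circ d_V$. A cdg-algebra $A=(A,u_A,m_A,d_A)$ is a unital associative graded-commutative dg algebra; $\mathrm{cdgA}(\Bbbk)$ is their category. A cdg-Hopf algebra $B=(B,u_B,m_B,\epsilon_B,\Delta_B,\varsigma_B,d_B)$ is a cdg-algebra and counital coassociative dg coalgebra, with $\epsilon_B,\Delta_B$ algebra maps, and antipode $\varsigma_B$ a cochain map satisfying the antipode axiom. Conilpotent: let $\bar B=\ker\epsilon_B$ and $\bar\Delta_B(x)=\Delta_B(x)-u_B(1)\otimes x-x\otimes u_B(1)$, with iterates $\bar\Delta_B^{(1)}=\mathbb I$, $\bar\Delta_B^{(n+1)}=(\bar\Delta_B^{(n)}\otimes\mathbb I)\circ\bar\Delta_B$. $B$ is conilpotent if for every $x\in\bar B$ there is a positive integer $n$ with $\bar\Delta_B^{(n+1)}(x)=0$. Iterates: $\Delta_B^{(1)}=\mathbb I_B$, $\Delta_B^{(n+1)}=(\Delta_B^{(n)}\otimes\mathbb I_B)\circ\Delta_B$; $m_A^{(1)}=\mathbb I_A$, $m_A^{(n+1)}=m_A\circ(m_A^{(n)}\otimes\mathbb I_A)$. The infinite sums are understood pointwise (finite on each element of $B$). A homotopy pair on $\mathrm{Hom}_{\mathrm{cdgA}(\Bbbk)}(A,A')$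 is $(f(t),\xi(t))\in\mathrm{Hom}(A,A')^0[t]\oplus\mathrm{Hom}(A,A')^{-1}[t]$ with $\frac{d}{dt}f(t)=d_{A,A'}\xi(t)$, $f(0)$ a morphism of cdg-algebras, $\xi(t)\circ u_A=0$, $\xi(t)\circ m_A=m_{A'}\circ(f(t)\otimes\xi(t)+\xi(t)\otimes f(t))$. Morphisms $f,\tilde f$ are homotopic if there is a homotopy pair with $f(0)=f$, $f(1)=\tilde f$ (regarded as an equivalence relation); $[f]$ is the homotopy type, and $\mathrm{ho}\,\mathrm{cdgA}(\Bbbk)$ has homotopy types as morphisms. With $e=u_A\circ\epsilon_B$, $\mathrm{THom}_{\mathrm{cdgA}(\Bbbk)}(B,A)$ is the set of $\upsilon\in\mathrm{Hom}(B,A)^0$ with $d_{B,A}\upsilon=0$, $\upsilon\circ u_B=0$, $\upsilon\circ m_B=m_A\circ(e\otimes\upsilon+\upsilon\otimes e)$. A homotopy pair on it is $(\upsilon(t),\sigma(t))\in\mathrm{Hom}(B,A)^0[t]\oplus\mathrm{Hom}(B,A)^{-1}[t]$ with $\frac{d}{dt}\upsilon(t)=d_{B,A}\sigma(t)$, $\upsilon(0)\in\mathrm{THom}_{\mathrm{cdgA}(\Bbbk)}(B,A)$, $\sigma(t)\circ u_B=0$, $\sigma(t)\circ m_B=m_A\circ(e\otimes\sigma(t)+\sigma(t)\otimes e)$; homotopy and homotopy types $[\upsilon]$ are defined as before, and $\mathrm{THom}_{\mathrm{ho}\,\mathrm{cdgA}(\Bbbk)}(B,A)$ is the set of homotopy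 types. It is a functor in $A$ by $[f]\cdot[\upsilon]=[f\circ\upsilon]$.
   Formalization: Homotopy pairs are polynomial in t only pointwise (f(t)(x), ξ(t)(x) polynomial for each x, no uniform degree bound); with elements of Hom(A,A')[t] read literally the claim fails for B=k[x], A=k[y,z], dz=y. *)

theory Defs
  imports Complex_Main "HOL-Library.Poly_Mapping"
begin

section \<open>Tensor powers\<close>

text \<open>
  An element of a tensor power of a vector space \<open>V\<close> is represented by a formal linear
  combination of words over \<open>V\<close>, the word \<open>[x1, ..., xn]\<close> standing for the pure tensor
  \<open>x1 \<otimes> ... \<otimes> xn\<close>.  The tensor power itself is the quotient of the free vector space on the
  words of length \<open>n\<close> by the multilinearity relations; equality in this quotient is
  \<open>tens_eq\<close>.  Hence a map into a tensor power is given by representatives, and all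
  equations between tensors are stated with \<open>tens_eq\<close>.  A single type for all tensor powers is
  needed because the iterated coproducts have values in the \<open>n\<close>-th power for variable \<open>n\<close>;
  the identification of the tensor product of two powers with a power is
  concatenation of words.
\<close>

type_synonym ('k, 'v) ftens = "'v list \<Rightarrow>\<^sub>0 'k"

definition fscale :: "'k::field \<Rightarrow> ('w \<Rightarrow>\<^sub>0 'k) \<Rightarrow> ('w \<Rightarrow>\<^sub>0 'k)" where
  "fscale c p = Poly_Mapping.map ((*) c) p"

lemma lookup_fscale [simp]:
  "Poly_Mapping.lookup (fscale c p) w = c * Poly_Mapping.lookup p w"
  by (simp add: fscale_def Poly_Mapping.map.rep_eq when_def)

lemma vector_space_fscale: "vector_space fscale"
  by unfold_locales (auto intro!: poly_mapping_eqI simp: lookup_add algebra_simps)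

definition pure :: "'v list \<Rightarrow> ('k::field, 'v) ftens" where
  "pure w = Poly_Mapping.single w 1"

definition lin_ext :: "('k \<Rightarrow> 'u \<Rightarrow> 'u) \<Rightarrow> ('w \<Rightarrow> 'u) \<Rightarrow> ('w \<Rightarrow>\<^sub>0 'k::zero) \<Rightarrow> 'u::comm_monoid_add" where
  "lin_ext s h p = (\<Sum>w\<in>Poly_Mapping.keys p. s (Poly_Mapping.lookup p w) (h w))"

definition multilinear_relators ::
  "('k::field \<Rightarrow> 'v::ab_group_add \<Rightarrow> 'v) \<Rightarrow> ('k, 'v) ftens set" where
  "multilinear_relators s =
     {pure (u @ (x + y) # w) - pure (u @ x # w) - pure (u @ y # w) | u w x y. True} \<union>
     {pure (u @ s c x # w) - fscale c (pure (u @ x # w)) | u w c x. True}"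

definition tens_eq ::
  "('k::field \<Rightarrow> 'v::ab_group_add \<Rightarrow> 'v) \<Rightarrow> ('k, 'v) ftens \<Rightarrow> ('k, 'v) ftens \<Rightarrow> bool" where
  "tens_eq s p q \<longleftrightarrow> p - q \<in> module.span fscale (multilinear_relators s)"

definition ftens_pow :: "nat \<Rightarrow> ('k::field, 'v) ftens set" where
  "ftens_pow n = {p. \<forall>w\<in>Poly_Mapping.keys p. length w = n}"

definition tconc :: "('k::field, 'v) ftens \<Rightarrow> ('k, 'v) ftens \<Rightarrow> ('k, 'v) ftens" where
  "tconc p q = lin_ext fscale (\<lambda>u. lin_ext fscale (\<lambda>w. pure (u @ w)) q) p"

text \<open>Linear map on the second tensor power induced by a bilinear map \<open>h\<close>; it is only applied
  to elements of \<open>ftens_pow 2\<close>.\<close>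

definition lin_ext2 ::
  "('k \<Rightarrow> 'u \<Rightarrow> 'u) \<Rightarrow> ('v \<Rightarrow> 'v \<Rightarrow> 'u) \<Rightarrow> ('k::zero, 'v) ftens \<Rightarrow> 'u::comm_monoid_add" where
  "lin_ext2 s h p = lin_ext s (\<lambda>w. h (w ! 0) (w ! 1)) p"

text \<open>The map \<open>F \<otimes> G\<close> on a second tensor power for \<open>F\<close>, \<open>G\<close> of degree 0 with values in tensor
  powers (so that there is no Koszul sign).\<close>

definition tens_map ::
  "('v \<Rightarrow> ('k::field, 'w) ftens) \<Rightarrow> ('v \<Rightarrow> ('k, 'w) ftens) \<Rightarrow> ('k, 'v) ftens \<Rightarrow> ('k, 'w) ftens" where
  "tens_map F G = lin_ext2 fscale (\<lambda>a b. tconc (F a) (G b))"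


section \<open>Graded spaces\<close>

definition is_decomposition :: "(int \<Rightarrow> 'v::ab_group_add set) \<Rightarrow> 'v \<Rightarrow> (int \<Rightarrow> 'v) \<Rightarrow> bool" where
  "is_decomposition G x c \<longleftrightarrow>
     (\<forall>i. c i \<in> G i) \<and> finite {i. c i \<noteq> 0} \<and> x = (\<Sum>i | c i \<noteq> 0. c i)"

locale graded_space = vector_space s
  for s :: "'k::field \<Rightarrow> 'v::ab_group_add \<Rightarrow> 'v" +
  fixes G :: "int \<Rightarrow> 'v set"
  assumes subspace_grade: "subspace (G i)"
    and direct_sum: "\<exists>!c. is_decomposition G x c"

text \<open>The homogeneous component of degree \<open>i\<close> of \<open>x\<close>.\<close>

definition hcomp :: "(int \<Rightarrow> 'v::ab_group_add set) \<Rightarrow> 'v \<Rightarrow> int \<Rightarrow> 'v" where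
  "hcomp G x = (THE c. is_decomposition G x c)"


section \<open>Cdg-algebras\<close>

record ('k, 'a) cdga =
  vscale :: "'k \<Rightarrow> 'a \<Rightarrow> 'a"
  grade :: "int \<Rightarrow> 'a set"
  aunit :: 'a
  amult :: "'a \<Rightarrow> 'a \<Rightarrow> 'a"
  adiff :: "'a \<Rightarrow> 'a"

definition unit_map :: "('k, 'a, 'm) cdga_scheme \<Rightarrow> 'k \<Rightarrow> 'a" where
  "unit_map A c = vscale A c (aunit A)"

text \<open>The component of degree \<open>k\<close> of the graded space of linear maps, and its differential
  on that component.\<close>

definition Hom_deg ::
  "('k::field, 'a::ab_group_add, 'm) cdga_scheme \<Rightarrow> ('k, 'c::ab_group_add, 'n) cdga_scheme \<Rightarrow>
   int \<Rightarrow> ('a \<Rightarrow> 'c) set" where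
  "Hom_deg A A' k =
     {f. Vector_Spaces.linear (vscale A) (vscale A') f \<and> (\<forall>i. f ` grade A i \<subseteq> grade A' (i + k))}"

definition Hom_diff ::
  "('k::field, 'a::ab_group_add, 'm) cdga_scheme \<Rightarrow> ('k, 'c::ab_group_add, 'n) cdga_scheme \<Rightarrow>
   int \<Rightarrow> ('a \<Rightarrow> 'c) \<Rightarrow> 'a \<Rightarrow> 'c" where
  "Hom_diff A A' k f = (\<lambda>x. adiff A' (f x) - vscale A' ((- 1) powi k) (f (adiff A x)))"

locale cdg_algebra = graded_space "vscale A" "grade A"
  for A :: "('k::field, 'a::ab_group_add, 'm) cdga_scheme" +
  assumes diff_deg: "adiff A \<in> Hom_deg A A 1"
    and diff_diff: "adiff A (adiff A x) = 0"
    and mult_add_left: "amult A (x + y) z = amult A x z + amult A y z"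
    and mult_add_right: "amult A x (y + z) = amult A x y + amult A x z"
    and mult_scale_left: "amult A (vscale A c x) y = vscale A c (amult A x y)"
    and mult_scale_right: "amult A x (vscale A c y) = vscale A c (amult A x y)"
    and unit_deg: "aunit A \<in> grade A 0"
    and mult_deg: "x \<in> grade A i \<Longrightarrow> y \<in> grade A j \<Longrightarrow> amult A x y \<in> grade A (i + j)"
    and mult_unit_left: "amult A (aunit A) x = x"
    and mult_unit_right: "amult A x (aunit A) = x"
    and mult_assoc: "amult A (amult A x y) z = amult A x (amult A y z)"
    and mult_comm: "x \<in> grade A i \<Longrightarrow> y \<in> grade A j \<Longrightarrow>
          amult A x y = vscale A ((- 1) powi (i * j)) (amult A y x)"
    and leibniz: "x \<in> grade A i \<Longrightarrow>
          adiff A (amult A x y) =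
            amult A (adiff A x) y + vscale A ((- 1) powi i) (amult A x (adiff A y))"

definition Hom_cdgA ::
  "('k::field, 'a::ab_group_add, 'm) cdga_scheme \<Rightarrow> ('k, 'c::ab_group_add, 'n) cdga_scheme \<Rightarrow>
   ('a \<Rightarrow> 'c) set" where
  "Hom_cdgA A A' =
     {f \<in> Hom_deg A A' 0. Hom_diff A A' 0 f = (\<lambda>x. 0) \<and> f (aunit A) = aunit A' \<and>
        (\<forall>x y. f (amult A x y) = amult A' (f x) (f y))}"

text \<open>All iterated products at once: on words of length \<open>n\<close> this is the \<open>n\<close>-th iterate, with
  \<open>[a1, ..., an] \<mapsto> (...(a1 a2)...) an\<close>.  The value on the empty word is never used.\<close>

definition mult_word :: "('k, 'a, 'm) cdga_scheme \<Rightarrow> 'a list \<Rightarrow> 'a" where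
  "mult_word A w = foldl (amult A) (hd w) (tl w)"

definition mult_iter :: "('k::field, 'a::ab_group_add, 'm) cdga_scheme \<Rightarrow> ('k, 'a) ftens \<Rightarrow> 'a" where
  "mult_iter A = lin_ext (vscale A) (mult_word A)"


section \<open>Conilpotent cdg-Hopf algebras\<close>

record (overloaded) ('k::zero, 'b) cdg_hopf = "('k, 'b) cdga" +
  counit :: "'b \<Rightarrow> 'k"
  comult :: "'b \<Rightarrow> ('k, 'b) ftens"
  antipode :: "'b \<Rightarrow> 'b"

text \<open>Homogeneous elements, differential and product of the cdg-algebra \<open>A \<otimes> A\<close>.  The Koszul
  signs are given for homogeneous entries, so the relevant entries are decomposed into their
  homogeneous components:
  \<open>d (a \<otimes> b) = da \<otimes> b + (-1)^|a| a \<otimes> db\<close> and \<open>(a \<otimes> b)(a' \<otimes> b') = (-1)^(|b||a'|) aa' \<otimes> bb'\<close>.\<close>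

definition tens2_grade ::
  "('k::field, 'a::ab_group_add, 'm) cdga_scheme \<Rightarrow> int \<Rightarrow> ('k, 'a) ftens set" where
  "tens2_grade A i =
     {p. \<exists>q. tens_eq (vscale A) p q \<and>
       (\<forall>w\<in>Poly_Mapping.keys q. \<exists>j a b. w = [a, b] \<and> a \<in> grade A j \<and> b \<in> grade A (i - j))}"

definition tens2_diff ::
  "('k::field, 'a::ab_group_add, 'm) cdga_scheme \<Rightarrow> ('k, 'a) ftens \<Rightarrow> ('k, 'a) ftens" where
  "tens2_diff A = lin_ext2 fscale (\<lambda>a b.
     pure [adiff A a, b] +
     (\<Sum>i | hcomp (grade A) a i \<noteq> 0.
        fscale ((- 1) powi i) (pure [hcomp (grade A) a i, adiff A b])))"

definition tens2_mult ::
  "('k::field, 'a::ab_group_add, 'm) cdga_scheme \<Rightarrow>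
   ('k, 'a) ftens \<Rightarrow> ('k, 'a) ftens \<Rightarrow> ('k, 'a) ftens" where
  "tens2_mult A p q = lin_ext2 fscale (\<lambda>a b. lin_ext2 fscale (\<lambda>a' b'.
     (\<Sum>i | hcomp (grade A) b i \<noteq> 0. \<Sum>j | hcomp (grade A) a' j \<noteq> 0.
        fscale ((- 1) powi (i * j))
          (pure [amult A a (hcomp (grade A) a' j), amult A (hcomp (grade A) b i) b']))) q) p"

definition tens1 :: "'b \<Rightarrow> ('k::field, 'b) ftens" where
  "tens1 x = pure [x]"

locale cdg_hopf_algebra = cdg_algebra B
  for B :: "('k::field, 'b::ab_group_add, 'm) cdg_hopf_scheme" +
  assumes counit_linear: "Vector_Spaces.linear (vscale B) (*) (counit B)"
    and counit_deg: "x \<in> grade B i \<Longrightarrow> i \<noteq> 0 \<Longrightarrow> counit B x = 0"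
    and counit_diff: "counit B (adiff B x) = 0"
    and counit_unit: "counit B (aunit B) = 1"
    and counit_mult: "counit B (amult B x y) = counit B x * counit B y"
    and comult_pow: "comult B x \<in> ftens_pow 2"
    and comult_add: "tens_eq (vscale B) (comult B (x + y)) (comult B x + comult B y)"
    and comult_scale: "tens_eq (vscale B) (comult B (vscale B c x)) (fscale c (comult B x))"
    and comult_deg: "x \<in> grade B i \<Longrightarrow> comult B x \<in> tens2_grade B i"
    and comult_diff: "tens_eq (vscale B) (comult B (adiff B x)) (tens2_diff B (comult B x))"
    and comult_unit: "tens_eq (vscale B) (comult B (aunit B)) (pure [aunit B, aunit B])"
    and comult_mult:
      "tens_eq (vscale B) (comult B (amult B x y)) (tens2_mult B (comult B x) (comult B y))"
    and coassoc: "tens_eq (vscale B) (tens_map (comult B) tens1 (comult B x))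
                                     (tens_map tens1 (comult B) (comult B x))"
    and counit_left: "lin_ext2 (vscale B) (\<lambda>a b. vscale B (counit B a) b) (comult B x) = x"
    and counit_right: "lin_ext2 (vscale B) (\<lambda>a b. vscale B (counit B b) a) (comult B x) = x"
    and antipode_deg: "antipode B \<in> Hom_deg B B 0"
    and antipode_diff: "Hom_diff B B 0 (antipode B) = (\<lambda>x. 0)"
    and antipode_left: "lin_ext2 (vscale B) (\<lambda>a b. amult B (antipode B a) b) (comult B x) =
                          unit_map B (counit B x)"
    and antipode_right: "lin_ext2 (vscale B) (\<lambda>a b. amult B a (antipode B b)) (comult B x) =
                          unit_map B (counit B x)"

text \<open>The iterated coproducts are indexed from 1; the value at 0 is never used.\<close>

fun comult_iter ::
  "('k::field, 'b, 'm) cdg_hopf_scheme \<Rightarrow> nat \<Rightarrow> 'b \<Rightarrow> ('k, 'b) ftens" where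
  "comult_iter B 0 x = 0"
| "comult_iter B (Suc 0) x = tens1 x"
| "comult_iter B (Suc (Suc n)) x = tens_map (comult_iter B (Suc n)) tens1 (comult B x)"

definition red_comult ::
  "('k::field, 'b, 'm) cdg_hopf_scheme \<Rightarrow> 'b \<Rightarrow> ('k, 'b) ftens" where
  "red_comult B x = comult B x - pure [aunit B, x] - pure [x, aunit B]"

fun red_comult_iter ::
  "('k::field, 'b, 'm) cdg_hopf_scheme \<Rightarrow> nat \<Rightarrow> 'b \<Rightarrow> ('k, 'b) ftens" where
  "red_comult_iter B 0 x = 0"
| "red_comult_iter B (Suc 0) x = tens1 x"
| "red_comult_iter B (Suc (Suc n)) x =
     tens_map (red_comult_iter B (Suc n)) tens1 (red_comult B x)"

definition conilpotent :: "('k::field, 'b::ab_group_add, 'm) cdg_hopf_scheme \<Rightarrow> bool" where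
  "conilpotent B \<longleftrightarrow>
     (\<forall>x. counit B x = 0 \<longrightarrow> (\<exists>n\<ge>1. tens_eq (vscale B) (red_comult_iter B (n + 1) x) 0))"


section \<open>Homotopy\<close>

text \<open>
  A family \<open>f(t) = \<Sum>n. t^n f_n\<close> of linear maps of degree \<open>k\<close> depending polynomially on \<open>t\<close> is
  given by its coefficient sequence \<open>n \<mapsto> f_n\<close>.  Polynomiality is understood pointwise: for
  each \<open>x\<close>, \<open>f(t)(x)\<close> is a polynomial in \<open>t\<close>, but there need not be a bound on its degree which
  is uniform in \<open>x\<close>; equivalently, \<open>f(t)\<close> is a linear map of degree \<open>k\<close> to \<open>A'[t]\<close>.
  With a uniform bound the maps exp and ln would not be compatible with homotopies:  for
  \<open>B = k[x]\<close> with \<open>x\<close> primitive of degree 0 and \<open>A = k[y, z]\<close> with \<open>|y| = 0\<close>, \<open>|z| = -1\<close> and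
  \<open>dz = y\<close>, a family of algebra maps \<open>B \<rightarrow> A\<close> has \<open>f(t)(x^n) = (f(t)(x))^n\<close>, whose degree in
  \<open>t\<close> is bounded in \<open>n\<close> only if \<open>f(t)(x)\<close> is constant.
\<close>

definition poly_Hom ::
  "('k::field, 'a::ab_group_add, 'm) cdga_scheme \<Rightarrow> ('k, 'c::ab_group_add, 'n) cdga_scheme \<Rightarrow>
   int \<Rightarrow> (nat \<Rightarrow> 'a \<Rightarrow> 'c) set" where
  "poly_Hom A A' k = {F. (\<forall>n. F n \<in> Hom_deg A A' k) \<and> (\<forall>x. finite {n. F n x \<noteq> 0})}"

definition poly_eval ::
  "('k::field, 'c::ab_group_add, 'n) cdga_scheme \<Rightarrow> (nat \<Rightarrow> 'a \<Rightarrow> 'c) \<Rightarrow> 'k \<Rightarrow> 'a \<Rightarrow> 'c" where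
  "poly_eval A' F t = (\<lambda>x. \<Sum>n | F n x \<noteq> 0. vscale A' (t ^ n) (F n x))"

definition poly_deriv ::
  "('k::field, 'c, 'n) cdga_scheme \<Rightarrow> (nat \<Rightarrow> 'a \<Rightarrow> 'c) \<Rightarrow> nat \<Rightarrow> 'a \<Rightarrow> 'c" where
  "poly_deriv A' F = (\<lambda>n x. vscale A' (of_nat (Suc n)) (F (Suc n) x))"

text \<open>The product condition is an identity of polynomials in \<open>t\<close>, written for the coefficients
  of \<open>t^n\<close>.  The exponent \<open>(- 1) * i\<close> is the Koszul sign of
  \<open>(f \<otimes> \<xi>)(x \<otimes> y) = (-1)^(|\<xi>||x|) f(x) \<otimes> \<xi>(y)\<close> with \<open>|\<xi>| = -1\<close>.\<close>

definition homotopy_pair ::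
  "('k::field, 'a::ab_group_add, 'm) cdga_scheme \<Rightarrow> ('k, 'c::ab_group_add, 'n) cdga_scheme \<Rightarrow>
   (nat \<Rightarrow> 'a \<Rightarrow> 'c) \<Rightarrow> (nat \<Rightarrow> 'a \<Rightarrow> 'c) \<Rightarrow> bool" where
  "homotopy_pair A A' F \<xi> \<longleftrightarrow>
     F \<in> poly_Hom A A' 0 \<and> \<xi> \<in> poly_Hom A A' (- 1) \<and>
     (\<forall>n. poly_deriv A' F n = Hom_diff A A' (- 1) (\<xi> n)) \<and>
     poly_eval A' F 0 \<in> Hom_cdgA A A' \<and>
     (\<forall>n c. \<xi> n (unit_map A c) = 0) \<and>
     (\<forall>n i. \<forall>x\<in>grade A i. \<forall>y.
        \<xi> n (amult A x y) =
          (\<Sum>p\<le>n. vscale A' ((- 1) powi ((- 1) * i)) (amult A' (F p x) (\<xi> (n - p) y)) +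
                  amult A' (\<xi> p x) (F (n - p) y)))"

text \<open>Being connected by a homotopy pair need not be transitive for a general source, so
  homotopy is the equivalence relation generated by it.\<close>

definition homotopy_rel ::
  "('k::field, 'a::ab_group_add, 'm) cdga_scheme \<Rightarrow> ('k, 'c::ab_group_add, 'n) cdga_scheme \<Rightarrow>
   (('a \<Rightarrow> 'c) \<times> ('a \<Rightarrow> 'c)) set" where
  "homotopy_rel A A' =
     (let R = {(f, g). f \<in> Hom_cdgA A A' \<and> g \<in> Hom_cdgA A A' \<and>
                 (\<exists>F \<xi>. homotopy_pair A A' F \<xi> \<and> poly_eval A' F 0 = f \<and> poly_eval A' F 1 = g)}
      in Restr ((R \<union> R\<inverse>)\<^sup>*) (Hom_cdgA A A'))"

definition htype ::
  "('k::field, 'a::ab_group_add, 'm) cdga_scheme \<Rightarrow> ('k, 'c::ab_group_add, 'n) cdga_scheme \<Rightarrow>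
   ('a \<Rightarrow> 'c) \<Rightarrow> ('a \<Rightarrow> 'c) set" where
  "htype A A' f = homotopy_rel A A' `` {f}"

definition Hom_ho ::
  "('k::field, 'a::ab_group_add, 'm) cdga_scheme \<Rightarrow> ('k, 'c::ab_group_add, 'n) cdga_scheme \<Rightarrow>
   ('a \<Rightarrow> 'c) set set" where
  "Hom_ho A A' = Hom_cdgA A A' // homotopy_rel A A'"

text \<open>Composition in the homotopy category: the class of \<open>f \<circ> g\<close> for representatives \<open>f\<close>, \<open>g\<close>.\<close>

definition comp_ho ::
  "('k::field, 'b::ab_group_add, 'l) cdga_scheme \<Rightarrow> ('k, 'c::ab_group_add, 'n) cdga_scheme \<Rightarrow>
   ('a \<Rightarrow> 'c) set \<Rightarrow> ('b \<Rightarrow> 'a) set \<Rightarrow> ('b \<Rightarrow> 'c) set" where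
  "comp_ho B A' \<phi> \<gamma> = (\<Union>f\<in>\<phi>. \<Union>g\<in>\<gamma>. htype B A' (f \<circ> g))"


section \<open>The functor THom\<close>

definition conv_unit ::
  "('k::zero, 'b, 'l) cdg_hopf_scheme \<Rightarrow> ('k, 'a, 'm) cdga_scheme \<Rightarrow> 'b \<Rightarrow> 'a" where
  "conv_unit B A = (\<lambda>x. unit_map A (counit B x))"

definition THom_cdgA ::
  "('k::field, 'b::ab_group_add, 'l) cdg_hopf_scheme \<Rightarrow> ('k, 'a::ab_group_add, 'm) cdga_scheme \<Rightarrow>
   ('b \<Rightarrow> 'a) set" where
  "THom_cdgA B A =
     {\<upsilon> \<in> Hom_deg B A 0. Hom_diff B A 0 \<upsilon> = (\<lambda>x. 0) \<and> (\<forall>c. \<upsilon> (unit_map B c) = 0) \<and>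
        (\<forall>x y. \<upsilon> (amult B x y) =
                 amult A (conv_unit B A x) (\<upsilon> y) + amult A (\<upsilon> x) (conv_unit B A y))}"

definition Thomotopy_pair ::
  "('k::field, 'b::ab_group_add, 'l) cdg_hopf_scheme \<Rightarrow> ('k, 'a::ab_group_add, 'm) cdga_scheme \<Rightarrow>
   (nat \<Rightarrow> 'b \<Rightarrow> 'a) \<Rightarrow> (nat \<Rightarrow> 'b \<Rightarrow> 'a) \<Rightarrow> bool" where
  "Thomotopy_pair B A \<Upsilon> \<sigma> \<longleftrightarrow>
     \<Upsilon> \<in> poly_Hom B A 0 \<and> \<sigma> \<in> poly_Hom B A (- 1) \<and>
     (\<forall>n. poly_deriv A \<Upsilon> n = Hom_diff B A (- 1) (\<sigma> n)) \<and>
     poly_eval A \<Upsilon> 0 \<in> THom_cdgA B A \<and>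
     (\<forall>n c. \<sigma> n (unit_map B c) = 0) \<and>
     (\<forall>n i. \<forall>x\<in>grade B i. \<forall>y.
        \<sigma> n (amult B x y) =
          vscale A ((- 1) powi ((- 1) * i)) (amult A (conv_unit B A x) (\<sigma> n y)) +
          amult A (\<sigma> n x) (conv_unit B A y))"

definition Thomotopy_rel ::
  "('k::field, 'b::ab_group_add, 'l) cdg_hopf_scheme \<Rightarrow> ('k, 'a::ab_group_add, 'm) cdga_scheme \<Rightarrow>
   (('b \<Rightarrow> 'a) \<times> ('b \<Rightarrow> 'a)) set" where
  "Thomotopy_rel B A =
     (let R = {(\<upsilon>, \<tau>). \<upsilon> \<in> THom_cdgA B A \<and> \<tau> \<in> THom_cdgA B A \<and>
                 (\<exists>\<Upsilon> \<sigma>. Thomotopy_pair B A \<Upsilon> \<sigma> \<and> poly_eval A \<Upsilon> 0 = \<upsilon> \<and> poly_eval A \<Upsilon> 1 = \<tau>)}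
      in Restr ((R \<union> R\<inverse>)\<^sup>*) (THom_cdgA B A))"

definition Thtype ::
  "('k::field, 'b::ab_group_add, 'l) cdg_hopf_scheme \<Rightarrow> ('k, 'a::ab_group_add, 'm) cdga_scheme \<Rightarrow>
   ('b \<Rightarrow> 'a) \<Rightarrow> ('b \<Rightarrow> 'a) set" where
  "Thtype B A \<upsilon> = Thomotopy_rel B A `` {\<upsilon>}"

definition THom_ho ::
  "('k::field, 'b::ab_group_add, 'l) cdg_hopf_scheme \<Rightarrow> ('k, 'a::ab_group_add, 'm) cdga_scheme \<Rightarrow>
   ('b \<Rightarrow> 'a) set set" where
  "THom_ho B A = THom_cdgA B A // Thomotopy_rel B A"

definition Tcomp_ho ::
  "('k::field, 'b::ab_group_add, 'l) cdg_hopf_scheme \<Rightarrow> ('k, 'c::ab_group_add, 'n) cdga_scheme \<Rightarrow>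
   ('a \<Rightarrow> 'c) set \<Rightarrow> ('b \<Rightarrow> 'a) set \<Rightarrow> ('b \<Rightarrow> 'c) set" where
  "Tcomp_ho B A' \<phi> U = (\<Union>f\<in>\<phi>. \<Union>\<upsilon>\<in>U. Thtype B A' (f \<circ> \<upsilon>))"


section \<open>Exponential and logarithm\<close>

definition fmap :: "('b \<Rightarrow> 'a) \<Rightarrow> ('k::field, 'b) ftens \<Rightarrow> ('k, 'a) ftens" where
  "fmap h = lin_ext fscale (\<lambda>w. pure (map h w))"

text \<open>\<open>m^(n) \<circ> (h \<otimes> ... \<otimes> h) \<circ> \<Delta>^(n)\<close> for \<open>h\<close> of degree 0.\<close>

definition conv_power ::
  "('k::field, 'b::ab_group_add, 'l) cdg_hopf_scheme \<Rightarrow> ('k, 'a::ab_group_add, 'm) cdga_scheme \<Rightarrow>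
   ('b \<Rightarrow> 'a) \<Rightarrow> nat \<Rightarrow> 'b \<Rightarrow> 'a" where
  "conv_power B A h n x = mult_iter A (fmap h (comult_iter B n x))"

text \<open>The sum of the series \<open>a 1 + a 2 + ...\<close>, meaningful if only finitely many terms are
  nonzero.\<close>

definition finite_series :: "(nat \<Rightarrow> 'a::comm_monoid_add) \<Rightarrow> 'a" where
  "finite_series a = (\<Sum>n | n \<ge> 1 \<and> a n \<noteq> 0. a n)"

definition exp_map ::
  "('k::field, 'b::ab_group_add, 'l) cdg_hopf_scheme \<Rightarrow> ('k, 'a::ab_group_add, 'm) cdga_scheme \<Rightarrow>
   ('b \<Rightarrow> 'a) \<Rightarrow> 'b \<Rightarrow> 'a" where
  "exp_map B A \<upsilon> = (\<lambda>x. unit_map A (counit B x) +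
     finite_series (\<lambda>n. vscale A (1 / of_nat (fact n)) (conv_power B A \<upsilon> n x)))"

definition ln_map ::
  "('k::field, 'b::ab_group_add, 'l) cdg_hopf_scheme \<Rightarrow> ('k, 'a::ab_group_add, 'm) cdga_scheme \<Rightarrow>
   ('b \<Rightarrow> 'a) \<Rightarrow> 'b \<Rightarrow> 'a" where
  "ln_map B A g = (\<lambda>x.
     - finite_series (\<lambda>n. vscale A ((- 1) ^ n / of_nat n)
         (conv_power B A (\<lambda>b. g b - unit_map A (counit B b)) n x)))"

definition exp_ho ::
  "('k::field, 'b::ab_group_add, 'l) cdg_hopf_scheme \<Rightarrow> ('k, 'a::ab_group_add, 'm) cdga_scheme \<Rightarrow>
   ('b \<Rightarrow> 'a) set \<Rightarrow> ('b \<Rightarrow> 'a) set" where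
  "exp_ho B A U = (\<Union>\<upsilon>\<in>U. htype B A (exp_map B A \<upsilon>))"

definition ln_ho ::
  "('k::field, 'b::ab_group_add, 'l) cdg_hopf_scheme \<Rightarrow> ('k, 'a::ab_group_add, 'm) cdga_scheme \<Rightarrow>
   ('b \<Rightarrow> 'a) set \<Rightarrow> ('b \<Rightarrow> 'a) set" where
  "ln_ho B A \<gamma> = (\<Union>g\<in>\<gamma>. Thtype B A (ln_map B A g))"

end

theory Submission
  imports Defs "HOL-Library.Product_Plus" "HOL-Computational_Algebra.Formal_Power_Series"
    "HOL-Computational_Algebra.Polynomial"
begin

text \<open>
  Under the convolution product \<open>f \<star> g = m \<circ> (f \<otimes> g) \<circ> \<Delta>\<close> the linear maps from \<open>B\<close> to \<open>A\<close> form an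
  algebra with unit \<open>e\<close>, and the two series of the theorem are the exponential and the logarithm
  in this algebra.  Conilpotence makes every power series in a map \<open>h\<close> with \<open>h 1 = 0\<close> finite at
  each element (\<open>pow_eventually_zero\<close>), and substitution of such a map is compatible with products
  and composition of formal power series (\<open>ser_mult\<close>, \<open>ser_compose\<close>).  Hence exp and ln are
  mutually inverse because the formal series are.

  That they exchange derivations along \<open>e\<close> and algebra maps rests on \<open>conv_mult\<close>: since \<open>\<Delta>\<close> is
  multiplicative and \<open>A\<close> is graded commutative, the behaviour of \<open>f \<star> g\<close> on a product \<open>x y\<close> is
  determined by that of \<open>f\<close> and \<open>g\<close>.  For a derivation \<open>\<upsilon>\<close> along \<open>e\<close> the divided powers of \<open>\<upsilon>\<close>
  then satisfy the binomial formula, which makes \<open>exp \<upsilon>\<close> multiplicative.  For an algebra map \<open>g\<close>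
  all convolution powers \<open>exp (n ln g)\<close> are multiplicative; this is a polynomial identity in \<open>n\<close>,
  whose linear part says that \<open>ln g\<close> is a derivation along \<open>e\<close>.

  Homotopies are reduced to the strict statement by the path algebra \<open>A[t, dt]\<close>, which is again a
  cdg-algebra: a homotopy pair \<open>(f(t), \<xi>(t))\<close> is the same thing as a morphism \<open>f(t) + dt \<xi>(t)\<close> into
  \<open>A[t, dt]\<close>, and likewise for \<open>THom\<close>.  Its endpoints are obtained by composing with the morphisms
  \<open>A[t, dt] \<rightarrow> A\<close> of evaluation at \<open>0\<close> and \<open>1\<close>.  A construction that is defined for every target
  and natural for morphisms of targets therefore preserves homotopy: apply it to the path and
  evaluate.  This covers composition, exp and ln, and the theorem follows by passing to
  equivalence classes.
\<close>

section \<open>Linear functionals on tensor powers\<close>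

lemma lin_ext_superset:
  assumes "vector_space s" "finite S" "Poly_Mapping.keys p \<subseteq> S"
  shows "lin_ext s h p = (\<Sum>w\<in>S. s (Poly_Mapping.lookup p w) (h w))"
proof -
  interpret vector_space s by fact
  show ?thesis
    unfolding lin_ext_def using assms(2,3)
    by (intro sum.mono_neutral_left) (auto simp: in_keys_iff)
qed

lemma lin_ext_cong:
  "(\<And>w. w \<in> Poly_Mapping.keys p \<Longrightarrow> h w = h' w) \<Longrightarrow> lin_ext s h p = lin_ext s h' p"
  by (simp add: lin_ext_def)

lemma lin_ext_zero [simp]: "lin_ext s h 0 = 0"
  by (simp add: lin_ext_def)

lemma keys_fscale: "Poly_Mapping.keys (fscale c p) \<subseteq> Poly_Mapping.keys p"
  by (auto simp: in_keys_iff)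

context vector_space
begin

lemma lin_ext_pure [simp]: "lin_ext scale h (pure w) = h w"
  by (simp add: lin_ext_def pure_def)

lemma lin_ext_add: "lin_ext scale h (p + q) = lin_ext scale h p + lin_ext scale h q"
proof -
  let ?S = "Poly_Mapping.keys p \<union> Poly_Mapping.keys q"
  have "Poly_Mapping.keys (p + q) \<subseteq> ?S" by (rule Poly_Mapping.keys_add)
  then show ?thesis
    using lin_ext_superset[OF vector_space_axioms, of ?S]
    by (simp add: lookup_add scale_left_distrib sum.distrib)
qed

lemma lin_ext_fscale: "lin_ext scale h (fscale c p) = scale c (lin_ext scale h p)"
  using lin_ext_superset[OF vector_space_axioms finite_keys keys_fscale, of h c p]
  by (simp add: lin_ext_def scale_sum_right)

lemma lin_ext_diff: "lin_ext scale h (p - q) = lin_ext scale h p - lin_ext scale h q"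
  using lin_ext_add[of h "p - q" q] by simp

lemma lin_ext_sum: "lin_ext scale h (\<Sum>i\<in>I. P i) = (\<Sum>i\<in>I. lin_ext scale h (P i))"
  by (induction I rule: infinite_finite_induct) (simp_all add: lin_ext_add)

lemma lin_ext_fun_add: "lin_ext scale (\<lambda>w. h w + h' w) p = lin_ext scale h p + lin_ext scale h' p"
  by (simp add: lin_ext_def scale_right_distrib sum.distrib)

lemma lin_ext_fun_zero: "lin_ext scale (\<lambda>w. 0) p = 0"
  by (simp add: lin_ext_def)

lemma lin_ext_fun_scale: "lin_ext scale (\<lambda>w. scale c (h w)) p = scale c (lin_ext scale h p)"
  by (simp add: lin_ext_def scale_sum_right mult.commute)

lemma lin_ext_fun_sum: "lin_ext scale (\<lambda>w. \<Sum>i\<in>I. h i w) p = (\<Sum>i\<in>I. lin_ext scale (h i) p)"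
  by (induction I rule: infinite_finite_induct) (simp_all add: lin_ext_fun_add lin_ext_fun_zero)

lemma lin_ext_lin_ext:
  "lin_ext scale h (lin_ext fscale H p) = lin_ext scale (\<lambda>w. lin_ext scale h (H w)) p"
  by (simp add: lin_ext_def[of fscale] lin_ext_sum lin_ext_fscale) (simp add: lin_ext_def)

lemma lin_ext_tconc:
  "lin_ext scale h (tconc p q) = lin_ext scale (\<lambda>u. lin_ext scale (\<lambda>w. h (u @ w)) q) p"
  by (simp add: tconc_def lin_ext_lin_ext)

lemma lin_ext_fmap: "lin_ext scale h (fmap g p) = lin_ext scale (\<lambda>w. h (map g w)) p"
  by (simp add: fmap_def lin_ext_lin_ext)

lemma lin_ext_in_subspace:
  "subspace S \<Longrightarrow> (\<And>w. w \<in> Poly_Mapping.keys p \<Longrightarrow> h w \<in> S) \<Longrightarrow> lin_ext scale h p \<in> S"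
  unfolding lin_ext_def by (intro subspace_sum subspace_scale)

end

lemma linear_lin_ext:
  assumes "Vector_Spaces.linear s s' f"
  shows "f (lin_ext s h p) = lin_ext s' (\<lambda>w. f (h w)) p"
proof -
  interpret Vector_Spaces.linear s s' f by fact
  show ?thesis by (simp add: lin_ext_def sum scale)
qed

definition multilinear :: "('k::field \<Rightarrow> 'v::ab_group_add \<Rightarrow> 'v) \<Rightarrow> ('k \<Rightarrow> 'u::ab_group_add \<Rightarrow> 'u) \<Rightarrow>
    ('v list \<Rightarrow> 'u) \<Rightarrow> bool" where
  "multilinear s s' h \<longleftrightarrow>
     (\<forall>u w x y. h (u @ (x + y) # w) = h (u @ x # w) + h (u @ y # w)) \<and>
     (\<forall>u w c x. h (u @ s c x # w) = s' c (h (u @ x # w)))"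

text \<open>The universal property of tensor powers: a multilinear map on words kills the relators,
  so its linear extension only depends on the tensor and not on its representative.\<close>

lemma lin_ext_tens_eq:
  assumes "vector_space s'" "multilinear s s' h" "tens_eq s p q"
  shows "lin_ext s' h p = lin_ext s' h q"
proof -
  interpret vector_space s' by fact
  interpret F: vector_space fscale by (rule vector_space_fscale)
  have "lin_ext s' h r = 0" if "r \<in> module.span fscale (multilinear_relators s)" for r
    using that
  proof (induction rule: F.span_induct_alt)
    case base then show ?case by simp
  next
    case (step c x y)
    then have "lin_ext s' h x = 0"
      using assms(2)
      by (auto simp: multilinear_relators_def multilinear_def lin_ext_diff lin_ext_fscale)
    with step show ?case by (simp add: lin_ext_add lin_ext_fscale)
  qed
  from this[of "p - q"] assms(3) show ?thesis
    by (simp add: tens_eq_def lin_ext_diff)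
qed

definition bilinear_map :: "('k::field \<Rightarrow> 'v::ab_group_add \<Rightarrow> 'v) \<Rightarrow> ('k \<Rightarrow> 'u::ab_group_add \<Rightarrow> 'u) \<Rightarrow>
    ('v \<Rightarrow> 'v \<Rightarrow> 'u) \<Rightarrow> bool" where
  "bilinear_map s s' \<beta> \<longleftrightarrow>
     (\<forall>x y z. \<beta> (x + y) z = \<beta> x z + \<beta> y z) \<and> (\<forall>x y z. \<beta> x (y + z) = \<beta> x y + \<beta> x z) \<and>
     (\<forall>c x y. \<beta> (s c x) y = s' c (\<beta> x y)) \<and> (\<forall>c x y. \<beta> x (s c y) = s' c (\<beta> x y))"

text \<open>The relators involve words of every length, so \<open>lin_ext_tens_eq\<close> needs functionals that are
  multilinear on all words; extending by zero achieves this.\<close>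

definition on_pairs :: "('v \<Rightarrow> 'v \<Rightarrow> 'u::zero) \<Rightarrow> 'v list \<Rightarrow> 'u" where
  "on_pairs \<beta> w = (case w of [a, b] \<Rightarrow> \<beta> a b | _ \<Rightarrow> 0)"

definition on_triples :: "('v \<Rightarrow> 'v \<Rightarrow> 'v \<Rightarrow> 'u::zero) \<Rightarrow> 'v list \<Rightarrow> 'u" where
  "on_triples \<tau> w = (case w of [a, b, c] \<Rightarrow> \<tau> a b c | _ \<Rightarrow> 0)"

lemma on_pairs_simps [simp]:
  "on_pairs \<beta> [] = 0" "on_pairs \<beta> [a] = 0" "on_pairs \<beta> [a, b] = \<beta> a b" "on_pairs \<beta> (a # b # c # w) = 0"
  by (simp_all add: on_pairs_def)

lemma on_triples_simps [simp]:
  "on_triples \<tau> [] = 0" "on_triples \<tau> [a] = 0" "on_triples \<tau> [a, b] = 0"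
  "on_triples \<tau> [a, b, c] = \<tau> a b c" "on_triples \<tau> (a # b # c # d # w) = 0"
  by (simp_all add: on_triples_def)

lemma multilinear_on_pairs:
  assumes "vector_space s'" "bilinear_map s s' \<beta>"
  shows "multilinear s s' (on_pairs \<beta>)"
proof -
  interpret vector_space s' by fact
  have "on_pairs \<beta> (u @ (x + y) # w) = on_pairs \<beta> (u @ x # w) + on_pairs \<beta> (u @ y # w) \<and>
     on_pairs \<beta> (u @ s c x # w) = s' c (on_pairs \<beta> (u @ x # w))" for u w x y c
    using assms(2)
    by (cases u; cases "tl u"; cases w; cases "tl w") (auto simp: bilinear_map_def on_pairs_def split: list.split)
  then show ?thesis unfolding multilinear_def by blast
qed

lemma multilinear_on_triples:
  assumes "vector_space s'" "\<And>x. bilinear_map s s' (\<tau> x)" "\<And>z. bilinear_map s s' (\<lambda>x y. \<tau> x y z)"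
  shows "multilinear s s' (on_triples \<tau>)"
proof -
  interpret vector_space s' by fact
  have "on_triples \<tau> (u @ (x + y) # w) = on_triples \<tau> (u @ x # w) + on_triples \<tau> (u @ y # w) \<and>
     on_triples \<tau> (u @ s c x # w) = s' c (on_triples \<tau> (u @ x # w))" for u w x y c
    using assms(2,3)
    by (cases u; cases "tl u"; cases "tl (tl u)"; cases w; cases "tl w"; cases "tl (tl w)")
      (auto simp: bilinear_map_def on_triples_def split: list.split)
  then show ?thesis unfolding multilinear_def by blast
qed

lemma ftens_pow_2_cases:
  assumes "p \<in> ftens_pow 2" "w \<in> Poly_Mapping.keys p"
  obtains a b where "w = [a, b]"
proof -
  from assms have "length w = 2" by (simp add: ftens_pow_def)
  then show thesis using that by (auto simp: numeral_2_eq_2 length_Suc_conv)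
qed

lemma lin_ext2_cong:
  assumes "p \<in> ftens_pow 2" "\<And>a b. [a, b] \<in> Poly_Mapping.keys p \<Longrightarrow> \<beta> a b = \<beta>' a b"
  shows "lin_ext2 s \<beta> p = lin_ext2 s \<beta>' p"
  unfolding lin_ext2_def
proof (rule lin_ext_cong)
  fix w assume "w \<in> Poly_Mapping.keys p"
  with assms(1) obtain a b where "w = [a, b]" by (rule ftens_pow_2_cases)
  with assms(2) \<open>w \<in> _\<close> show "\<beta> (w ! 0) (w ! 1) = \<beta>' (w ! 0) (w ! 1)" by simp
qed

lemma lin_ext_eq_lin_ext2:
  assumes "p \<in> ftens_pow 2" "\<And>a b. h [a, b] = \<beta> a b"
  shows "lin_ext s h p = lin_ext2 s \<beta> p"
  unfolding lin_ext2_def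
proof (rule lin_ext_cong)
  fix w assume "w \<in> Poly_Mapping.keys p"
  with assms(1) obtain a b where "w = [a, b]" by (rule ftens_pow_2_cases)
  with assms(2) show "h w = \<beta> (w ! 0) (w ! 1)" by simp
qed

lemma lin_ext2_eq_on_pairs: "p \<in> ftens_pow 2 \<Longrightarrow> lin_ext2 s \<beta> p = lin_ext s (on_pairs \<beta>) p"
  by (rule lin_ext_eq_lin_ext2[symmetric]) simp_all

text \<open>A second representative of a tensor in the second power may involve words of length other than
  two, on which \<open>lin_ext2\<close> is meaningless; hence \<open>on_pairs\<close> on the right-hand side.\<close>

lemma lin_ext2_tens_eq:
  assumes "vector_space s'" "bilinear_map s s' \<beta>" "tens_eq s p q" "p \<in> ftens_pow 2"
  shows "lin_ext2 s' \<beta> p = lin_ext s' (on_pairs \<beta>) q"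
  using lin_ext_tens_eq[OF assms(1) multilinear_on_pairs[OF assms(1,2)] assms(3)]
  by (simp add: lin_ext2_eq_on_pairs[OF assms(4)])

context vector_space
begin

lemma lin_ext_tens_map:
  "lin_ext scale h (tens_map F G p) =
     lin_ext2 scale (\<lambda>a b. lin_ext scale (\<lambda>u. lin_ext scale (\<lambda>w. h (u @ w)) (G b)) (F a)) p"
  by (simp add: tens_map_def lin_ext2_def lin_ext_lin_ext lin_ext_tconc)

lemma lin_ext_lin_ext2:
  "lin_ext scale h (lin_ext2 fscale \<beta> p) = lin_ext2 scale (\<lambda>a b. lin_ext scale h (\<beta> a b)) p"
  by (simp add: lin_ext2_def lin_ext_lin_ext)

lemma lin_ext2_fun_scale:
  "lin_ext2 scale (\<lambda>a b. scale c (\<beta> a b)) p = scale c (lin_ext2 scale \<beta> p)"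
  by (simp add: lin_ext2_def lin_ext_fun_scale)

lemma lin_ext2_fun_sum:
  "lin_ext2 scale (\<lambda>a b. \<Sum>i\<in>I. \<beta> i a b) p = (\<Sum>i\<in>I. lin_ext2 scale (\<beta> i) p)"
  by (simp add: lin_ext2_def lin_ext_fun_sum)

end

lemma linear_lin_ext2:
  "Vector_Spaces.linear s s' f \<Longrightarrow> f (lin_ext2 s \<beta> p) = lin_ext2 s' (\<lambda>a b. f (\<beta> a b)) p"
  by (simp add: lin_ext2_def linear_lin_ext)

section \<open>Graded spaces\<close>

context graded_space
begin

lemma is_decomposition_hcomp: "is_decomposition G x (hcomp G x)"
  unfolding hcomp_def by (rule theI'[OF direct_sum])

lemma hcomp_in: "hcomp G x i \<in> G i"
  and finite_hcomp: "finite {i. hcomp G x i \<noteq> 0}"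
  and sum_hcomp: "(\<Sum>i | hcomp G x i \<noteq> 0. hcomp G x i) = x"
  using is_decomposition_hcomp[of x] unfolding is_decomposition_def by auto

lemma sum_hcomp_superset:
  "finite S \<Longrightarrow> {i. hcomp G x i \<noteq> 0} \<subseteq> S \<Longrightarrow> (\<Sum>i\<in>S. hcomp G x i) = x"
  by (subst (2) sum_hcomp[symmetric], rule sum.mono_neutral_right) auto

text \<open>Components are computed by exhibiting any homogeneous decomposition; the index set \<open>S\<close> need not
  be the exact support.\<close>

lemma hcomp_unique:
  assumes "\<And>i. c i \<in> G i" "finite S" "\<And>i. i \<notin> S \<Longrightarrow> c i = 0" "x = (\<Sum>i\<in>S. c i)"
  shows "hcomp G x = c"
proof -
  have "{i. c i \<noteq> 0} \<subseteq> S" using assms(3) by auto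
  then have "is_decomposition G x c"
    unfolding is_decomposition_def
    using assms by (auto intro: finite_subset sum.mono_neutral_right)
  then show ?thesis using direct_sum[of x] is_decomposition_hcomp[of x] by blast
qed

lemma grade_zero [simp]: "0 \<in> G i"
  and grade_add: "x \<in> G i \<Longrightarrow> y \<in> G i \<Longrightarrow> x + y \<in> G i"
  and grade_scale: "x \<in> G i \<Longrightarrow> s c x \<in> G i"
  and grade_diff: "x \<in> G i \<Longrightarrow> y \<in> G i \<Longrightarrow> x - y \<in> G i"
  and grade_sum: "(\<And>j. j \<in> J \<Longrightarrow> f j \<in> G i) \<Longrightarrow> sum f J \<in> G i"
  using subspace_grade[of i]
  by (auto intro: subspace_0 subspace_add subspace_scale subspace_diff subspace_sum)

lemma hcomp_homogeneous: "x \<in> G i \<Longrightarrow> hcomp G x j = (if j = i then x else 0)"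
  by (rule fun_cong[OF hcomp_unique[where S = "{i}"]]) auto

lemma hcomp_add: "hcomp G (x + y) i = hcomp G x i + hcomp G y i"
proof -
  let ?S = "{i. hcomp G x i \<noteq> 0} \<union> {i. hcomp G y i \<noteq> 0}"
  have fin: "finite ?S" by (simp add: finite_hcomp)
  have "(\<Sum>i\<in>?S. hcomp G x i) = x" "(\<Sum>i\<in>?S. hcomp G y i) = y"
    using fin by (auto intro!: sum_hcomp_superset)
  then have "x + y = (\<Sum>i\<in>?S. hcomp G x i + hcomp G y i)" by (simp add: sum.distrib)
  then show ?thesis
    by (intro fun_cong[OF hcomp_unique[where S = ?S]]) (use fin in \<open>auto intro: grade_add hcomp_in\<close>)
qed

lemma hcomp_scale: "hcomp G (s c x) i = s c (hcomp G x i)"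
  by (rule fun_cong[OF hcomp_unique[where S = "{i. hcomp G x i \<noteq> 0}"]])
    (auto intro: grade_scale hcomp_in finite_hcomp simp: sum_hcomp simp flip: scale_sum_right)

lemma hcomp_zero [simp]: "hcomp G 0 i = 0"
  by (subst hcomp_homogeneous[of 0 i]) auto

lemma graded_induct [case_names homogeneous add]:
  assumes "\<And>i x. x \<in> G i \<Longrightarrow> P x" "\<And>x y. P x \<Longrightarrow> P y \<Longrightarrow> P (x + y)"
  shows "P x"
proof -
  have "P (\<Sum>i\<in>S. hcomp G x i)" if "finite S" for S
    using that
    by (induction S rule: finite_induct) (auto intro: assms hcomp_in assms(1)[of 0 0])
  from this[OF finite_hcomp[of x]] show ?thesis by (simp add: sum_hcomp)
qed

end

text \<open>The grading involution \<open>x \<mapsto> (-1)^|x| x\<close> turns the Koszul signs for homogeneous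
  elements into identities valid for all elements.\<close>

definition gr_inv :: "('k::field \<Rightarrow> 'v::ab_group_add \<Rightarrow> 'v) \<Rightarrow> (int \<Rightarrow> 'v set) \<Rightarrow> 'v \<Rightarrow> 'v" where
  "gr_inv s G x = (\<Sum>i | hcomp G x i \<noteq> 0. s ((- 1) powi i) (hcomp G x i))"

context graded_space
begin

lemma gr_inv_superset:
  "finite S \<Longrightarrow> {i. hcomp G x i \<noteq> 0} \<subseteq> S \<Longrightarrow>
     gr_inv s G x = (\<Sum>i\<in>S. s ((- 1) powi i) (hcomp G x i))"
  unfolding gr_inv_def by (rule sum.mono_neutral_left) auto

lemma gr_inv_homogeneous: "x \<in> G i \<Longrightarrow> gr_inv s G x = s ((- 1) powi i) x"
  by (subst gr_inv_superset[where S = "{i}"]) (auto simp: hcomp_homogeneous split: if_splits)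

lemma gr_inv_add: "gr_inv s G (x + y) = gr_inv s G x + gr_inv s G y"
proof -
  let ?S = "{i. hcomp G x i \<noteq> 0} \<union> {i. hcomp G y i \<noteq> 0}"
  have "finite ?S" by (simp add: finite_hcomp)
  then show ?thesis
    by (subst (1 2 3) gr_inv_superset[where S = ?S])
      (auto simp: hcomp_add scale_right_distrib sum.distrib)
qed

lemma gr_inv_scale: "gr_inv s G (s c x) = s c (gr_inv s G x)"
  by (subst (1 2) gr_inv_superset[where S = "{i. hcomp G x i \<noteq> 0}"])
    (auto simp: hcomp_scale finite_hcomp scale_sum_right mult.commute)

lemma gr_inv_zero [simp]: "gr_inv s G 0 = 0"
  by (simp add: gr_inv_def)

lemma gr_inv_in: "x \<in> G i \<Longrightarrow> gr_inv s G x \<in> G i"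
  by (simp add: gr_inv_homogeneous grade_scale)

end

section \<open>Cdg-algebras and their morphisms\<close>

context cdg_algebra
begin

abbreviation mul (infixl "\<cdot>" 70) where "x \<cdot> y \<equiv> amult A x y"
abbreviation gi where "gi \<equiv> gr_inv (vscale A) (grade A)"

lemma diff_linear: "Vector_Spaces.linear (vscale A) (vscale A) (adiff A)"
  and diff_grade: "x \<in> grade A i \<Longrightarrow> adiff A x \<in> grade A (i + 1)"
  using diff_deg by (auto simp: Hom_deg_def)

lemma diff_add: "adiff A (x + y) = adiff A x + adiff A y"
  and diff_scale: "adiff A (vscale A c x) = vscale A c (adiff A x)"
  using diff_linear by (auto simp: Vector_Spaces.linear_iff)

lemma diff_zero [simp]: "adiff A 0 = 0"
  using diff_add[of 0 0] by simp

lemma diff_minus: "adiff A (x - y) = adiff A x - adiff A y"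
  using diff_add[of "x - y" y] by simp

lemma mult_linear_left: "Vector_Spaces.linear (vscale A) (vscale A) (\<lambda>x. x \<cdot> y)"
  and mult_linear_right: "Vector_Spaces.linear (vscale A) (vscale A) (\<lambda>y. x \<cdot> y)"
  by (simp_all add: Vector_Spaces.linear_iff vector_space_axioms mult_add_left mult_add_right
      mult_scale_left mult_scale_right)

lemma mult_zero_left [simp]: "0 \<cdot> x = 0"
  using mult_add_left[of 0 0 x] by simp

lemma mult_zero_right [simp]: "x \<cdot> 0 = 0"
  using mult_add_right[of x 0 0] by simp

lemma mult_diff_left: "(x - y) \<cdot> z = x \<cdot> z - y \<cdot> z"
  using mult_add_left[of "x - y" y z] by simp

lemma mult_diff_right: "x \<cdot> (y - z) = x \<cdot> y - x \<cdot> z"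
  using mult_add_right[of x "y - z" z] by simp

lemma mult_sum_left: "(\<Sum>i\<in>I. f i) \<cdot> y = (\<Sum>i\<in>I. f i \<cdot> y)"
  by (induction I rule: infinite_finite_induct) (simp_all add: mult_add_left)

lemma mult_sum_right: "y \<cdot> (\<Sum>i\<in>I. f i) = (\<Sum>i\<in>I. y \<cdot> f i)"
  by (induction I rule: infinite_finite_induct) (simp_all add: mult_add_right)

lemma leibniz_gi: "adiff A (x \<cdot> y) = adiff A x \<cdot> y + gi x \<cdot> adiff A y"
proof (induction x rule: graded_induct)
  case (homogeneous i x)
  then show ?case by (simp add: leibniz gr_inv_homogeneous mult_scale_left)
next
  case (add x x')
  then show ?case by (simp add: mult_add_left diff_add gr_inv_add algebra_simps)
qed

lemma gi_mult: "gi (x \<cdot> y) = gi x \<cdot> gi y"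
proof (induction x rule: graded_induct)
  case (homogeneous i x)
  show ?case
  proof (induction y rule: graded_induct)
    case (homogeneous j y)
    with \<open>x \<in> grade A i\<close> show ?case
      using gr_inv_homogeneous[OF mult_deg[of x i y j]]
      by (simp add: gr_inv_homogeneous mult_scale_left mult_scale_right power_int_add mult.commute)
  next
    case (add y y')
    then show ?case by (simp add: mult_add_right gr_inv_add)
  qed
next
  case (add x x')
  then show ?case by (simp add: mult_add_left gr_inv_add)
qed

lemma gi_unit [simp]: "gi (aunit A) = aunit A"
  using gr_inv_homogeneous[OF unit_deg] by simp

lemma diff_unit [simp]: "adiff A (aunit A) = 0"
  using leibniz_gi[of "aunit A" "aunit A"] by (simp add: mult_unit_left mult_unit_right)

end

lemma Hom_deg_linearD: "f \<in> Hom_deg A A' k \<Longrightarrow> Vector_Spaces.linear (vscale A) (vscale A') f"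
  and Hom_deg_gradeD: "f \<in> Hom_deg A A' k \<Longrightarrow> x \<in> grade A i \<Longrightarrow> f x \<in> grade A' (i + k)"
  by (auto simp: Hom_deg_def)

lemma Hom_cdgA_iff:
  assumes "cdg_algebra A'"
  shows "f \<in> Hom_cdgA A A' \<longleftrightarrow> f \<in> Hom_deg A A' 0 \<and> (\<forall>x. adiff A' (f x) = f (adiff A x)) \<and>
    f (aunit A) = aunit A' \<and> (\<forall>x y. f (amult A x y) = amult A' (f x) (f y))"
proof -
  interpret cdg_algebra A' by fact
  show ?thesis by (simp add: Hom_cdgA_def Hom_diff_def fun_eq_iff)
qed

lemma THom_cdgA_iff:
  assumes "cdg_algebra A"
  shows "\<upsilon> \<in> THom_cdgA B A \<longleftrightarrow>
    \<upsilon> \<in> Hom_deg B A 0 \<and> (\<forall>x. adiff A (\<upsilon> x) = \<upsilon> (adiff B x)) \<and> \<upsilon> (aunit B) = 0 \<and>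
    (\<forall>x y. \<upsilon> (amult B x y) = amult A (conv_unit B A x) (\<upsilon> y) + amult A (\<upsilon> x) (conv_unit B A y))"
proof -
  interpret cdg_algebra A by fact
  have "(\<forall>c. \<upsilon> (unit_map B c) = 0) \<longleftrightarrow> \<upsilon> (aunit B) = 0" if "\<upsilon> \<in> Hom_deg B A 0"
  proof -
    interpret Vector_Spaces.linear "vscale B" "vscale A" \<upsilon> using that by (rule Hom_deg_linearD)
    show ?thesis by (auto simp: unit_map_def scale dest: spec[of _ 1])
  qed
  then show ?thesis by (auto simp: THom_cdgA_def Hom_diff_def fun_eq_iff)
qed

lemma Hom_deg_comp:
  assumes "f \<in> Hom_deg A A' 0" "g \<in> Hom_deg A' A'' 0"
  shows "g \<circ> f \<in> Hom_deg A A'' 0"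
  using assms Vector_Spaces.linear_compose[of "vscale A" "vscale A'" f "vscale A''" g]
  by (force simp: Hom_deg_def)

lemma Hom_cdgA_comp:
  assumes "cdg_algebra A'" "cdg_algebra A''" "f \<in> Hom_cdgA A A'" "g \<in> Hom_cdgA A' A''"
  shows "g \<circ> f \<in> Hom_cdgA A A''"
  using assms by (auto simp: Hom_cdgA_iff intro: Hom_deg_comp)

lemma Hom_cdgA_unit_map:
  assumes "cdg_algebra A'" "f \<in> Hom_cdgA A A'"
  shows "f (unit_map A c) = unit_map A' c"
  using assms by (simp add: Hom_cdgA_iff unit_map_def Hom_deg_def Vector_Spaces.linear_iff)

lemma Hom_THom_comp:
  assumes "cdg_algebra A" "cdg_algebra A'" "\<upsilon> \<in> THom_cdgA B A" "f \<in> Hom_cdgA A A'"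
  shows "f \<circ> \<upsilon> \<in> THom_cdgA B A'"
proof -
  have f: "f \<in> Hom_deg A A' 0" and \<upsilon>: "\<upsilon> \<in> Hom_deg B A 0"
    using assms by (auto simp: Hom_cdgA_iff THom_cdgA_iff)
  interpret Vector_Spaces.linear "vscale A" "vscale A'" f using f by (rule Hom_deg_linearD)
  have "f (conv_unit B A x) = conv_unit B A' x" for x
    unfolding conv_unit_def by (rule Hom_cdgA_unit_map[OF assms(2,4)])
  then show ?thesis
    using assms Hom_deg_comp[OF \<upsilon> f] by (auto simp: Hom_cdgA_iff THom_cdgA_iff add zero)
qed

section \<open>The path algebra \<open>A[t, dt]\<close>\<close>

lemma Cauchy_sum_rev: "(\<Sum>i=0..n. f i (n - i)) = (\<Sum>i=0..n. f (n - i) (i::nat))"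
  by (subst sum.atLeastAtMost_rev) simp

lemma finite_Cauchy_support:
  fixes p q :: "nat \<Rightarrow>\<^sub>0 'v::zero"
  assumes "\<And>i j. i \<notin> Poly_Mapping.keys p \<or> j \<notin> Poly_Mapping.keys q \<Longrightarrow> f i j = (0::'u::comm_monoid_add)"
  shows "finite {n. (\<Sum>i=0..n. f i (n - i)) \<noteq> 0}"
proof (rule finite_subset)
  show "{n. (\<Sum>i=0..n. f i (n - i)) \<noteq> 0} \<subseteq>
      (\<lambda>(i, j). i + j) ` (Poly_Mapping.keys p \<times> Poly_Mapping.keys q)"
  proof
    fix n assume "n \<in> {n. (\<Sum>i=0..n. f i (n - i)) \<noteq> 0}"
    then obtain i where "i \<in> {0..n}" "f i (n - i) \<noteq> 0"
      by (auto elim: sum.not_neutral_contains_not_neutral)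
    with assms[of i "n - i"] show "n \<in> (\<lambda>(i, j). i + j) ` (Poly_Mapping.keys p \<times> Poly_Mapping.keys q)"
      by (intro image_eqI[of _ _ "(i, n - i)"]) auto
  qed
qed simp

lemma finite_lookup_mono:
  "(\<And>n. Poly_Mapping.lookup p n = 0 \<Longrightarrow> f n = 0) \<Longrightarrow> finite {n. f n \<noteq> 0}"
  by (rule finite_subset[OF _ finite_lookup[of p]]) auto

lemma lookup_Abs:
  "finite {n. f n \<noteq> 0} \<Longrightarrow> Poly_Mapping.lookup (Abs_poly_mapping f) n = f n"
  by simp

text \<open>A pair \<open>(p, q)\<close> stands for \<open>p(t) + dt q(t)\<close>.  With \<open>dt\<close> on the left, moving a factor
  past \<open>dt\<close> costs the grading involution, and the multiplicativity of \<open>x \<mapsto> f(t)(x) + dt \<xi>(t)(x)\<close>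
  is literally the product condition for a homotopy pair.\<close>

type_synonym 'a path = "(nat \<Rightarrow>\<^sub>0 'a) \<times> (nat \<Rightarrow>\<^sub>0 'a)"

abbreviation fn_part :: "'a::zero path \<Rightarrow> nat \<Rightarrow> 'a" where
  "fn_part x n \<equiv> Poly_Mapping.lookup (fst x) n"

abbreviation form_part :: "'a::zero path \<Rightarrow> nat \<Rightarrow> 'a" where
  "form_part x n \<equiv> Poly_Mapping.lookup (snd x) n"

definition path_mult ::
  "('k::field, 'a::ab_group_add, 'm) cdga_scheme \<Rightarrow> 'a path \<Rightarrow> 'a path \<Rightarrow> 'a path" where
  "path_mult A x y =
     (Abs_poly_mapping (\<lambda>n. \<Sum>i=0..n. amult A (fn_part x i) (fn_part y (n - i))),
      Abs_poly_mapping (\<lambda>n. \<Sum>i=0..n.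
        amult A (gr_inv (vscale A) (grade A) (fn_part x i)) (form_part y (n - i))) +
      Abs_poly_mapping (\<lambda>n. \<Sum>i=0..n. amult A (form_part x i) (fn_part y (n - i))))"

definition path_diff ::
  "('k::field, 'a::ab_group_add, 'm) cdga_scheme \<Rightarrow> 'a path \<Rightarrow> 'a path" where
  "path_diff A x =
     (Abs_poly_mapping (\<lambda>n. adiff A (fn_part x n)),
      Abs_poly_mapping (\<lambda>n. vscale A (of_nat (Suc n)) (fn_part x (Suc n))) -
      Abs_poly_mapping (\<lambda>n. adiff A (form_part x n)))"

definition path_algebra ::
  "('k::field, 'a::ab_group_add, 'm) cdga_scheme \<Rightarrow> ('k, 'a path) cdga" where
  "path_algebra A =
     \<lparr>vscale = (\<lambda>c x. (Abs_poly_mapping (\<lambda>n. vscale A c (fn_part x n)),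
                       Abs_poly_mapping (\<lambda>n. vscale A c (form_part x n)))),
      grade = (\<lambda>i. {x. \<forall>n. fn_part x n \<in> grade A i \<and> form_part x n \<in> grade A (i - 1)}),
      aunit = (Poly_Mapping.single 0 (aunit A), 0),
      amult = path_mult A,
      adiff = path_diff A\<rparr>"

lemma path_eqI:
  "(\<And>n. fn_part x n = fn_part y n) \<Longrightarrow> (\<And>n. form_part x n = form_part y n) \<Longrightarrow> x = y"
  by (auto intro!: prod_eqI poly_mapping_eqI)

lemma path_eq_iff: "x = y \<longleftrightarrow> (\<forall>n. fn_part x n = fn_part y n \<and> form_part x n = form_part y n)"
  by (auto intro: path_eqI)

lemma grade_path:
  "x \<in> grade (path_algebra A) i \<longleftrightarrow> (\<forall>n. fn_part x n \<in> grade A i \<and> form_part x n \<in> grade A (i - 1))"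
  by (simp add: path_algebra_def)

lemma fn_part_unit [simp]: "fn_part (aunit (path_algebra A)) n = (if n = 0 then aunit A else 0)"
  and form_part_unit [simp]: "form_part (aunit (path_algebra A)) n = 0"
  by (auto simp: path_algebra_def lookup_single)

lemma fn_part_sum: "fn_part (sum f I) n = (\<Sum>i\<in>I. fn_part (f i) n)"
  and form_part_sum: "form_part (sum f I) n = (\<Sum>i\<in>I. form_part (f i) n)"
  by (induction I rule: infinite_finite_induct) (simp_all add: lookup_add)

context cdg_algebra
begin

abbreviation P where "P \<equiv> path_algebra A"

lemma fn_part_scale [simp]: "fn_part (vscale P c x) n = vscale A c (fn_part x n)"
  by (simp add: path_algebra_def)

lemma form_part_scale [simp]: "form_part (vscale P c x) n = vscale A c (form_part x n)"
  by (simp add: path_algebra_def)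

lemma fn_part_mult: "fn_part (amult P x y) n = (\<Sum>i=0..n. fn_part x i \<cdot> fn_part y (n - i))"
proof -
  have "finite {n. (\<Sum>i=0..n. fn_part x i \<cdot> fn_part y (n - i)) \<noteq> 0}"
    by (rule finite_Cauchy_support[where p = "fst x" and q = "fst y"]) (auto simp: in_keys_iff)
  then show ?thesis by (simp add: path_algebra_def path_mult_def)
qed

lemma form_part_mult:
  "form_part (amult P x y) n =
     (\<Sum>i=0..n. gi (fn_part x i) \<cdot> form_part y (n - i) + form_part x i \<cdot> fn_part y (n - i))"
proof -
  have "finite {n. (\<Sum>i=0..n. gi (fn_part x i) \<cdot> form_part y (n - i)) \<noteq> 0}"
    by (rule finite_Cauchy_support[where p = "fst x" and q = "snd y"]) (auto simp: in_keys_iff)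
  moreover have "finite {n. (\<Sum>i=0..n. form_part x i \<cdot> fn_part y (n - i)) \<noteq> 0}"
    by (rule finite_Cauchy_support[where p = "snd x" and q = "fst y"]) (auto simp: in_keys_iff)
  ultimately show ?thesis by (simp add: path_algebra_def path_mult_def lookup_add sum.distrib)
qed

lemma fn_part_diff [simp]: "fn_part (adiff P x) n = adiff A (fn_part x n)"
  unfolding path_algebra_def path_diff_def
  by (simp, subst lookup_Abs, rule finite_lookup_mono[where p = "fst x"]) auto

lemma form_part_diff:
  "form_part (adiff P x) n =
     vscale A (of_nat (Suc n)) (fn_part x (Suc n)) - adiff A (form_part x n)"
proof -
  have "finite (Suc -` {n. fn_part x n \<noteq> 0})"
    by (intro finite_vimageI finite_lookup) simp
  then have "finite {n. vscale A (of_nat (Suc n)) (fn_part x (Suc n)) \<noteq> 0}"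
    by (rule finite_subset[rotated]) auto
  moreover have "finite {n. adiff A (form_part x n) \<noteq> 0}"
    by (rule finite_lookup_mono[where p = "snd x"]) auto
  ultimately show ?thesis
    by (simp add: path_algebra_def path_diff_def lookup_minus del: of_nat_Suc)
qed

lemma vector_space_path: "vector_space (vscale P)"
proof
  fix a b x y
  show "vscale P a (x + y) = vscale P a x + vscale P a y"
    by (rule path_eqI) (simp_all add: lookup_add scale_right_distrib)
  show "vscale P (a + b) x = vscale P a x + vscale P b x"
    by (rule path_eqI) (simp_all add: lookup_add scale_left_distrib)
  show "vscale P a (vscale P b x) = vscale P (a * b) x"
    by (rule path_eqI) simp_all
  show "vscale P 1 x = x"
    by (rule path_eqI) simp_all
qed

text \<open>Decompositions are taken coefficient by coefficient.  As \<open>dt\<close> has degree 1, the component of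
  degree \<open>i\<close> of the form part consists of the components of degree \<open>i - 1\<close> of its coefficients.\<close>

lemma graded_space_path: "graded_space (vscale P) (grade P)"
proof -
  interpret P: vector_space "vscale P" by (rule vector_space_path)
  show ?thesis
  proof unfold_locales
    fix i
    show "P.subspace (grade P i)"
      unfolding P.subspace_def
      by (auto simp: grade_path lookup_add intro: grade_add grade_scale)
  next
    fix x :: "'a path"
    define S where "S = (\<Union>n\<in>Poly_Mapping.keys (fst x). {i. hcomp (grade A) (fn_part x n) i \<noteq> 0}) \<union>
      (\<Union>n\<in>Poly_Mapping.keys (snd x). {i. hcomp (grade A) (form_part x n) (i - 1) \<noteq> 0})"
    define c where "c i = (Abs_poly_mapping (\<lambda>n. hcomp (grade A) (fn_part x n) i),
        Abs_poly_mapping (\<lambda>n. hcomp (grade A) (form_part x n) (i - 1)))" for i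
    have fn: "fn_part (c i) n = hcomp (grade A) (fn_part x n) i" for i n
      unfolding c_def by (simp, subst lookup_Abs, rule finite_lookup_mono[where p = "fst x"]) auto
    have form: "form_part (c i) n = hcomp (grade A) (form_part x n) (i - 1)" for i n
      unfolding c_def by (simp, subst lookup_Abs, rule finite_lookup_mono[where p = "snd x"]) auto
    have "finite {i. hcomp (grade A) y (i - 1) \<noteq> 0}" for y
      using finite_vimageI[OF finite_hcomp[of y], of "\<lambda>i. i - 1"] by (simp add: vimage_def)
    then have "finite S" by (auto simp: S_def finite_hcomp)
    have S: "i \<in> S" if "hcomp (grade A) (fn_part x n) i \<noteq> 0 \<or> hcomp (grade A) (form_part x n) (i - 1) \<noteq> 0" for i n
    proof -
      from that show ?thesis
      proof
        assume *: "hcomp (grade A) (fn_part x n) i \<noteq> 0"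
        then have "n \<in> Poly_Mapping.keys (fst x)" by (auto simp: in_keys_iff)
        with * show ?thesis unfolding S_def by blast
      next
        assume *: "hcomp (grade A) (form_part x n) (i - 1) \<noteq> 0"
        then have "n \<in> Poly_Mapping.keys (snd x)" by (auto simp: in_keys_iff)
        with * show ?thesis unfolding S_def by blast
      qed
    qed
    have supp: "{i. c i \<noteq> 0} \<subseteq> S"
    proof
      fix i assume "i \<in> {i. c i \<noteq> 0}"
      then obtain n where "fn_part (c i) n \<noteq> 0 \<or> form_part (c i) n \<noteq> 0"
        by (metis (mono_tags, lifting) fst_zero lookup_zero mem_Collect_eq path_eqI snd_zero)
      then show "i \<in> S" using S fn form by auto
    qed
    have "x = (\<Sum>i\<in>S. c i)"
    proof (rule path_eqI)
      fix n
      show "fn_part x n = fn_part (sum c S) n"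
        unfolding fn_part_sum fn using S
        by (intro sum_hcomp_superset[symmetric] \<open>finite S\<close>) auto
      have "form_part (sum c S) n = (\<Sum>i\<in>S. hcomp (grade A) (form_part x n) (i - 1))"
        unfolding form_part_sum form ..
      also have "\<dots> = (\<Sum>i\<in>(\<lambda>i. i - 1) ` S. hcomp (grade A) (form_part x n) i)"
        by (subst sum.reindex) (auto simp: inj_on_def)
      also have "\<dots> = form_part x n"
      proof (rule sum_hcomp_superset)
        show "{i. hcomp (grade A) (form_part x n) i \<noteq> 0} \<subseteq> (\<lambda>i. i - 1) ` S"
        proof
          fix i assume "i \<in> {i. hcomp (grade A) (form_part x n) i \<noteq> 0}"
          then have "i + 1 \<in> S" using S[of n "i + 1"] by simp
          then show "i \<in> (\<lambda>i. i - 1) ` S" by force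
        qed
      qed (use \<open>finite S\<close> in simp)
      finally show "form_part x n = form_part (sum c S) n" ..
    qed
    then have "is_decomposition (grade P) x c"
      unfolding is_decomposition_def
      using \<open>finite S\<close> supp
      by (auto simp: grade_path fn form hcomp_in intro: finite_subset sum.mono_neutral_right)
    moreover have "c' = c" if "is_decomposition (grade P) x c'" for c'
    proof
      fix i
      from that have *: "\<And>i. c' i \<in> grade P i" "finite {i. c' i \<noteq> 0}"
        and x: "x = (\<Sum>i | c' i \<noteq> 0. c' i)"
        by (auto simp: is_decomposition_def)
      have "hcomp (grade A) (fn_part x n) = (\<lambda>i. fn_part (c' i) n)" for n
        by (rule hcomp_unique[OF _ *(2)])
          (use * in \<open>auto simp: grade_path fn_part_sum[symmetric] x[symmetric]\<close>)
      moreover have "hcomp (grade A) (form_part x n) = (\<lambda>i. form_part (c' (i + 1)) n)" for n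
      proof (rule hcomp_unique)
        show "form_part (c' (i + 1)) n \<in> grade A i" for i
          using *(1)[of "i + 1"] by (simp add: grade_path)
        show "finite ((\<lambda>i. i - 1) ` {i. c' i \<noteq> 0})" using *(2) by simp
        show "form_part (c' (i + 1)) n = 0" if "i \<notin> (\<lambda>i. i - 1) ` {i. c' i \<noteq> 0}" for i
        proof -
          have "c' (i + 1) = 0" using that by force
          then show ?thesis by simp
        qed
        show "form_part x n = (\<Sum>i\<in>(\<lambda>i. i - 1) ` {i. c' i \<noteq> 0}. form_part (c' (i + 1)) n)"
          by (subst sum.reindex) (auto simp: inj_on_def form_part_sum[symmetric] x[symmetric])
      qed
      ultimately show "c' i = c i"
        by (intro path_eqI) (simp_all add: fn form)
    qed
    ultimately show "\<exists>!c. is_decomposition (grade P) x c" by blast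
  qed
qed

end

text \<open>The product rule for polynomials, obtained by splitting the factor \<open>n + 1\<close> at a term of bidegree
  \<open>(i, n + 1 - i)\<close> as the sum of \<open>i\<close> and \<open>n + 1 - i\<close>.  It serves both the derivative on the path
  algebra and the induction for divided powers.\<close>

lemma (in vector_space) Cauchy_sum_deriv:
  "scale (of_nat (Suc n)) (\<Sum>i=0..Suc n. f i (Suc n - i)) =
     (\<Sum>i=0..n. scale (of_nat (Suc i)) (f (Suc i) (n - i)) + scale (of_nat (Suc (n - i))) (f i (Suc (n - i))))"
proof -
  have "scale (of_nat (Suc n)) (\<Sum>i=0..Suc n. f i (Suc n - i)) =
      (\<Sum>i=0..Suc n. scale (of_nat i) (f i (Suc n - i)) + scale (of_nat (Suc n - i)) (f i (Suc n - i)))"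
    unfolding scale_sum_right
    by (intro sum.cong) (auto simp flip: scale_left_distrib of_nat_add)
  also have "\<dots> = (\<Sum>i=0..Suc n. scale (of_nat i) (f i (Suc n - i))) +
      (\<Sum>i=0..Suc n. scale (of_nat (Suc n - i)) (f i (Suc n - i)))"
    by (rule sum.distrib)
  also have "(\<Sum>i=0..Suc n. scale (of_nat i) (f i (Suc n - i))) =
      (\<Sum>i=0..n. scale (of_nat (Suc i)) (f (Suc i) (n - i)))"
    by (subst sum.atLeast0_atMost_Suc_shift) simp
  also have "(\<Sum>i=0..Suc n. scale (of_nat (Suc n - i)) (f i (Suc n - i))) =
      (\<Sum>i=0..n. scale (of_nat (Suc (n - i))) (f i (Suc (n - i))))"
    by (simp add: Suc_diff_le del: of_nat_Suc of_nat_diff)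
  finally show ?thesis by (simp add: sum.distrib)
qed

context cdg_algebra
begin

lemma Cauchy_assoc:
  "(\<Sum>j=0..n. \<Sum>i=0..j. f i (j - i) (n - j)) = (\<Sum>j=0..n. \<Sum>i=0..n - j. f j i (n - j - i))"
  for f :: "nat \<Rightarrow> nat \<Rightarrow> nat \<Rightarrow> 'a"
  by (rule fps_mult_assoc_lemma)

lemma gi_sum: "gi (sum f I) = (\<Sum>i\<in>I. gi (f i))"
  by (induction I rule: infinite_finite_induct) (simp_all add: gr_inv_add)

lemma diff_sum: "adiff A (sum f I) = (\<Sum>i\<in>I. adiff A (f i))"
  by (induction I rule: infinite_finite_induct) (simp_all add: diff_add)

lemma path_mult_assoc: "amult P (amult P x y) z = amult P x (amult P y z)"
proof (rule path_eqI)
  fix n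
  show "fn_part (amult P (amult P x y) z) n = fn_part (amult P x (amult P y z)) n"
    using Cauchy_assoc[where n = n and f = "\<lambda>i j k. fn_part x i \<cdot> (fn_part y j \<cdot> fn_part z k)"]
    by (simp add: fn_part_mult mult_sum_left mult_sum_right mult_assoc)
  show "form_part (amult P (amult P x y) z) n = form_part (amult P x (amult P y z)) n"
    using Cauchy_assoc[where n = n and f = "\<lambda>i j k. gi (fn_part x i) \<cdot> (gi (fn_part y j) \<cdot> form_part z k) +
      (gi (fn_part x i) \<cdot> (form_part y j \<cdot> fn_part z k) + form_part x i \<cdot> (fn_part y j \<cdot> fn_part z k))"]
    by (simp add: form_part_mult fn_part_mult mult_sum_left mult_sum_right mult_assoc gi_sum gi_mult
        mult_add_left mult_add_right sum.distrib add.assoc)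
qed

lemma cdg_algebra_path: "cdg_algebra P"
proof -
  interpret P: graded_space "vscale P" "grade P" by (rule graded_space_path)
  show ?thesis
  proof unfold_locales
    have "adiff P x \<in> grade P (i + 1)" if "x \<in> grade P i" for x i
      using that diff_grade[of _ i] diff_grade[of _ "i - 1"]
      by (auto simp: grade_path form_part_diff intro!: grade_diff grade_scale)
    moreover have "adiff P (x + y) = adiff P x + adiff P y"
        "adiff P (vscale P c x) = vscale P c (adiff P x)" for x y c
      by (simp_all add: path_eq_iff lookup_add form_part_diff diff_add diff_scale
          scale_right_distrib scale_right_diff_distrib mult.commute del: of_nat_Suc)
    ultimately show "adiff P \<in> Hom_deg P P 1"
      by (auto simp: Hom_deg_def Vector_Spaces.linear_iff P.vector_space_axioms)
  next
    fix x show "adiff P (adiff P x) = 0"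
      by (rule path_eqI) (simp_all add: form_part_diff diff_diff diff_scale diff_minus del: of_nat_Suc)
  next
    fix x y z :: "'a path" and c
    show "amult P (x + y) z = amult P x z + amult P y z"
      by (rule path_eqI)
        (simp_all add: lookup_add fn_part_mult form_part_mult mult_add_left gr_inv_add sum.distrib algebra_simps)
    show "amult P x (y + z) = amult P x y + amult P x z"
      by (rule path_eqI)
        (simp_all add: lookup_add fn_part_mult form_part_mult mult_add_right sum.distrib algebra_simps)
    show "amult P (vscale P c x) y = vscale P c (amult P x y)"
      by (rule path_eqI)
        (simp_all add: fn_part_mult form_part_mult mult_scale_left gr_inv_scale scale_sum_right scale_right_distrib)
    show "amult P x (vscale P c y) = vscale P c (amult P x y)"
      by (rule path_eqI)
        (simp_all add: fn_part_mult form_part_mult mult_scale_right scale_sum_right scale_right_distrib)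
    show "amult P (amult P x y) z = amult P x (amult P y z)"
      by (rule path_mult_assoc)
    show "amult P (aunit P) x = x"
    proof (rule path_eqI)
      fix n
      have *: "(\<Sum>i=0..n. f i) = f 0" if "\<And>i. i \<noteq> 0 \<Longrightarrow> f i = 0" for f :: "nat \<Rightarrow> 'a"
        using that sum.mono_neutral_right[of "{0..n}" "{0}" f] by auto
      show "fn_part (amult P (aunit P) x) n = fn_part x n"
        unfolding fn_part_mult by (subst *) (auto simp: mult_unit_left)
      show "form_part (amult P (aunit P) x) n = form_part x n"
        unfolding form_part_mult by (subst *) (auto simp: mult_unit_left)
    qed
    show "amult P x (aunit P) = x"
    proof (rule path_eqI)
      fix n
      have *: "(\<Sum>i=0..n. f i) = f n" if "\<And>i. i < n \<Longrightarrow> f i = 0" for f :: "nat \<Rightarrow> 'a"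
        using that sum.mono_neutral_right[of "{0..n}" "{n}" f] by auto
      show "fn_part (amult P x (aunit P)) n = fn_part x n"
        unfolding fn_part_mult by (subst *) (auto simp: mult_unit_right)
      show "form_part (amult P x (aunit P)) n = form_part x n"
        unfolding form_part_mult by (subst *) (auto simp: mult_unit_right)
    qed
  next
    show "aunit P \<in> grade P 0"
      by (simp add: grade_path unit_deg)
  next
    fix x y i j assume x: "x \<in> grade P i" and y: "y \<in> grade P j"
    then have g: "fn_part x n \<in> grade A i" "form_part x n \<in> grade A (i - 1)"
       "fn_part y n \<in> grade A j" "form_part y n \<in> grade A (j - 1)" for n
      by (simp_all add: grade_path)
    show "amult P x y \<in> grade P (i + j)"
      unfolding grade_path fn_part_mult form_part_mult
      using mult_deg[OF g(1) g(3)] mult_deg[OF gr_inv_in[OF g(1)] g(4)] mult_deg[OF g(2) g(3)]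
      by (intro allI conjI grade_sum grade_add) (simp_all add: algebra_simps)
    show "amult P x y = vscale P ((- 1) powi (i * j)) (amult P y x)"
    proof (rule path_eqI)
      fix n
      show "fn_part (amult P x y) n = fn_part (vscale P ((- 1) powi (i * j)) (amult P y x)) n"
        unfolding fn_part_scale fn_part_mult
          Cauchy_sum_rev[where f = "\<lambda>a b. fn_part y a \<cdot> fn_part x b"]
        by (simp add: scale_sum_right mult_comm[OF g(1) g(3)])
      have sgn: "(- 1 :: 'k) powi (i * j) = (- 1) powi (i * (j - 1)) * (- 1) powi i"
          "(- 1 :: 'k) powi (i * j) * (- 1) powi j = (- 1) powi ((i - 1) * j)"
        using power_int_inverse[of "- 1 :: 'k" j]
        by (simp_all add: algebra_simps power_int_diff power_int_add divide_inverse)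
      have "gi (fn_part x a) \<cdot> form_part y b = vscale A ((- 1) powi (i * j)) (form_part y b \<cdot> fn_part x a)" for a b
        by (simp add: gr_inv_homogeneous[OF g(1)] mult_scale_left mult_comm[OF g(1) g(4)] sgn mult.commute)
      moreover have "form_part x a \<cdot> fn_part y b = vscale A ((- 1) powi (i * j)) (gi (fn_part y b) \<cdot> form_part x a)" for a b
        by (simp add: gr_inv_homogeneous[OF g(3)] mult_scale_left mult_comm[OF g(2) g(3)] sgn(2))
      ultimately show "form_part (amult P x y) n = form_part (vscale P ((- 1) powi (i * j)) (amult P y x)) n"
        unfolding form_part_scale form_part_mult Cauchy_sum_rev[where
            f = "\<lambda>a b. gi (fn_part y a) \<cdot> form_part x b + form_part y a \<cdot> fn_part x b"]
        by (simp add: scale_sum_right scale_right_distrib add.commute)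
    qed
  next
    fix x y i assume "x \<in> grade P i"
    then have g: "fn_part x n \<in> grade A i" "form_part x n \<in> grade A (i - 1)" for n
      by (simp_all add: grade_path)
    have gi: "gi (fn_part x n) = vscale A ((- 1) powi i) (fn_part x n)"
        "gi (form_part x n) \<cdot> z = - vscale A ((- 1) powi i) (form_part x n \<cdot> z)"
        "gi (adiff A (fn_part x n)) \<cdot> z = - vscale A ((- 1) powi i) (adiff A (fn_part x n) \<cdot> z)" for n z
      by (simp_all add: gr_inv_homogeneous[OF g(1)] gr_inv_homogeneous[OF g(2)]
          gr_inv_homogeneous[OF diff_grade[OF g(1)]] power_int_diff power_int_add
          mult_scale_left[where c = "- c" for c, simplified])
    have sgn: "(- 1 :: 'k) powi i * (c * (- 1) powi i) = c" for c
      using power_int_minus_one_mult_self[of i, where ?'a = 'k] by (metis mult.assoc mult.commute mult_1)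
    show "adiff P (amult P x y) =
      amult P (adiff P x) y + vscale P ((- 1) powi i) (amult P x (adiff P y))"
    proof (rule path_eqI)
      fix n
      show "fn_part (adiff P (amult P x y)) n =
          fn_part (amult P (adiff P x) y + vscale P ((- 1) powi i) (amult P x (adiff P y))) n"
        by (simp add: fn_part_mult lookup_add diff_sum leibniz_gi gi mult_scale_left sum.distrib scale_sum_right)
      show "form_part (adiff P (amult P x y)) n =
          form_part (amult P (adiff P x) y + vscale P ((- 1) powi i) (amult P x (adiff P y))) n"
        using Cauchy_sum_deriv[of n "\<lambda>i j. fn_part x i \<cdot> fn_part y j"]
        by (simp add: form_part_diff form_part_mult fn_part_mult lookup_add diff_sum leibniz_gi gi
          sum.distrib scale_sum_right mult_scale_left mult_scale_right diff_add diff_scale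
          mult_add_left mult_add_right mult_diff_left mult_diff_right sum_subtractf sum_negf
          scale_right_distrib scale_right_diff_distrib mult_scale_left[where c = "- c" for c, simplified]
          sgn del: of_nat_Suc)
    qed
  qed
qed

end

section \<open>Evaluation of paths\<close>

text \<open>The triangle \<open>i + j \<le> N + M\<close> contains the rectangle that supports \<open>f\<close>.\<close>

lemma Cauchy_sum_rectangle:
  fixes f :: "nat \<Rightarrow> nat \<Rightarrow> 'v::comm_monoid_add"
  assumes "\<And>i j. i > N \<or> j > M \<Longrightarrow> f i j = 0"
  shows "(\<Sum>n\<le>N + M. \<Sum>i\<le>n. f i (n - i)) = (\<Sum>i\<le>N. \<Sum>j\<le>M. f i j)"
proof -
  have "(\<Sum>n\<le>N + M. \<Sum>i\<le>n. f i (n - i)) = (\<Sum>(i, j)\<in>{(i, j). i + j \<le> N + M}. f i j)"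
    by (rule sum.triangle_reindex_eq[symmetric])
  also have "\<dots> = (\<Sum>(i, j)\<in>{..N} \<times> {..M}. f i j)"
  proof (rule sum.mono_neutral_right)
    show "finite {(i, j). i + j \<le> N + M}"
      by (rule finite_subset[of _ "{..N + M} \<times> {..N + M}"]) auto
    show "\<forall>z\<in>{(i, j). i + j \<le> N + M} - {..N} \<times> {..M}. (case z of (i, j) \<Rightarrow> f i j) = 0"
    proof
      fix z assume "z \<in> {(i, j). i + j \<le> N + M} - {..N} \<times> {..M}"
      then have "fst z > N \<or> snd z > M" by (cases z) auto
      then show "(case z of (i, j) \<Rightarrow> f i j) = 0" unfolding case_prod_beta by (rule assms)
    qed
  qed auto
  also have "\<dots> = (\<Sum>i\<le>N. \<Sum>j\<le>M. f i j)"
    by (rule sum.cartesian_product[symmetric])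
  finally show ?thesis .
qed

definition path_eval :: "('k::field, 'a::ab_group_add, 'm) cdga_scheme \<Rightarrow> 'k \<Rightarrow> 'a path \<Rightarrow> 'a" where
  "path_eval A c x = (\<Sum>n | fn_part x n \<noteq> 0. vscale A (c ^ n) (fn_part x n))"

context cdg_algebra
begin

lemma path_eval_superset:
  assumes "finite S" "\<And>n. n \<notin> S \<Longrightarrow> fn_part x n = 0"
  shows "path_eval A c x = (\<Sum>n\<in>S. vscale A (c ^ n) (fn_part x n))"
  unfolding path_eval_def using assms by (intro sum.mono_neutral_left) auto

lemma path_degree_bound: "\<exists>N. \<forall>n>N. fn_part x n = 0"
proof -
  obtain N where "\<forall>n\<in>{n. fn_part x n \<noteq> 0}. n \<le> N"
    using finite_lookup[of "fst x"] unfolding finite_nat_set_iff_bounded_le by metis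
  then have "\<forall>n>N. fn_part x n = 0" by (metis (mono_tags) mem_Collect_eq not_le)
  then show ?thesis ..
qed

lemma path_eval_add: "path_eval A c (x + y) = path_eval A c x + path_eval A c y"
proof -
  let ?S = "{n. fn_part x n \<noteq> 0} \<union> {n. fn_part y n \<noteq> 0}"
  have "path_eval A c z = (\<Sum>n\<in>?S. vscale A (c ^ n) (fn_part z n))"
    if "z \<in> {x, y, x + y}" for z
    using that by (intro path_eval_superset) (auto simp: lookup_add)
  then show ?thesis by (simp add: lookup_add scale_right_distrib sum.distrib)
qed

lemma path_eval_scale: "path_eval A c (vscale P b x) = vscale A b (path_eval A c x)"
  by (subst (1 2) path_eval_superset[where S = "{n. fn_part x n \<noteq> 0}"])
    (auto simp: scale_sum_right mult.commute)

lemma path_eval_mult: "path_eval A c (amult P x y) = path_eval A c x \<cdot> path_eval A c y"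
proof -
  obtain N M where N: "\<forall>n>N. fn_part x n = 0" and M: "\<forall>n>M. fn_part y n = 0"
    using path_degree_bound by metis
  let ?g = "\<lambda>i j. vscale A (c ^ (i + j)) (fn_part x i \<cdot> fn_part y j)"
  have zero: "?g i j = 0" if "i > N \<or> j > M" for i j
    using that N M by auto
  have "path_eval A c (amult P x y) =
      (\<Sum>n\<le>N + M. vscale A (c ^ n) (fn_part (amult P x y) n))"
  proof (rule path_eval_superset)
    fix n assume "n \<notin> {..N + M}"
    then have "i > N \<or> n - i > M" if "i \<le> n" for i using that by auto
    then show "fn_part (amult P x y) n = 0"
      unfolding fn_part_mult using N M by (intro sum.neutral) force
  qed simp
  also have "\<dots> = (\<Sum>n\<le>N + M. \<Sum>i\<le>n. ?g i (n - i))"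
    by (simp add: fn_part_mult scale_sum_right atLeast0AtMost)
  also have "\<dots> = (\<Sum>i\<le>N. \<Sum>j\<le>M. ?g i j)"
    by (rule Cauchy_sum_rectangle) (rule zero)
  also have "\<dots> = (\<Sum>i\<le>N. vscale A (c ^ i) (fn_part x i)) \<cdot> (\<Sum>j\<le>M. vscale A (c ^ j) (fn_part y j))"
    by (subst sum.swap)
      (simp add: mult_sum_left mult_sum_right mult_scale_left mult_scale_right power_add mult.commute
        scale_sum_right)
  also have "\<dots> = path_eval A c x \<cdot> path_eval A c y"
    using N M path_eval_superset[of "{..N}" x c] path_eval_superset[of "{..M}" y c]
    by (simp add: not_le)
  finally show ?thesis .
qed

lemma path_eval_Hom: "path_eval A c \<in> Hom_cdgA P A"
proof -
  have "path_eval A c x \<in> grade A i" if "x \<in> grade P i" for x i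
    using that unfolding path_eval_def grade_path by (auto intro!: grade_sum grade_scale)
  moreover have "adiff A (path_eval A c x) = path_eval A c (adiff P x)" for x
    by (subst (1 2) path_eval_superset[where S = "{n. fn_part x n \<noteq> 0}"])
      (auto simp: diff_sum diff_scale)
  moreover have "path_eval A c (aunit P) = aunit A"
    by (subst path_eval_superset[where S = "{0}"]) auto
  moreover have "Vector_Spaces.linear (vscale P) (vscale A) (path_eval A c)"
    by (simp only: Vector_Spaces.linear_iff vector_space_path vector_space_axioms
        path_eval_add path_eval_scale simp_thms)
  ultimately show ?thesis
    by (simp add: Hom_cdgA_iff[OF cdg_algebra_axioms] Hom_deg_def path_eval_mult image_subset_iff)
qed

text \<open>As \<open>0 ^ 0 = 1\<close>, evaluation at 0 picks the constant coefficient.\<close>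

lemma path_eval_0: "path_eval A 0 x = fn_part x 0"
  by (cases "fn_part x 0 = 0") (auto simp: path_eval_def power_0_left if_distrib[of "\<lambda>c. vscale A c _"]
      intro: sum.neutral cong: if_cong)

end

text \<open>In characteristic zero a path without form part whose differential has no form part is
  constant in \<open>t\<close>.  This is what makes the conditions on \<open>f(t)\<close> follow from those on \<open>\<xi>(t)\<close>
  and the initial value.\<close>

lemma path_zero_if_flat:
  fixes A :: "('k::field_char_0, 'a::ab_group_add, 'm) cdga_scheme"
  assumes "cdg_algebra A"
    and "\<And>n. form_part z n = 0" "\<And>n. form_part (adiff (path_algebra A) z) n = 0" "fn_part z 0 = 0"
  shows "z = 0"
proof -
  interpret cdg_algebra A by fact
  have "fn_part z (Suc n) = 0" for n
    using assms(2)[of n] assms(3)[of n] by (simp add: form_part_diff del: of_nat_Suc)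
  with assms(4) have "fn_part z n = 0" for n by (cases n) simp_all
  with assms(2) show ?thesis by (intro path_eqI) simp_all
qed

lemma Hom_deg_0_gr_inv:
  assumes "cdg_algebra C" "cdg_algebra A" "f \<in> Hom_deg C A 0"
  shows "f (gr_inv (vscale C) (grade C) x) = gr_inv (vscale A) (grade A) (f x)"
proof -
  interpret C: cdg_algebra C by fact
  interpret A: cdg_algebra A by fact
  interpret f: Vector_Spaces.linear "vscale C" "vscale A" f using assms(3) by (rule Hom_deg_linearD)
  show ?thesis
  proof (induction x rule: C.graded_induct)
    case (homogeneous i x)
    with Hom_deg_gradeD[OF assms(3) homogeneous] show ?case
      by (simp add: C.gr_inv_homogeneous A.gr_inv_homogeneous f.scale)
  next
    case (add x y)
    then show ?case by (simp add: C.gr_inv_add A.gr_inv_add f.add)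
  qed
qed

text \<open>The defects of compatibility with differential, unit and product have no form part; the
  differential of such a defect is a combination of defects, so \<open>path_zero_if_flat\<close> applies.\<close>

lemma path_Hom_cdgAI:
  fixes A :: "('k::field_char_0, 'a::ab_group_add, 'm) cdga_scheme"
    and C :: "('k, 'b::ab_group_add, 'l) cdga_scheme"
  defines "P \<equiv> path_algebra A"
  assumes C: "cdg_algebra C" and A: "cdg_algebra A" and \<Phi>: "\<Phi> \<in> Hom_deg C P 0"
    and diff: "\<And>x n. form_part (adiff P (\<Phi> x)) n = form_part (\<Phi> (adiff C x)) n"
    and unit: "\<And>n. form_part (\<Phi> (aunit C)) n = 0"
    and mult: "\<And>x y n. form_part (\<Phi> (amult C x y)) n = form_part (amult P (\<Phi> x) (\<Phi> y)) n"
    and start: "(\<lambda>x. fn_part (\<Phi> x) 0) \<in> Hom_cdgA C A"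
  shows "\<Phi> \<in> Hom_cdgA C P"
proof -
  interpret C: cdg_algebra C by fact
  interpret A: cdg_algebra A by fact
  interpret P: cdg_algebra P unfolding P_def by (rule A.cdg_algebra_path)
  interpret \<Phi>: Vector_Spaces.linear "vscale C" "vscale P" \<Phi> using \<Phi> by (rule Hom_deg_linearD)
  note start' = start[unfolded Hom_cdgA_iff[OF A]]
  have fn_diff: "fn_part (adiff P z) n = adiff A (fn_part z n)" for z n
    by (simp add: P_def)
  have fn_mult: "fn_part (amult P z w) 0 = amult A (fn_part z 0) (fn_part w 0)" for z w
    by (simp add: P_def A.fn_part_mult)
  note flat = path_zero_if_flat[OF A, folded P_def]
  have d: "adiff P (\<Phi> x) = \<Phi> (adiff C x)" for x
  proof -
    have "adiff P (\<Phi> x) - \<Phi> (adiff C x) = 0"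
    proof (rule flat)
      have "adiff P (adiff P (\<Phi> x) - \<Phi> (adiff C x)) = - (adiff P (\<Phi> (adiff C x)) - \<Phi> (adiff C (adiff C x)))"
        by (simp add: P.diff_minus P.diff_diff C.diff_diff \<Phi>.zero)
      then show "form_part (adiff P (adiff P (\<Phi> x) - \<Phi> (adiff C x))) n = 0" for n
        using diff by (simp add: lookup_minus)
    qed (use diff start' in \<open>simp_all add: lookup_minus fn_diff\<close>)
    then show ?thesis by simp
  qed
  have "\<Phi> (aunit C) - aunit P = 0"
  proof (rule flat)
    show "form_part (adiff P (\<Phi> (aunit C) - aunit P)) n = 0" for n
      by (simp add: P.diff_minus d \<Phi>.zero)
  qed (use unit start' in \<open>simp_all add: lookup_minus P_def\<close>)
  moreover have "\<Phi> (amult C x y) - amult P (\<Phi> x) (\<Phi> y) = 0" for x y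
  proof (rule flat)
    let ?E = "\<lambda>x y. \<Phi> (amult C x y) - amult P (\<Phi> x) (\<Phi> y)"
    have "adiff P (?E x y) = ?E (adiff C x) y + ?E (C.gi x) (adiff C y)"
      by (simp add: P.diff_minus P.leibniz_gi d C.leibniz_gi \<Phi>.add
          Hom_deg_0_gr_inv[OF C P.cdg_algebra_axioms \<Phi>])
    then show "form_part (adiff P (?E x y)) n = 0" for n
      using mult by (simp add: lookup_minus lookup_add)
  qed (use mult start' in \<open>simp_all add: lookup_minus fn_mult\<close>)
  ultimately show ?thesis
    using \<Phi> d by (simp add: Hom_cdgA_iff[OF P.cdg_algebra_axioms])
qed

lemma (in cdg_algebra) conv_unit_mult_left: "conv_unit B A x \<cdot> z = vscale A (counit B x) z"
  and conv_unit_mult_right: "z \<cdot> conv_unit B A x = vscale A (counit B x) z"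
  by (simp_all add: conv_unit_def unit_map_def mult_scale_left mult_scale_right mult_unit_left mult_unit_right)

lemma (in cdg_hopf_algebra) counit_gi: "counit B (gi x) = counit B x"
proof (induction x rule: graded_induct)
  case (homogeneous i x)
  then show ?case
    using counit_linear counit_deg[OF homogeneous]
    by (cases "i = 0") (simp_all add: gr_inv_homogeneous Vector_Spaces.linear_iff)
next
  case (add x y)
  then show ?case using counit_linear by (simp add: gr_inv_add Vector_Spaces.linear_iff)
qed

text \<open>The same argument for derivations along \<open>e\<close>, where the defect for a product is
  \<open>\<Phi>(x y) - \<epsilon>(x) \<Phi>(y) - \<epsilon>(y) \<Phi>(x)\<close> because \<open>e\<close> takes scalar values.\<close>

lemma path_THom_cdgAI:
  fixes A :: "('k::field_char_0, 'a::ab_group_add, 'm) cdga_scheme"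
    and B :: "('k, 'b::ab_group_add, 'l) cdg_hopf_scheme"
  defines "P \<equiv> path_algebra A"
  assumes B: "cdg_hopf_algebra B" and A: "cdg_algebra A" and \<Phi>: "\<Phi> \<in> Hom_deg B P 0"
    and diff: "\<And>x n. form_part (adiff P (\<Phi> x)) n = form_part (\<Phi> (adiff B x)) n"
    and unit: "\<And>n. form_part (\<Phi> (aunit B)) n = 0"
    and mult: "\<And>x y n. form_part (\<Phi> (amult B x y)) n =
      vscale A (counit B x) (form_part (\<Phi> y) n) + vscale A (counit B y) (form_part (\<Phi> x) n)"
    and start: "(\<lambda>x. fn_part (\<Phi> x) 0) \<in> THom_cdgA B A"
  shows "\<Phi> \<in> THom_cdgA B P"
proof -
  interpret B: cdg_hopf_algebra B by fact
  interpret A: cdg_algebra A by fact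
  interpret P: cdg_algebra P unfolding P_def by (rule A.cdg_algebra_path)
  interpret \<Phi>: Vector_Spaces.linear "vscale B" "vscale P" \<Phi> using \<Phi> by (rule Hom_deg_linearD)
  note start' = start[unfolded THom_cdgA_iff[OF A] A.conv_unit_mult_left A.conv_unit_mult_right]
  have fn_diff: "fn_part (adiff P z) n = adiff A (fn_part z n)" for z n
    by (simp add: P_def)
  have scale: "fn_part (vscale P c z) n = vscale A c (fn_part z n)"
      "form_part (vscale P c z) n = vscale A c (form_part z n)" for c z n
    by (simp_all add: P_def)
  note flat = path_zero_if_flat[OF A, folded P_def]
  have d: "adiff P (\<Phi> x) = \<Phi> (adiff B x)" for x
  proof -
    have "adiff P (\<Phi> x) - \<Phi> (adiff B x) = 0"
    proof (rule flat)
      have "adiff P (adiff P (\<Phi> x) - \<Phi> (adiff B x)) = - (adiff P (\<Phi> (adiff B x)) - \<Phi> (adiff B (adiff B x)))"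
        by (simp add: P.diff_minus P.diff_diff B.diff_diff \<Phi>.zero)
      then show "form_part (adiff P (adiff P (\<Phi> x) - \<Phi> (adiff B x))) n = 0" for n
        using diff by (simp add: lookup_minus)
    qed (use diff start' in \<open>simp_all add: lookup_minus fn_diff\<close>)
    then show ?thesis by simp
  qed
  have "\<Phi> (aunit B) = 0"
  proof (rule flat)
    show "form_part (adiff P (\<Phi> (aunit B))) n = 0" for n by (simp add: d \<Phi>.zero)
  qed (use unit start' in simp_all)
  moreover have "\<Phi> (amult B x y) - (vscale P (counit B x) (\<Phi> y) + vscale P (counit B y) (\<Phi> x)) = 0" for x y
  proof (rule flat)
    let ?E = "\<lambda>x y. \<Phi> (amult B x y) - (vscale P (counit B x) (\<Phi> y) + vscale P (counit B y) (\<Phi> x))"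
    have "adiff P (?E x y) = ?E (adiff B x) y + ?E (B.gi x) (adiff B y)"
      by (simp add: P.diff_minus P.diff_add P.diff_scale d B.leibniz_gi \<Phi>.add B.counit_diff B.counit_gi)
    then show "form_part (adiff P (?E x y)) n = 0" for n
      using mult by (simp add: lookup_minus lookup_add scale)
  qed (use mult start' in \<open>simp_all add: lookup_minus lookup_add scale\<close>)
  ultimately show ?thesis
    using \<Phi> d by (simp add: THom_cdgA_iff[OF P.cdg_algebra_axioms] P.conv_unit_mult_left P.conv_unit_mult_right)
qed

section \<open>Homotopy pairs are morphisms to the path algebra\<close>

definition path_map :: "(nat \<Rightarrow> 'b \<Rightarrow> 'a::zero) \<Rightarrow> (nat \<Rightarrow> 'b \<Rightarrow> 'a) \<Rightarrow> 'b \<Rightarrow> 'a path" where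
  "path_map F \<xi> x = (Abs_poly_mapping (\<lambda>n. F n x), Abs_poly_mapping (\<lambda>n. \<xi> n x))"

lemma fn_part_path_map: "F \<in> poly_Hom C A k \<Longrightarrow> fn_part (path_map F \<xi> x) n = F n x"
  and form_part_path_map: "\<xi> \<in> poly_Hom C A k \<Longrightarrow> form_part (path_map F \<xi> x) n = \<xi> n x"
  by (simp_all add: path_map_def poly_Hom_def)

lemma path_map_Hom_deg:
  assumes "cdg_algebra C" "cdg_algebra A" "F \<in> poly_Hom C A 0" "\<xi> \<in> poly_Hom C A (- 1)"
  shows "path_map F \<xi> \<in> Hom_deg C (path_algebra A) 0"
proof -
  interpret C: cdg_algebra C by fact
  interpret A: cdg_algebra A by fact
  note parts = fn_part_path_map[OF assms(3)] form_part_path_map[OF assms(4)]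
  have F: "F n \<in> Hom_deg C A 0" and \<xi>: "\<xi> n \<in> Hom_deg C A (- 1)" for n
    using assms(3,4) by (auto simp: poly_Hom_def)
  show ?thesis
    using Hom_deg_linearD[OF F] Hom_deg_linearD[OF \<xi>] Hom_deg_gradeD[OF F] Hom_deg_gradeD[OF \<xi>]
    by (auto simp: Hom_deg_def Vector_Spaces.linear_iff A.vector_space_path grade_path parts
        path_eq_iff lookup_add)
qed

lemma poly_Hom_parts:
  assumes "cdg_algebra C" "cdg_algebra A" "\<Phi> \<in> Hom_deg C (path_algebra A) 0"
  shows "(\<lambda>n x. fn_part (\<Phi> x) n) \<in> poly_Hom C A 0" "(\<lambda>n x. form_part (\<Phi> x) n) \<in> poly_Hom C A (- 1)"
proof -
  interpret C: cdg_algebra C by fact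
  interpret A: cdg_algebra A by fact
  interpret \<Phi>: Vector_Spaces.linear "vscale C" "vscale (path_algebra A)" \<Phi>
    using assms(3) by (rule Hom_deg_linearD)
  show "(\<lambda>n x. fn_part (\<Phi> x) n) \<in> poly_Hom C A 0" "(\<lambda>n x. form_part (\<Phi> x) n) \<in> poly_Hom C A (- 1)"
    using Hom_deg_gradeD[OF assms(3)]
    by (auto simp: poly_Hom_def Hom_deg_def Vector_Spaces.linear_iff C.vector_space_axioms
        A.vector_space_axioms \<Phi>.add \<Phi>.scale lookup_add grade_path)
qed

lemma poly_eval_eq_path_eval:
  "(\<And>n x. fn_part (\<Phi> x) n = F n x) \<Longrightarrow> poly_eval A F c = path_eval A c \<circ> \<Phi>"
  by (simp add: poly_eval_def path_eval_def fun_eq_iff)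

lemma minus_one_powi_uminus: "(- 1 :: 'k::field) powi (- i) = (- 1) powi i"
  using power_int_inverse[of "- 1 :: 'k" i] by (simp add: power_int_minus)

text \<open>The equations for \<open>\<xi>\<close> say that the form part is compatible with differential, unit and product;
  the rest of the structure is recovered by \<open>path_Hom_cdgAI\<close> from the value at \<open>t = 0\<close>.\<close>

lemma homotopy_pair_path_map:
  fixes A :: "('k::field_char_0, 'a::ab_group_add, 'm) cdga_scheme"
  assumes C: "cdg_algebra C" and A: "cdg_algebra A" and hp: "homotopy_pair C A F \<xi>"
  shows "path_map F \<xi> \<in> Hom_cdgA C (path_algebra A)"
    and "poly_eval A F c = path_eval A c \<circ> path_map F \<xi>"
proof -
  interpret C: cdg_algebra C by fact
  interpret A: cdg_algebra A by fact
  have F: "F \<in> poly_Hom C A 0" and \<xi>: "\<xi> \<in> poly_Hom C A (- 1)"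
    and deriv: "\<And>n. poly_deriv A F n = Hom_diff C A (- 1) (\<xi> n)"
    and start: "poly_eval A F 0 \<in> Hom_cdgA C A"
    and unit: "\<And>n c. \<xi> n (unit_map C c) = 0"
    and mult: "\<And>n i x y. x \<in> grade C i \<Longrightarrow> \<xi> n (amult C x y) =
          (\<Sum>p\<le>n. vscale A ((- 1) powi ((- 1) * i)) (amult A (F p x) (\<xi> (n - p) y)) +
                  amult A (\<xi> p x) (F (n - p) y))"
    using hp by (auto simp: homotopy_pair_def)
  note parts = fn_part_path_map[OF F] form_part_path_map[OF \<xi>]
  note \<Phi> = path_map_Hom_deg[OF C A F \<xi>]
  show eval: "poly_eval A F c = path_eval A c \<circ> path_map F \<xi>" for c
    by (rule poly_eval_eq_path_eval) (simp add: parts)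
  have Fd: "F n \<in> Hom_deg C A 0" and \<xi>d: "\<xi> n \<in> Hom_deg C A (- 1)" for n
    using F \<xi> by (auto simp: poly_Hom_def)
  have add: "F n (x + y) = F n x + F n y" "\<xi> n (x + y) = \<xi> n x + \<xi> n y" for n x y
    using Hom_deg_linearD[OF Fd] Hom_deg_linearD[OF \<xi>d] by (auto simp: Vector_Spaces.linear_iff)
  show "path_map F \<xi> \<in> Hom_cdgA C (path_algebra A)"
  proof (rule path_Hom_cdgAI[OF C A \<Phi>])
    show "form_part (adiff (path_algebra A) (path_map F \<xi> x)) n = form_part (path_map F \<xi> (adiff C x)) n" for x n
      using fun_cong[OF deriv, of n x]
      by (simp add: A.form_part_diff parts poly_deriv_def Hom_diff_def del: of_nat_Suc)
    show "form_part (path_map F \<xi> (aunit C)) n = 0" for n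
      using unit[of n 1] by (simp add: parts unit_map_def)
    show "form_part (path_map F \<xi> (amult C x y)) n =
      form_part (amult (path_algebra A) (path_map F \<xi> x) (path_map F \<xi> y)) n" for x y n
      unfolding A.form_part_mult parts
    proof (induction x rule: C.graded_induct)
      case (homogeneous i x)
      have "F p x \<in> grade A i" for p using Hom_deg_gradeD[OF Fd homogeneous] by simp
      then show ?case
        by (simp add: mult[OF homogeneous] A.gr_inv_homogeneous[where i = i] A.mult_scale_left
            atLeast0AtMost minus_one_powi_uminus)
    next
      case (add x x')
      then show ?case
        by (simp add: \<open>\<And>n x y. \<xi> n (x + y) = \<xi> n x + \<xi> n y\<close> \<open>\<And>n x y. F n (x + y) = F n x + F n y\<close>
          C.mult_add_left A.mult_add_left A.gr_inv_add sum.distrib algebra_simps)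
    qed
    show "(\<lambda>x. fn_part (path_map F \<xi> x) 0) \<in> Hom_cdgA C A"
      using start eval[of 0] by (simp add: A.path_eval_0 comp_def)
  qed
qed

lemma homotopy_pair_of_path:
  assumes C: "cdg_algebra C" and A: "cdg_algebra A" and \<Phi>: "\<Phi> \<in> Hom_cdgA C (path_algebra A)"
  shows "homotopy_pair C A (\<lambda>n x. fn_part (\<Phi> x) n) (\<lambda>n x. form_part (\<Phi> x) n)"
proof -
  interpret C: cdg_algebra C by fact
  interpret A: cdg_algebra A by fact
  interpret P: cdg_algebra "path_algebra A" by (rule A.cdg_algebra_path)
  note \<Phi>' = \<Phi>[unfolded Hom_cdgA_iff[OF P.cdg_algebra_axioms]]
  have "\<Phi> (unit_map C c) = unit_map (path_algebra A) c" for c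
    by (rule Hom_cdgA_unit_map[OF P.cdg_algebra_axioms \<Phi>])
  moreover have "vscale A (of_nat (Suc n)) (fn_part (\<Phi> x) (Suc n)) =
      adiff A (form_part (\<Phi> x) n) + form_part (\<Phi> (adiff C x)) n" for x n
    using \<Phi>' A.form_part_diff[of "\<Phi> x" n] by simp
  moreover have "fn_part (\<Phi> x) n \<in> grade A i" if "x \<in> grade C i" for x i n
    using \<Phi>' Hom_deg_gradeD[OF _ that, of \<Phi> "path_algebra A" 0] by (auto simp: grade_path)
  then have "A.gi (fn_part (\<Phi> x) n) = vscale A ((- 1) powi i) (fn_part (\<Phi> x) n)"
    if "x \<in> grade C i" for x i n
    using that by (intro A.gr_inv_homogeneous)
  moreover have "poly_eval A (\<lambda>n x. fn_part (\<Phi> x) n) 0 \<in> Hom_cdgA C A"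
    using poly_eval_eq_path_eval[of \<Phi> "\<lambda>n x. fn_part (\<Phi> x) n" A 0]
      Hom_cdgA_comp[OF P.cdg_algebra_axioms A \<Phi> A.path_eval_Hom] by simp
  ultimately show ?thesis
    unfolding homotopy_pair_def
    using poly_Hom_parts[OF C A] \<Phi>'
    by (auto simp: poly_deriv_def Hom_diff_def fun_eq_iff unit_map_def A.form_part_mult
        A.mult_scale_left atLeast0AtMost minus_one_powi_uminus simp del: of_nat_Suc)
qed

text \<open>The Koszul sign \<open>(-1)^|x|\<close> in front of \<open>e(x) \<sigma>(y)\<close> has no effect, since \<open>e\<close> vanishes outside
  degree 0.\<close>

lemma Thomotopy_pair_path_map:
  fixes A :: "('k::field_char_0, 'a::ab_group_add, 'm) cdga_scheme"
  assumes B: "cdg_hopf_algebra B" and A: "cdg_algebra A" and hp: "Thomotopy_pair B A F \<xi>"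
  shows "path_map F \<xi> \<in> THom_cdgA B (path_algebra A)"
    and "poly_eval A F c = path_eval A c \<circ> path_map F \<xi>"
proof -
  interpret B: cdg_hopf_algebra B by fact
  interpret A: cdg_algebra A by fact
  have F: "F \<in> poly_Hom B A 0" and \<xi>: "\<xi> \<in> poly_Hom B A (- 1)"
    and deriv: "\<And>n. poly_deriv A F n = Hom_diff B A (- 1) (\<xi> n)"
    and start: "poly_eval A F 0 \<in> THom_cdgA B A"
    and unit: "\<And>n c. \<xi> n (unit_map B c) = 0"
    and mult: "\<And>n i x y. x \<in> grade B i \<Longrightarrow> \<xi> n (amult B x y) =
          vscale A ((- 1) powi ((- 1) * i)) (amult A (conv_unit B A x) (\<xi> n y)) +
          amult A (\<xi> n x) (conv_unit B A y)"
    using hp by (auto simp: Thomotopy_pair_def)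
  note parts = fn_part_path_map[OF F] form_part_path_map[OF \<xi>]
  note \<Phi> = path_map_Hom_deg[OF B.cdg_algebra_axioms A F \<xi>]
  show eval: "poly_eval A F c = path_eval A c \<circ> path_map F \<xi>" for c
    by (rule poly_eval_eq_path_eval) (simp add: parts)
  have \<xi>d: "\<xi> n \<in> Hom_deg B A (- 1)" for n
    using \<xi> by (auto simp: poly_Hom_def)
  have \<xi>_add: "\<xi> n (x + y) = \<xi> n x + \<xi> n y" for n x y
    using Hom_deg_linearD[OF \<xi>d] by (auto simp: Vector_Spaces.linear_iff)
  have \<epsilon>_add: "counit B (x + y) = counit B x + counit B y" for x y
    using B.counit_linear by (simp add: Vector_Spaces.linear_iff)
  show "path_map F \<xi> \<in> THom_cdgA B (path_algebra A)"
  proof (rule path_THom_cdgAI[OF B A \<Phi>])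
    show "form_part (adiff (path_algebra A) (path_map F \<xi> x)) n = form_part (path_map F \<xi> (adiff B x)) n" for x n
      using fun_cong[OF deriv, of n x]
      by (simp add: A.form_part_diff parts poly_deriv_def Hom_diff_def del: of_nat_Suc)
    show "form_part (path_map F \<xi> (aunit B)) n = 0" for n
      using unit[of n 1] by (simp add: parts unit_map_def)
    show "form_part (path_map F \<xi> (amult B x y)) n = vscale A (counit B x) (form_part (path_map F \<xi> y) n) +
        vscale A (counit B y) (form_part (path_map F \<xi> x) n)" for x y n
      unfolding parts
    proof (induction x rule: B.graded_induct)
      case (homogeneous i x)
      then show ?case
        using B.counit_deg[OF homogeneous]
        by (cases "i = 0") (simp_all add: mult[OF homogeneous] A.conv_unit_mult_left A.conv_unit_mult_right)
    next
      case (add x x')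
      then show ?case
        by (simp add: \<xi>_add \<epsilon>_add B.mult_add_left A.scale_left_distrib A.scale_right_distrib)
    qed
    show "(\<lambda>x. fn_part (path_map F \<xi> x) 0) \<in> THom_cdgA B A"
      using start eval[of 0] by (simp add: A.path_eval_0 comp_def)
  qed
qed

lemma Thomotopy_pair_of_path:
  assumes B: "cdg_hopf_algebra B" and A: "cdg_algebra A" and \<Phi>: "\<Phi> \<in> THom_cdgA B (path_algebra A)"
  shows "Thomotopy_pair B A (\<lambda>n x. fn_part (\<Phi> x) n) (\<lambda>n x. form_part (\<Phi> x) n)"
proof -
  interpret B: cdg_hopf_algebra B by fact
  interpret A: cdg_algebra A by fact
  interpret P: cdg_algebra "path_algebra A" by (rule A.cdg_algebra_path)
  note \<Phi>' = \<Phi>[unfolded THom_cdgA_iff[OF P.cdg_algebra_axioms] P.conv_unit_mult_left P.conv_unit_mult_right]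
  have "\<Phi> (unit_map B c) = 0" for c
    using \<Phi> by (simp add: THom_cdgA_def)
  moreover have "vscale A (of_nat (Suc n)) (fn_part (\<Phi> x) (Suc n)) =
      adiff A (form_part (\<Phi> x) n) + form_part (\<Phi> (adiff B x)) n" for x n
    using \<Phi>' A.form_part_diff[of "\<Phi> x" n] by simp
  moreover have "poly_eval A (\<lambda>n x. fn_part (\<Phi> x) n) 0 \<in> THom_cdgA B A"
    using poly_eval_eq_path_eval[of \<Phi> "\<lambda>n x. fn_part (\<Phi> x) n" A 0]
      Hom_THom_comp[OF P.cdg_algebra_axioms A \<Phi> A.path_eval_Hom] by simp
  moreover have "vscale A ((- 1) powi (- i)) (vscale A (counit B x) z) = vscale A (counit B x) z"
    if "x \<in> grade B i" for i x z
    using B.counit_deg[OF that] by (cases "i = 0") simp_all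
  ultimately show ?thesis
    unfolding Thomotopy_pair_def
    using poly_Hom_parts[OF B.cdg_algebra_axioms A] \<Phi>'
    by (auto simp: poly_deriv_def Hom_diff_def fun_eq_iff lookup_add
        A.conv_unit_mult_left A.conv_unit_mult_right simp del: of_nat_Suc A.scale_scale)
qed

section \<open>Homotopy and composition\<close>

definition gen_equiv :: "'x set \<Rightarrow> ('x \<times> 'x) set \<Rightarrow> ('x \<times> 'x) set" where
  "gen_equiv X R = Restr ((R \<union> R\<inverse>)\<^sup>*) X"

lemma equiv_gen_equiv: "equiv X (gen_equiv X R)"
proof (rule equivI)
  have "sym ((R \<union> R\<inverse>)\<^sup>*)" by (rule sym_rtrancl) (auto simp: sym_def)
  then show "sym (gen_equiv X R)" by (auto simp: gen_equiv_def sym_def)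
  show "trans (gen_equiv X R)" by (auto simp: gen_equiv_def trans_def)
qed (auto simp: gen_equiv_def refl_on_def)

text \<open>It suffices to check a map on the generating pairs, because zigzags are mapped to zigzags.\<close>

lemma gen_equiv_map:
  assumes "(x, y) \<in> gen_equiv X R" "\<And>x. x \<in> X \<Longrightarrow> \<phi> x \<in> Y"
    and "\<And>x y. (x, y) \<in> R \<Longrightarrow> (\<phi> x, \<phi> y) \<in> S"
  shows "(\<phi> x, \<phi> y) \<in> gen_equiv Y S"
proof -
  have "(x, y) \<in> (R \<union> R\<inverse>)\<^sup>*" using assms(1) by (simp add: gen_equiv_def)
  then have "(\<phi> x, \<phi> y) \<in> (S \<union> S\<inverse>)\<^sup>*"
    by induction (auto intro: rtrancl_into_rtrancl dest: assms(3))
  with assms(1,2) show ?thesis by (simp add: gen_equiv_def)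
qed

definition path_ends ::
  "('k::field, 'a::ab_group_add, 'm) cdga_scheme \<Rightarrow> ('b \<Rightarrow> 'a path) set \<Rightarrow> (('b \<Rightarrow> 'a) \<times> ('b \<Rightarrow> 'a)) set" where
  "path_ends A M = (\<lambda>\<Phi>. (path_eval A 0 \<circ> \<Phi>, path_eval A 1 \<circ> \<Phi>)) ` M"

text \<open>Homotopy is generated by the pairs of endpoints of morphisms into the path algebra.\<close>

lemma homotopy_rel_eq:
  fixes A :: "('k::field_char_0, 'a::ab_group_add, 'm) cdga_scheme"
  assumes C: "cdg_algebra C" and A: "cdg_algebra A"
  shows "homotopy_rel C A = gen_equiv (Hom_cdgA C A) (path_ends A (Hom_cdgA C (path_algebra A)))"
proof -
  interpret A: cdg_algebra A by fact
  interpret P: cdg_algebra "path_algebra A" by (rule A.cdg_algebra_path)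
  have "{(f, g). f \<in> Hom_cdgA C A \<and> g \<in> Hom_cdgA C A \<and>
      (\<exists>F \<xi>. homotopy_pair C A F \<xi> \<and> poly_eval A F 0 = f \<and> poly_eval A F 1 = g)} =
    path_ends A (Hom_cdgA C (path_algebra A))" (is "?L = ?R")
  proof (intro equalityI subsetI)
    fix z assume "z \<in> ?L"
    then obtain F \<xi> where z: "z = (poly_eval A F 0, poly_eval A F 1)" and hp: "homotopy_pair C A F \<xi>"
      by auto
    show "z \<in> ?R"
      unfolding z path_ends_def using homotopy_pair_path_map[OF C A hp]
      by (intro image_eqI[of _ _ "path_map F \<xi>"]) auto
  next
    fix z assume "z \<in> ?R"
    then obtain \<Phi> where z: "z = (path_eval A 0 \<circ> \<Phi>, path_eval A 1 \<circ> \<Phi>)"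
      and \<Phi>: "\<Phi> \<in> Hom_cdgA C (path_algebra A)" by (auto simp: path_ends_def)
    have "poly_eval A (\<lambda>n x. fn_part (\<Phi> x) n) c = path_eval A c \<circ> \<Phi>" for c
      by (rule poly_eval_eq_path_eval) simp
    then show "z \<in> ?L"
      unfolding z using homotopy_pair_of_path[OF C A \<Phi>]
        Hom_cdgA_comp[OF P.cdg_algebra_axioms A \<Phi> A.path_eval_Hom] by blast
  qed
  then show ?thesis by (simp add: homotopy_rel_def gen_equiv_def Let_def)
qed

lemma Thomotopy_rel_eq:
  fixes A :: "('k::field_char_0, 'a::ab_group_add, 'm) cdga_scheme"
  assumes B: "cdg_hopf_algebra B" and A: "cdg_algebra A"
  shows "Thomotopy_rel B A = gen_equiv (THom_cdgA B A) (path_ends A (THom_cdgA B (path_algebra A)))"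
proof -
  interpret A: cdg_algebra A by fact
  interpret P: cdg_algebra "path_algebra A" by (rule A.cdg_algebra_path)
  have "{(f, g). f \<in> THom_cdgA B A \<and> g \<in> THom_cdgA B A \<and>
      (\<exists>F \<xi>. Thomotopy_pair B A F \<xi> \<and> poly_eval A F 0 = f \<and> poly_eval A F 1 = g)} =
    path_ends A (THom_cdgA B (path_algebra A))" (is "?L = ?R")
  proof (intro equalityI subsetI)
    fix z assume "z \<in> ?L"
    then obtain F \<xi> where z: "z = (poly_eval A F 0, poly_eval A F 1)" and hp: "Thomotopy_pair B A F \<xi>"
      by auto
    show "z \<in> ?R"
      unfolding z path_ends_def using Thomotopy_pair_path_map[OF B A hp]
      by (intro image_eqI[of _ _ "path_map F \<xi>"]) auto
  next
    fix z assume "z \<in> ?R"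
    then obtain \<Phi> where z: "z = (path_eval A 0 \<circ> \<Phi>, path_eval A 1 \<circ> \<Phi>)"
      and \<Phi>: "\<Phi> \<in> THom_cdgA B (path_algebra A)" by (auto simp: path_ends_def)
    have "poly_eval A (\<lambda>n x. fn_part (\<Phi> x) n) c = path_eval A c \<circ> \<Phi>" for c
      by (rule poly_eval_eq_path_eval) simp
    then show "z \<in> ?L"
      unfolding z using Thomotopy_pair_of_path[OF B A \<Phi>]
        Hom_THom_comp[OF P.cdg_algebra_axioms A \<Phi> A.path_eval_Hom] by blast
  qed
  then show ?thesis by (simp add: Thomotopy_rel_def gen_equiv_def Let_def)
qed

lemma equiv_homotopy_rel: "equiv (Hom_cdgA C A) (homotopy_rel C A)"
  unfolding homotopy_rel_def Let_def by (rule equiv_gen_equiv[unfolded gen_equiv_def])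

lemma equiv_Thomotopy_rel: "equiv (THom_cdgA B A) (Thomotopy_rel B A)"
  unfolding Thomotopy_rel_def Let_def by (rule equiv_gen_equiv[unfolded gen_equiv_def])

definition path_lift :: "('a::zero \<Rightarrow> 'c::zero) \<Rightarrow> 'a path \<Rightarrow> 'c path" where
  "path_lift f x = (Abs_poly_mapping (\<lambda>n. f (fn_part x n)), Abs_poly_mapping (\<lambda>n. f (form_part x n)))"

lemma path_lift_parts:
  assumes "f 0 = 0"
  shows "fn_part (path_lift f x) n = f (fn_part x n)" "form_part (path_lift f x) n = f (form_part x n)"
proof -
  have "finite {n. f (fn_part x n) \<noteq> 0}" "finite {n. f (form_part x n) \<noteq> 0}"
    by (rule finite_lookup_mono[where p = "fst x"], simp add: assms,
        rule finite_lookup_mono[where p = "snd x"], simp add: assms)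
  then show "fn_part (path_lift f x) n = f (fn_part x n)" "form_part (path_lift f x) n = f (form_part x n)"
    by (simp_all add: path_lift_def)
qed

lemma path_lift_Hom:
  assumes A: "cdg_algebra A" and A': "cdg_algebra A'" and f: "f \<in> Hom_cdgA A A'"
  shows "path_lift f \<in> Hom_cdgA (path_algebra A) (path_algebra A')"
    and "path_eval A' c \<circ> path_lift f = f \<circ> path_eval A c"
proof -
  interpret A: cdg_algebra A by fact
  interpret A': cdg_algebra A' by fact
  note f' = f[unfolded Hom_cdgA_iff[OF A']]
  interpret f: Vector_Spaces.linear "vscale A" "vscale A'" f
    using f' by (auto dest: Hom_deg_linearD)
  note parts = path_lift_parts[of f, OF f.zero]
  have gi: "f (A.gi x) = A'.gi (f x)" for x
    using Hom_deg_0_gr_inv[OF A A'] f' by blast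
  have grade: "f x \<in> grade A' i" if "x \<in> grade A i" for x i
    using Hom_deg_gradeD[OF _ that, of f A' 0] f' by simp
  have "Vector_Spaces.linear (vscale A.P) (vscale A'.P) (path_lift f)"
    by (simp add: Vector_Spaces.linear_iff A.vector_space_path A'.vector_space_path path_eq_iff
        parts lookup_add f.add f.scale)
  moreover have "adiff A'.P (path_lift f x) = path_lift f (adiff A.P x)" for x
    using f' by (simp add: path_eq_iff parts A.form_part_diff A'.form_part_diff f.diff f.scale del: of_nat_Suc)
  moreover have "path_lift f (aunit A.P) = aunit A'.P"
    using f' by (simp add: path_eq_iff parts f.zero)
  moreover have "path_lift f (amult A.P x y) = amult A'.P (path_lift f x) (path_lift f y)" for x y
    using f' by (simp add: path_eq_iff parts A.form_part_mult A'.form_part_mult A.fn_part_mult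
        A'.fn_part_mult f.sum f.add gi)
  moreover have "path_lift f x \<in> grade A'.P i" if "x \<in> grade A.P i" for x i
    using that by (auto simp: grade_path parts intro: grade)
  ultimately show "path_lift f \<in> Hom_cdgA A.P A'.P"
    by (simp add: Hom_cdgA_iff[OF A'.cdg_algebra_path] Hom_deg_def image_subset_iff)
  show "path_eval A' c \<circ> path_lift f = f \<circ> path_eval A c"
  proof
    fix x
    show "(path_eval A' c \<circ> path_lift f) x = (f \<circ> path_eval A c) x"
      using A'.path_eval_superset[of "{n. fn_part x n \<noteq> 0}" "path_lift f x" c]
      by (simp add: path_eval_def[of A] f.sum f.scale parts f.zero)
  qed
qed

text \<open>A construction on morphisms that is also defined on paths and commutes with evaluation at
  the endpoints preserves homotopy.\<close>

lemma path_ends_map: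
  assumes "(f, g) \<in> path_ends A M" "\<And>\<Phi>. \<Phi> \<in> M \<Longrightarrow> \<psi> \<Phi> \<in> N"
    and "\<And>c \<Phi>. \<Phi> \<in> M \<Longrightarrow> path_eval A' c \<circ> \<psi> \<Phi> = \<phi> (path_eval A c \<circ> \<Phi>)"
  shows "(\<phi> f, \<phi> g) \<in> path_ends A' N"
  using assms unfolding path_ends_def by (auto intro!: image_eqI)

lemma homotopic_comp_left:
  fixes A :: "('k::field_char_0, 'a::ab_group_add, 'm) cdga_scheme"
  assumes C: "cdg_algebra C" and A: "cdg_algebra A" and A': "cdg_algebra A'"
    and f: "f \<in> Hom_cdgA A A'" and gh: "(g, g') \<in> homotopy_rel C A"
  shows "(f \<circ> g, f \<circ> g') \<in> homotopy_rel C A'"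
  using gh unfolding homotopy_rel_eq[OF C A] homotopy_rel_eq[OF C A']
proof (rule gen_equiv_map)
  note P = cdg_algebra.cdg_algebra_path
  show "f \<circ> x \<in> Hom_cdgA C A'" if "x \<in> Hom_cdgA C A" for x
    by (rule Hom_cdgA_comp[OF A A' that f])
  show "(f \<circ> x, f \<circ> y) \<in> path_ends A' (Hom_cdgA C (path_algebra A'))"
    if "(x, y) \<in> path_ends A (Hom_cdgA C (path_algebra A))" for x y
    using that
  proof (rule path_ends_map[where \<psi> = "\<lambda>\<Phi>. path_lift f \<circ> \<Phi>"])
    show "path_lift f \<circ> \<Phi> \<in> Hom_cdgA C (path_algebra A')" if "\<Phi> \<in> Hom_cdgA C (path_algebra A)" for \<Phi>
      by (rule Hom_cdgA_comp[OF P[OF A] P[OF A'] that path_lift_Hom(1)[OF A A' f]])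
    show "path_eval A' c \<circ> (path_lift f \<circ> \<Phi>) = f \<circ> (path_eval A c \<circ> \<Phi>)" for c \<Phi>
      using path_lift_Hom(2)[OF A A' f] by (simp add: comp_assoc[symmetric])
  qed
qed

lemma homotopic_comp_right:
  fixes A :: "('k::field_char_0, 'a::ab_group_add, 'm) cdga_scheme"
  assumes C: "cdg_algebra C" and A: "cdg_algebra A" and A': "cdg_algebra A'"
    and g: "g \<in> Hom_cdgA C A" and fh: "(f, f') \<in> homotopy_rel A A'"
  shows "(f \<circ> g, f' \<circ> g) \<in> homotopy_rel C A'"
  using fh unfolding homotopy_rel_eq[OF A A'] homotopy_rel_eq[OF C A']
proof (rule gen_equiv_map[where \<phi> = "\<lambda>f. f \<circ> g"])
  note P = cdg_algebra.cdg_algebra_path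
  show "x \<circ> g \<in> Hom_cdgA C A'" if "x \<in> Hom_cdgA A A'" for x
    by (rule Hom_cdgA_comp[OF A A' g that])
  show "(x \<circ> g, y \<circ> g) \<in> path_ends A' (Hom_cdgA C (path_algebra A'))"
    if "(x, y) \<in> path_ends A' (Hom_cdgA A (path_algebra A'))" for x y
    using that
  proof (rule path_ends_map[where \<psi> = "\<lambda>\<Phi>. \<Phi> \<circ> g" and \<phi> = "\<lambda>f. f \<circ> g"])
    show "\<Phi> \<circ> g \<in> Hom_cdgA C (path_algebra A')" if "\<Phi> \<in> Hom_cdgA A (path_algebra A')" for \<Phi>
      by (rule Hom_cdgA_comp[OF A P[OF A'] g that])
  qed (simp add: comp_assoc)
qed

lemma Thomotopic_comp_left:
  fixes A :: "('k::field_char_0, 'a::ab_group_add, 'm) cdga_scheme"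
  assumes B: "cdg_hopf_algebra B" and A: "cdg_algebra A" and A': "cdg_algebra A'"
    and f: "f \<in> Hom_cdgA A A'" and gh: "(\<upsilon>, \<upsilon>') \<in> Thomotopy_rel B A"
  shows "(f \<circ> \<upsilon>, f \<circ> \<upsilon>') \<in> Thomotopy_rel B A'"
  using gh unfolding Thomotopy_rel_eq[OF B A] Thomotopy_rel_eq[OF B A']
proof (rule gen_equiv_map)
  note P = cdg_algebra.cdg_algebra_path
  show "f \<circ> x \<in> THom_cdgA B A'" if "x \<in> THom_cdgA B A" for x
    by (rule Hom_THom_comp[OF A A' that f])
  show "(f \<circ> x, f \<circ> y) \<in> path_ends A' (THom_cdgA B (path_algebra A'))"
    if "(x, y) \<in> path_ends A (THom_cdgA B (path_algebra A))" for x y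
    using that
  proof (rule path_ends_map[where \<psi> = "\<lambda>\<Phi>. path_lift f \<circ> \<Phi>"])
    show "path_lift f \<circ> \<Phi> \<in> THom_cdgA B (path_algebra A')" if "\<Phi> \<in> THom_cdgA B (path_algebra A)" for \<Phi>
      by (rule Hom_THom_comp[OF P[OF A] P[OF A'] that path_lift_Hom(1)[OF A A' f]])
    show "path_eval A' c \<circ> (path_lift f \<circ> \<Phi>) = f \<circ> (path_eval A c \<circ> \<Phi>)" for c \<Phi>
      using path_lift_Hom(2)[OF A A' f] by (simp add: comp_assoc[symmetric])
  qed
qed

lemma Thomotopic_comp_right:
  fixes A :: "('k::field_char_0, 'a::ab_group_add, 'm) cdga_scheme"
  assumes B: "cdg_hopf_algebra B" and A: "cdg_algebra A" and A': "cdg_algebra A'"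
    and \<upsilon>: "\<upsilon> \<in> THom_cdgA B A" and fh: "(f, f') \<in> homotopy_rel A A'"
  shows "(f \<circ> \<upsilon>, f' \<circ> \<upsilon>) \<in> Thomotopy_rel B A'"
  using fh unfolding homotopy_rel_eq[OF A A'] Thomotopy_rel_eq[OF B A']
proof (rule gen_equiv_map[where \<phi> = "\<lambda>f. f \<circ> \<upsilon>"])
  note P = cdg_algebra.cdg_algebra_path
  show "x \<circ> \<upsilon> \<in> THom_cdgA B A'" if "x \<in> Hom_cdgA A A'" for x
    by (rule Hom_THom_comp[OF A A' \<upsilon> that])
  show "(x \<circ> \<upsilon>, y \<circ> \<upsilon>) \<in> path_ends A' (THom_cdgA B (path_algebra A'))"
    if "(x, y) \<in> path_ends A' (Hom_cdgA A (path_algebra A'))" for x y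
    using that
  proof (rule path_ends_map[where \<psi> = "\<lambda>\<Phi>. \<Phi> \<circ> \<upsilon>" and \<phi> = "\<lambda>f. f \<circ> \<upsilon>"])
    show "\<Phi> \<circ> \<upsilon> \<in> THom_cdgA B (path_algebra A')" if "\<Phi> \<in> Hom_cdgA A (path_algebra A')" for \<Phi>
      by (rule Hom_THom_comp[OF A P[OF A'] \<upsilon> that])
  qed (simp add: comp_assoc)
qed

lemma htype_eqI: "(f, g) \<in> homotopy_rel C A \<Longrightarrow> htype C A f = htype C A g"
  unfolding htype_def by (rule equiv_class_eq[OF equiv_homotopy_rel])

lemma Thtype_eqI: "(\<upsilon>, \<tau>) \<in> Thomotopy_rel B A \<Longrightarrow> Thtype B A \<upsilon> = Thtype B A \<tau>"
  unfolding Thtype_def by (rule equiv_class_eq[OF equiv_Thomotopy_rel])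

lemma comp_ho_htype:
  fixes A :: "('k::field_char_0, 'a::ab_group_add, 'm) cdga_scheme"
  assumes C: "cdg_algebra C" and A: "cdg_algebra A" and A': "cdg_algebra A'"
    and f: "f \<in> Hom_cdgA A A'" and g: "g \<in> Hom_cdgA C A"
  shows "comp_ho C A' (htype A A' f) (htype C A g) = htype C A' (f \<circ> g)"
  unfolding comp_ho_def htype_def[of A A' f] htype_def[of C A g]
proof (rule UN_equiv_class2[OF equiv_homotopy_rel equiv_homotopy_rel _ f g],
    rule congruent2I')
  fix f f' g g' assume ff': "(f, f') \<in> homotopy_rel A A'" and gg': "(g, g') \<in> homotopy_rel C A"
  then have "g \<in> Hom_cdgA C A" "f' \<in> Hom_cdgA A A'"
    using equiv_type[OF equiv_homotopy_rel] by blast+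
  then show "htype C A' (f \<circ> g) = htype C A' (f' \<circ> g')"
    using htype_eqI[OF homotopic_comp_right[OF C A A' _ ff']]
      htype_eqI[OF homotopic_comp_left[OF C A A' _ gg']] by simp
qed

lemma Tcomp_ho_Thtype:
  fixes A :: "('k::field_char_0, 'a::ab_group_add, 'm) cdga_scheme"
  assumes B: "cdg_hopf_algebra B" and A: "cdg_algebra A" and A': "cdg_algebra A'"
    and f: "f \<in> Hom_cdgA A A'" and \<upsilon>: "\<upsilon> \<in> THom_cdgA B A"
  shows "Tcomp_ho B A' (htype A A' f) (Thtype B A \<upsilon>) = Thtype B A' (f \<circ> \<upsilon>)"
  unfolding Tcomp_ho_def htype_def Thtype_def[of B A \<upsilon>]
proof (rule UN_equiv_class2[OF equiv_homotopy_rel equiv_Thomotopy_rel _ f \<upsilon>],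
    rule congruent2I')
  fix f f' \<upsilon> \<upsilon>' assume ff': "(f, f') \<in> homotopy_rel A A'" and gg': "(\<upsilon>, \<upsilon>') \<in> Thomotopy_rel B A"
  then have "\<upsilon> \<in> THom_cdgA B A" "f' \<in> Hom_cdgA A A'"
    using equiv_type[OF equiv_homotopy_rel] equiv_type[OF equiv_Thomotopy_rel] by blast+
  then show "Thtype B A' (f \<circ> \<upsilon>) = Thtype B A' (f' \<circ> \<upsilon>')"
    using Thtype_eqI[OF Thomotopic_comp_right[OF B A A' _ ff']]
      Thtype_eqI[OF Thomotopic_comp_left[OF B A A' _ gg']] by simp
qed

section \<open>The convolution product\<close>

definition conv ::
  "('k::field, 'b::ab_group_add, 'l) cdg_hopf_scheme \<Rightarrow> ('k, 'a::ab_group_add, 'm) cdga_scheme \<Rightarrow>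
   ('b \<Rightarrow> 'a) \<Rightarrow> ('b \<Rightarrow> 'a) \<Rightarrow> 'b \<Rightarrow> 'a" where
  "conv B A f g x = lin_ext2 (vscale A) (\<lambda>a b. amult A (f a) (g b)) (comult B x)"

fun conv_pow ::
  "('k::field, 'b::ab_group_add, 'l) cdg_hopf_scheme \<Rightarrow> ('k, 'a::ab_group_add, 'm) cdga_scheme \<Rightarrow>
   ('b \<Rightarrow> 'a) \<Rightarrow> nat \<Rightarrow> 'b \<Rightarrow> 'a" where
  "conv_pow B A h 0 = conv_unit B A"
| "conv_pow B A h (Suc n) = conv B A (conv_pow B A h n) h"

lemma sum_swap_pairs:
  "(\<Sum>i\<in>X. \<Sum>j\<in>Y. \<Sum>p\<in>I. \<Sum>q\<in>J. t i j p q) = (\<Sum>p\<in>I. \<Sum>q\<in>J. \<Sum>i\<in>X. \<Sum>j\<in>Y. t i j p q)"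
proof -
  have "(\<Sum>i\<in>X. \<Sum>j\<in>Y. \<Sum>p\<in>I. \<Sum>q\<in>J. t i j p q) = (\<Sum>i\<in>X. \<Sum>p\<in>I. \<Sum>j\<in>Y. \<Sum>q\<in>J. t i j p q)"
    by (rule sum.cong[OF refl], rule sum.swap)
  also have "\<dots> = (\<Sum>p\<in>I. \<Sum>i\<in>X. \<Sum>j\<in>Y. \<Sum>q\<in>J. t i j p q)"
    by (rule sum.swap)
  also have "\<dots> = (\<Sum>p\<in>I. \<Sum>i\<in>X. \<Sum>q\<in>J. \<Sum>j\<in>Y. t i j p q)"
    by (rule sum.cong[OF refl], rule sum.cong[OF refl], rule sum.swap)
  also have "\<dots> = (\<Sum>p\<in>I. \<Sum>q\<in>J. \<Sum>i\<in>X. \<Sum>j\<in>Y. t i j p q)"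
    by (rule sum.cong[OF refl], rule sum.swap)
  finally show ?thesis .
qed

lemma lookup_lin_ext_fscale:
  "Poly_Mapping.lookup (lin_ext fscale H p) w =
     (\<Sum>u\<in>Poly_Mapping.keys p. Poly_Mapping.lookup p u * Poly_Mapping.lookup (H u) w)"
  by (simp add: lin_ext_def lookup_sum)

lemma Nil_notin_tens_map_tens1: "[] \<notin> Poly_Mapping.keys (tens_map F tens1 p)"
  by (simp add: in_keys_iff tens_map_def lin_ext2_def tconc_def tens1_def lookup_lin_ext_fscale
      vector_space.lin_ext_pure[OF vector_space_fscale] pure_def lookup_single)

lemma Nil_notin_comult_iter: "[] \<notin> Poly_Mapping.keys (comult_iter B (Suc n) x)"
  by (cases n) (simp_all add: Nil_notin_tens_map_tens1 tens1_def pure_def)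

lemma Nil_notin_red_comult_iter: "[] \<notin> Poly_Mapping.keys (red_comult_iter B (Suc n) x)"
  by (cases n) (simp_all add: Nil_notin_tens_map_tens1 tens1_def pure_def)

locale convolution = B: cdg_hopf_algebra B + A: cdg_algebra A
  for B :: "('k::field, 'b::ab_group_add, 'l) cdg_hopf_scheme"
    and A :: "('k, 'a::ab_group_add, 'm) cdga_scheme"
begin

abbreviation lin where "lin \<equiv> Vector_Spaces.linear (vscale B) (vscale A)"
abbreviation e where "e \<equiv> conv_unit B A"
abbreviation cv (infixl "\<star>" 70) where "f \<star> g \<equiv> conv B A f g"
abbreviation pow where "pow \<equiv> conv_pow B A"

lemma lin_iff: "lin f \<longleftrightarrow> (\<forall>x y. f (x + y) = f x + f y) \<and> (\<forall>c x. f (vscale B c x) = vscale A c (f x))"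
  by (simp add: Vector_Spaces.linear_iff B.vector_space_axioms A.vector_space_axioms)

lemma lin_diff: "lin f \<Longrightarrow> f (x - y) = f x - f y"
  by (metis add_diff_cancel_right' diff_add_cancel lin_iff)

lemma bilinear_prod:
  "lin f \<Longrightarrow> lin g \<Longrightarrow> bilinear_map (vscale B) (vscale A) (\<lambda>a b. amult A (f a) (g b))"
  by (simp add: lin_iff bilinear_map_def A.mult_add_left A.mult_add_right A.mult_scale_left
      A.mult_scale_right)

text \<open>The coproduct is linear, coassociative and multiplicative only up to \<open>tens_eq\<close>.  Convolution does
  not see the choice of representative, so each law of \<open>\<Delta>\<close> gives an equation for convolutions.\<close>

lemma conv_tens_eq:
  assumes "lin f" "lin g" "tens_eq (vscale B) (comult B x) q"
  shows "(f \<star> g) x = lin_ext (vscale A) (on_pairs (\<lambda>a b. amult A (f a) (g b))) q"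
  unfolding conv_def
  by (rule lin_ext2_tens_eq[OF A.vector_space_axioms bilinear_prod[OF assms(1,2)] assms(3) B.comult_pow])

lemma conv_lin: assumes "lin f" "lin g" shows "lin (f \<star> g)"
proof -
  have *: "lin_ext (vscale A) (on_pairs (\<lambda>a b. amult A (f a) (g b))) (comult B x) = (f \<star> g) x" for x
    by (simp add: conv_def lin_ext2_eq_on_pairs[OF B.comult_pow])
  show ?thesis
    using conv_tens_eq[OF assms B.comult_add] conv_tens_eq[OF assms B.comult_scale]
    by (simp add: lin_iff A.lin_ext_add A.lin_ext_fscale *)
qed

lemma conv_at_unit: "lin f \<Longrightarrow> lin g \<Longrightarrow> (f \<star> g) (aunit B) = amult A (f (aunit B)) (g (aunit B))"
  by (simp add: conv_tens_eq[OF _ _ B.comult_unit])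

lemma counit_add: "counit B (x + y) = counit B x + counit B y"
  and counit_scale: "counit B (vscale B c x) = c * counit B x"
  using B.counit_linear by (simp_all add: Vector_Spaces.linear_iff)

lemma e_lin: "lin e"
  by (simp add: lin_iff conv_unit_def unit_map_def counit_add counit_scale A.scale_left_distrib)

lemma e_unit: "e (aunit B) = aunit A"
  by (simp add: conv_unit_def unit_map_def B.counit_unit)

lemma conv_unit_right: assumes "lin f" shows "f \<star> e = f"
proof
  fix x
  have "(f \<star> e) x = lin_ext2 (vscale A) (\<lambda>a b. f (vscale B (counit B b) a)) (comult B x)"
    using assms by (simp add: conv_def A.conv_unit_mult_right lin_iff)
  also have "\<dots> = f x"
    using linear_lin_ext2[OF assms, of "\<lambda>a b. vscale B (counit B b) a" "comult B x"] B.counit_right[of x]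
    by simp
  finally show "(f \<star> e) x = f x" .
qed

lemma conv_unit_left: assumes "lin f" shows "e \<star> f = f"
proof
  fix x
  have "(e \<star> f) x = lin_ext2 (vscale A) (\<lambda>a b. f (vscale B (counit B a) b)) (comult B x)"
    using assms by (simp add: conv_def A.conv_unit_mult_left lin_iff)
  also have "\<dots> = f x"
    using linear_lin_ext2[OF assms, of "\<lambda>a b. vscale B (counit B a) b" "comult B x"] B.counit_left[of x]
    by simp
  finally show "(e \<star> f) x = f x" .
qed

text \<open>Both sides are the value of one trilinear map on the two sides of coassociativity.\<close>

lemma conv_assoc:
  assumes "lin f" "lin g" "lin h"
  shows "(f \<star> g) \<star> h = f \<star> (g \<star> h)"
proof
  fix x
  let ?t = "\<lambda>a b c. amult A (amult A (f a) (g b)) (h c)"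
  have ml: "multilinear (vscale B) (vscale A) (on_triples ?t)"
    using assms by (intro multilinear_on_triples[OF A.vector_space_axioms])
      (simp_all add: lin_iff bilinear_map_def A.mult_add_left A.mult_add_right A.mult_scale_left A.mult_scale_right)
  have left: "lin_ext (vscale A) (\<lambda>u. on_triples ?t (u @ [c])) (comult B y) = amult A ((f \<star> g) y) (h c)" for y c
    unfolding conv_def linear_lin_ext2[OF A.mult_linear_left]
    by (rule lin_ext_eq_lin_ext2[OF B.comult_pow]) simp
  have right: "lin_ext (vscale A) (\<lambda>w. on_triples ?t ([a] @ w)) (comult B y) = amult A (f a) ((g \<star> h) y)" for y a
    unfolding conv_def linear_lin_ext2[OF A.mult_linear_right]
    by (rule lin_ext_eq_lin_ext2[OF B.comult_pow]) (simp add: A.mult_assoc)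
  have "((f \<star> g) \<star> h) x = lin_ext (vscale A) (on_triples ?t) (tens_map (comult B) tens1 (comult B x))"
    by (simp add: A.lin_ext_tens_map tens1_def left) (simp add: conv_def)
  also have "\<dots> = lin_ext (vscale A) (on_triples ?t) (tens_map tens1 (comult B) (comult B x))"
    by (rule lin_ext_tens_eq[OF A.vector_space_axioms ml B.coassoc])
  also have "\<dots> = (f \<star> (g \<star> h)) x"
    using right by (simp add: A.lin_ext_tens_map tens1_def) (simp add: conv_def)
  finally show "((f \<star> g) \<star> h) x = (f \<star> (g \<star> h)) x" .
qed

lemma conv_scale_left: "(\<lambda>x. vscale A c (f x)) \<star> g = (\<lambda>x. vscale A c ((f \<star> g) x))"
  by (simp add: conv_def fun_eq_iff A.mult_scale_left A.lin_ext2_fun_scale)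

lemma Hom_deg_lin: "f \<in> Hom_deg B A k \<Longrightarrow> lin f"
  by (rule Hom_deg_linearD)

lemma conv_Hom_deg:
  assumes f: "f \<in> Hom_deg B A 0" and g: "g \<in> Hom_deg B A 0"
  shows "f \<star> g \<in> Hom_deg B A 0"
proof -
  have "(f \<star> g) x \<in> grade A i" if x: "x \<in> grade B i" for x i
  proof -
    obtain q where q: "tens_eq (vscale B) (comult B x) q"
      "\<And>w. w \<in> Poly_Mapping.keys q \<Longrightarrow> \<exists>j a b. w = [a, b] \<and> a \<in> grade B j \<and> b \<in> grade B (i - j)"
      using B.comult_deg[OF x] by (auto simp: tens2_grade_def)
    have "on_pairs (\<lambda>a b. amult A (f a) (g b)) w \<in> grade A i" if w: "w \<in> Poly_Mapping.keys q" for w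
    proof -
      obtain j a b where w: "w = [a, b]" and a: "a \<in> grade B j" and b: "b \<in> grade B (i - j)"
        using q(2)[OF w] by blast
      show ?thesis
        using A.mult_deg[OF Hom_deg_gradeD[OF f a] Hom_deg_gradeD[OF g b]] by (simp add: w)
    qed
    then show ?thesis
      unfolding conv_tens_eq[OF Hom_deg_lin[OF f] Hom_deg_lin[OF g] q(1)]
      by (rule A.lin_ext_in_subspace[OF A.subspace_grade])
  qed
  then show ?thesis
    using conv_lin[OF Hom_deg_lin[OF f] Hom_deg_lin[OF g]] by (auto simp: Hom_deg_def)
qed

text \<open>The sign in the differential of \<open>B \<otimes> B\<close> is that of the Leibniz rule in \<open>A\<close>, because \<open>f\<close> preserves
  degrees.\<close>

lemma conv_chain_map:
  assumes f: "f \<in> Hom_deg B A 0" and g: "g \<in> Hom_deg B A 0"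
    and df: "\<And>x. adiff A (f x) = f (adiff B x)" and dg: "\<And>x. adiff A (g x) = g (adiff B x)"
  shows "adiff A ((f \<star> g) x) = (f \<star> g) (adiff B x)"
proof -
  note lf = Hom_deg_lin[OF f] and lg = Hom_deg_lin[OF g]
  have fgi: "(\<Sum>i | hcomp (grade B) a i \<noteq> 0. vscale A ((- 1) powi i) (amult A (f (hcomp (grade B) a i)) z)) =
      amult A (A.gi (f a)) z" for a z
  proof -
    interpret f: Vector_Spaces.linear "vscale B" "vscale A" f by (rule lf)
    have "A.gi (f a) = f (B.gi a)"
      by (rule Hom_deg_0_gr_inv[OF B.cdg_algebra_axioms A.cdg_algebra_axioms f, symmetric])
    then show ?thesis by (simp add: gr_inv_def f.sum f.scale A.mult_sum_left A.mult_scale_left)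
  qed
  have "(f \<star> g) (adiff B x) =
      lin_ext (vscale A) (on_pairs (\<lambda>a b. amult A (f a) (g b))) (tens2_diff B (comult B x))"
    by (rule conv_tens_eq[OF lf lg B.comult_diff])
  also have "\<dots> = lin_ext2 (vscale A) (\<lambda>a b. adiff A (amult A (f a) (g b))) (comult B x)"
    by (simp add: tens2_diff_def A.lin_ext_lin_ext2 A.lin_ext_add A.lin_ext_sum A.lin_ext_fscale
        fgi A.leibniz_gi df dg)
  also have "\<dots> = adiff A ((f \<star> g) x)"
    by (simp add: conv_def linear_lin_ext2[OF A.diff_linear])
  finally show ?thesis ..
qed

text \<open>Maps of degree 0 into a graded commutative algebra commute up to exactly the signs in the
  product of \<open>B \<otimes> B\<close>.\<close>

lemma koszul_swap:
  assumes \<beta>: "\<beta> \<in> Hom_deg B A 0" and \<gamma>: "\<gamma> \<in> Hom_deg B A 0"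
  shows "(\<Sum>i | hcomp (grade B) b i \<noteq> 0. \<Sum>j | hcomp (grade B) a j \<noteq> 0.
      vscale A ((- 1) powi (i * j)) (amult A (\<beta> (hcomp (grade B) a j)) (\<gamma> (hcomp (grade B) b i)))) =
    amult A (\<gamma> b) (\<beta> a)"
proof -
  interpret \<beta>: Vector_Spaces.linear "vscale B" "vscale A" \<beta> by (rule Hom_deg_lin[OF \<beta>])
  interpret \<gamma>: Vector_Spaces.linear "vscale B" "vscale A" \<gamma> by (rule Hom_deg_lin[OF \<gamma>])
  have "vscale A ((- 1) powi (i * j)) (amult A (\<beta> (hcomp (grade B) a j)) (\<gamma> (hcomp (grade B) b i))) =
      amult A (\<gamma> (hcomp (grade B) b i)) (\<beta> (hcomp (grade B) a j))" for i j
    using A.mult_comm[OF Hom_deg_gradeD[OF \<gamma> B.hcomp_in] Hom_deg_gradeD[OF \<beta> B.hcomp_in], of b i a j]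
    by simp
  then have "?thesis \<longleftrightarrow> amult A (\<gamma> (\<Sum>i | hcomp (grade B) b i \<noteq> 0. hcomp (grade B) b i))
       (\<beta> (\<Sum>j | hcomp (grade B) a j \<noteq> 0. hcomp (grade B) a j)) = amult A (\<gamma> b) (\<beta> a)"
    by (simp add: \<beta>.sum \<gamma>.sum A.mult_sum_left A.mult_sum_right) (subst sum.swap, simp)
  then show ?thesis by (simp add: B.sum_hcomp)
qed

text \<open>Convolution is compatible with the products of \<open>B\<close> and \<open>A\<close>: if \<open>f \<circ> m\<close> and \<open>g \<circ> m\<close> are
  sums of products of maps in separate variables, then so is \<open>(f \<star> g) \<circ> m\<close>, because the
  coproduct of \<open>B\<close> is multiplicative.\<close>

lemma conv_mult:
  assumes f: "lin f" and g: "lin g"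
    and fm: "\<And>x y. f (amult B x y) = (\<Sum>p\<in>I. amult A (\<alpha> p x) (\<beta> p y))"
    and gm: "\<And>x y. g (amult B x y) = (\<Sum>q\<in>J. amult A (\<gamma> q x) (\<delta> q y))"
    and \<beta>: "\<And>p. p \<in> I \<Longrightarrow> \<beta> p \<in> Hom_deg B A 0" and \<gamma>: "\<And>q. q \<in> J \<Longrightarrow> \<gamma> q \<in> Hom_deg B A 0"
  shows "(f \<star> g) (amult B x y) =
    (\<Sum>p\<in>I. \<Sum>q\<in>J. amult A ((\<alpha> p \<star> \<gamma> q) x) ((\<beta> p \<star> \<delta> q) y))"
proof -
  have inner: "(\<Sum>i | hcomp (grade B) b i \<noteq> 0. \<Sum>j | hcomp (grade B) a' j \<noteq> 0.
      vscale A ((- 1) powi (i * j)) (amult A (f (amult B a (hcomp (grade B) a' j)))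
        (g (amult B (hcomp (grade B) b i) b')))) =
    (\<Sum>p\<in>I. \<Sum>q\<in>J. amult A (amult A (\<alpha> p a) (\<gamma> q b)) (amult A (\<beta> p a') (\<delta> q b')))"
    (is "?L = ?R") for a b a' b'
  proof -
    have "?L = (\<Sum>i | hcomp (grade B) b i \<noteq> 0. \<Sum>j | hcomp (grade B) a' j \<noteq> 0. \<Sum>p\<in>I. \<Sum>q\<in>J.
        amult A (\<alpha> p a) (amult A (vscale A ((- 1) powi (i * j))
          (amult A (\<beta> p (hcomp (grade B) a' j)) (\<gamma> q (hcomp (grade B) b i)))) (\<delta> q b')))"
      unfolding fm gm
      unfolding A.mult_sum_left unfolding A.mult_sum_right
      by (simp add: A.scale_sum_right A.mult_assoc A.mult_scale_left A.mult_scale_right)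
    also have "\<dots> = (\<Sum>p\<in>I. \<Sum>q\<in>J. \<Sum>i | hcomp (grade B) b i \<noteq> 0. \<Sum>j | hcomp (grade B) a' j \<noteq> 0.
        amult A (\<alpha> p a) (amult A (vscale A ((- 1) powi (i * j))
          (amult A (\<beta> p (hcomp (grade B) a' j)) (\<gamma> q (hcomp (grade B) b i)))) (\<delta> q b')))"
      by (rule sum_swap_pairs)
    also have "\<dots> = (\<Sum>p\<in>I. \<Sum>q\<in>J. amult A (\<alpha> p a) (amult A (amult A (\<gamma> q b) (\<beta> p a')) (\<delta> q b')))"
      by (intro sum.cong refl)
        (simp add: koszul_swap[OF \<beta> \<gamma>, symmetric] A.mult_sum_left A.mult_sum_right)
    finally show ?thesis by (simp add: A.mult_assoc)
  qed
  have "(f \<star> g) (amult B x y) = lin_ext (vscale A) (on_pairs (\<lambda>a b. amult A (f a) (g b)))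
      (tens2_mult B (comult B x) (comult B y))"
    by (rule conv_tens_eq[OF f g B.comult_mult])
  also have "\<dots> = lin_ext2 (vscale A) (\<lambda>a b. lin_ext2 (vscale A) (\<lambda>a' b'.
      \<Sum>p\<in>I. \<Sum>q\<in>J. amult A (amult A (\<alpha> p a) (\<gamma> q b)) (amult A (\<beta> p a') (\<delta> q b')))
      (comult B y)) (comult B x)"
    by (simp add: tens2_mult_def A.lin_ext_lin_ext2 A.lin_ext_sum A.lin_ext_fscale inner)
  also have "\<dots> = (\<Sum>p\<in>I. \<Sum>q\<in>J. amult A ((\<alpha> p \<star> \<gamma> q) x) ((\<beta> p \<star> \<delta> q) y))"
    unfolding A.lin_ext2_fun_sum conv_def linear_lin_ext2[OF A.mult_linear_left]
    unfolding linear_lin_ext2[OF A.mult_linear_right] ..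
  finally show ?thesis .
qed

section \<open>Convolution powers\<close>

lemma pow_lin: "lin h \<Longrightarrow> lin (pow h n)"
  by (induction n) (simp_all add: e_lin conv_lin)

lemma pow_1: "lin h \<Longrightarrow> pow h (Suc 0) = h"
  by (simp add: conv_unit_left)

lemma pow_add: "lin h \<Longrightarrow> pow h m \<star> pow h n = pow h (m + n)"
  by (induction n) (simp_all add: conv_unit_right pow_lin conv_assoc[symmetric])

lemma pow_at_unit: "lin h \<Longrightarrow> h (aunit B) = 0 \<Longrightarrow> pow h (Suc n) (aunit B) = 0"
  by (simp add: conv_at_unit pow_lin)

text \<open>The first letter is treated by a separate map \<open>k\<close>.  For \<open>k = h ^ m\<close> this expresses the power
  \<open>h ^ (m + n)\<close> through the iterated coproduct with only \<open>n + 1\<close> factors, which is what makes the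
  vanishing of one iterated reduced coproduct affect all higher powers.\<close>

definition word_prod :: "('b \<Rightarrow> 'a) \<Rightarrow> ('b \<Rightarrow> 'a) \<Rightarrow> 'b list \<Rightarrow> 'a" where
  "word_prod k h w = (case w of [] \<Rightarrow> 0 | a # w' \<Rightarrow> foldl (\<lambda>z b. amult A z (h b)) (k a) w')"

lemma word_prod_simps [simp]:
  "word_prod k h [a] = k a" "word_prod k h (a # w @ [b]) = amult A (word_prod k h (a # w)) (h b)"
  by (simp_all add: word_prod_def)

lemma word_prod_snoc: "u \<noteq> [] \<Longrightarrow> word_prod k h (u @ [b]) = amult A (word_prod k h u) (h b)"
  by (cases u) simp_all

lemma mult_word_map: "w \<noteq> [] \<Longrightarrow> mult_word A (map h w) = word_prod h h w"
  by (cases w) (simp_all add: mult_word_def word_prod_def foldl_map)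

lemma multilinear_word_prod:
  assumes "lin k" "lin h"
  shows "multilinear (vscale B) (vscale A) (word_prod k h)"
proof -
  let ?F = "foldl (\<lambda>z b. amult A z (h b))"
  have add: "?F (z + z') w = ?F z w + ?F z' w" for z z' w
    by (induction w arbitrary: z z') (simp_all add: A.mult_add_left)
  have scale: "?F (vscale A c z) w = vscale A c (?F z w)" for c z w
    by (induction w arbitrary: z) (simp_all add: A.mult_scale_left)
  have "word_prod k h (u @ (x + y) # w) = word_prod k h (u @ x # w) + word_prod k h (u @ y # w)"
    "word_prod k h (u @ vscale B c x # w) = vscale A c (word_prod k h (u @ x # w))" for u x y w c
    using assms
    by (cases u; simp add: word_prod_def lin_iff add scale A.mult_add_right A.mult_scale_right)+
  then show ?thesis by (simp add: multilinear_def)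
qed

lemma comult_iter_word_prod:
  "lin_ext (vscale A) (word_prod k h) (comult_iter B (Suc n) x) = ((\<lambda>f. f \<star> h) ^^ n) k x"
proof (induction n arbitrary: x)
  case 0
  then show ?case by (simp add: tens1_def)
next
  case (Suc n)
  have *: "lin_ext (vscale A) (\<lambda>u. word_prod k h (u @ [b])) (comult_iter B (Suc n) a) =
      amult A (((\<lambda>f. f \<star> h) ^^ n) k a) (h b)" for a b
    unfolding Suc.IH[symmetric] linear_lin_ext[OF A.mult_linear_left]
    by (intro lin_ext_cong word_prod_snoc) (use Nil_notin_comult_iter in metis)
  show ?case
    by (simp add: A.lin_ext_tens_map tens1_def * ) (simp add: conv_def)
qed

lemma conv_pow_iterate: "lin h \<Longrightarrow> pow h (m + n) = ((\<lambda>f. f \<star> h) ^^ n) (pow h m)"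
  by (induction n) simp_all

text \<open>The iterated coproducts are bracketed to the left, as are the powers \<open>pow\<close>.  The
  exponent 0 is excluded because \<open>pow h 0 = e\<close>, while the iterated coproduct of index 0 is 0.\<close>

lemma conv_power_eq_pow:
  assumes "lin h" "n \<ge> 1"
  shows "conv_power B A h n x = pow h n x"
proof -
  obtain m where n: "n = Suc m" using assms(2) by (cases n) auto
  have "conv_power B A h n x = lin_ext (vscale A) (word_prod h h) (comult_iter B (Suc m) x)"
    unfolding conv_power_def mult_iter_def A.lin_ext_fmap n
    by (intro lin_ext_cong mult_word_map) (use Nil_notin_comult_iter in metis)
  also have "\<dots> = pow h n x"
    using conv_pow_iterate[OF assms(1), of "Suc 0" m] by (simp add: comult_iter_word_prod pow_1[OF assms(1)] n
      del: conv_pow.simps)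
  finally show ?thesis .
qed

text \<open>On maps that kill the unit, convolution does not see the difference between the coproduct
  and the reduced coproduct.\<close>

lemma red_comult_iter_word_prod:
  assumes k: "lin k" "k (aunit B) = 0" and h: "lin h" "h (aunit B) = 0"
  shows "lin_ext (vscale A) (word_prod k h) (red_comult_iter B (Suc n) x) = ((\<lambda>f. f \<star> h) ^^ n) k x"
proof (induction n arbitrary: x)
  case 0
  then show ?case by (simp add: tens1_def)
next
  case (Suc n)
  let ?F = "((\<lambda>f. f \<star> h) ^^ n) k"
  have F: "lin ?F \<and> ?F (aunit B) = 0"
    by (induction n) (use k h in \<open>simp_all add: conv_lin conv_at_unit\<close>)
  have *: "lin_ext (vscale A) (\<lambda>u. word_prod k h (u @ [b])) (red_comult_iter B (Suc n) a) =
      amult A (?F a) (h b)" for a b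
    unfolding Suc.IH[symmetric] linear_lin_ext[OF A.mult_linear_left]
    by (intro lin_ext_cong word_prod_snoc) (use Nil_notin_red_comult_iter in metis)
  have "lin_ext (vscale A) (word_prod k h) (red_comult_iter B (Suc (Suc n)) x) =
      lin_ext2 (vscale A) (\<lambda>a b. amult A (?F a) (h b)) (red_comult B x)"
    by (simp add: A.lin_ext_tens_map tens1_def * )
  also have "\<dots> = (?F \<star> h) x"
    using F h by (simp add: red_comult_def lin_ext2_def A.lin_ext_diff conv_def)
  finally show ?case by simp
qed

text \<open>Conilpotence bounds the convolution powers: once one iterated reduced coproduct of \<open>x\<close>
  vanishes, every product of more than that many maps killing the unit vanishes on \<open>x\<close>.\<close>

lemma pow_eventually_zero:
  assumes conil: "conilpotent B" and h: "lin h" "h (aunit B) = 0"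
  shows "\<exists>N. \<forall>n>N. pow h n x = 0"
proof -
  \<comment> \<open>The projection of \<open>x\<close> to the kernel of the counit.\<close>
  define y where "y = x - vscale B (counit B x) (aunit B)"
  have "counit B (y + vscale B (counit B x) (aunit B)) = counit B y + counit B x"
    by (simp only: counit_add counit_scale B.counit_unit mult_1_right)
  then have "counit B y = 0" by (simp add: y_def)
  then obtain N where N: "N \<ge> 1" and red: "tens_eq (vscale B) (red_comult_iter B (N + 1) y) 0"
    using conil unfolding conilpotent_def by blast
  have "pow h n x = 0" if n: "n > N" for n
  proof -
    \<comment> \<open>The first factor must be a positive power of \<open>h\<close> in order to kill the unit.\<close>
    obtain m where m: "n = Suc m + N" using n less_iff_Suc_add[of N n] by auto
    have "pow h n (aunit B) = 0" unfolding m using pow_at_unit[OF h] by simp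
    then have "pow h n x = pow h n y"
      using pow_lin[OF h(1), of n] by (simp add: y_def lin_diff lin_iff)
    also have "\<dots> = lin_ext (vscale A) (word_prod (pow h (Suc m)) h) (red_comult_iter B (Suc N) y)"
      unfolding m conv_pow_iterate[OF h(1)]
      by (rule red_comult_iter_word_prod[symmetric, OF pow_lin[OF h(1)] pow_at_unit[OF h] h])
    also have "\<dots> = 0"
      using lin_ext_tens_eq[OF A.vector_space_axioms multilinear_word_prod[OF pow_lin[OF h(1)] h(1)] red]
      by (simp del: conv_pow.simps)
    finally show ?thesis .
  qed
  then show ?thesis by blast
qed

end

section \<open>Power series in the convolution algebra\<close>

text \<open>The value at \<open>x\<close> of the power series \<open>\<Sum>n. a_n h^n\<close> under convolution.  It is only used
  for maps \<open>h\<close> that kill the unit, where conilpotence makes the sum finite.\<close>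

definition conv_series ::
  "('k::field, 'b::ab_group_add, 'l) cdg_hopf_scheme \<Rightarrow> ('k, 'a::ab_group_add, 'm) cdga_scheme \<Rightarrow>
   'k fps \<Rightarrow> ('b \<Rightarrow> 'a) \<Rightarrow> 'b \<Rightarrow> 'a" where
  "conv_series B A a h x =
     (\<Sum>n | conv_pow B A h n x \<noteq> 0. vscale A (fps_nth a n) (conv_pow B A h n x))"

locale conilpotent_convolution = convolution B A
  for B :: "('k::field, 'b::ab_group_add, 'l) cdg_hopf_scheme"
    and A :: "('k, 'a::ab_group_add, 'm) cdga_scheme" +
  assumes conil: "conilpotent B"
begin

abbreviation ser where "ser \<equiv> conv_series B A"

definition pointed :: "('b \<Rightarrow> 'a) \<Rightarrow> bool" where
  "pointed h \<longleftrightarrow> lin h \<and> h (aunit B) = 0"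

lemma pointed_lin: "pointed h \<Longrightarrow> lin h"
  by (simp add: pointed_def)

lemma pow_bound:
  assumes "pointed h" "finite X"
  obtains N where "\<And>x n. x \<in> X \<Longrightarrow> n > N \<Longrightarrow> pow h n x = 0"
proof -
  have "\<exists>N. \<forall>x\<in>X. \<forall>n>N. pow h n x = 0"
    using assms(2)
  proof (induction X rule: finite_induct)
    case (insert x X)
    then obtain N where N: "\<forall>x\<in>X. \<forall>n>N. pow h n x = 0" by blast
    obtain M where M: "\<forall>n>M. pow h n x = 0"
      using pow_eventually_zero[OF conil] assms(1) unfolding pointed_def by blast
    show ?case using N M by (intro exI[of _ "max N M"]) auto
  qed simp
  then show thesis using that by blast
qed

lemma pow_bound_at:
  assumes "pointed h"
  obtains N where "\<And>n. n > N \<Longrightarrow> pow h n x = 0"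
proof -
  from assms obtain N where "\<forall>n>N. pow h n x = 0"
    using pow_eventually_zero[OF conil] unfolding pointed_def by blast
  then show thesis using that by blast
qed

lemma ser_eq:
  assumes "\<And>n. n > N \<Longrightarrow> pow h n x = 0"
  shows "ser a h x = (\<Sum>n\<le>N. vscale A (fps_nth a n) (pow h n x))"
  unfolding conv_series_def using assms
  by (intro sum.mono_neutral_left) (auto simp: not_less[symmetric])

lemma ser_lin: assumes h: "pointed h" shows "lin (ser a h)"
proof -
  note pl = pow_lin[OF pointed_lin[OF h]]
  have "ser a h (x + y) = ser a h x + ser a h y \<and> ser a h (vscale B c x) = vscale A c (ser a h x)" for x y c
  proof -
    obtain N where "\<And>z n. z \<in> {x, y, x + y, vscale B c x} \<Longrightarrow> n > N \<Longrightarrow> pow h n z = 0"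
      using pow_bound[OF h, of "{x, y, x + y, vscale B c x}"] by auto
    then have "ser a h z = (\<Sum>n\<le>N. vscale A (fps_nth a n) (pow h n z))"
      if "z \<in> {x, y, x + y, vscale B c x}" for z
      using that by (intro ser_eq) blast
    then show ?thesis
      using pl by (simp add: lin_iff A.scale_right_distrib sum.distrib A.scale_sum_right mult.commute)
  qed
  then show ?thesis by (simp add: lin_iff)
qed

lemma ser_at_unit: "pointed h \<Longrightarrow> ser a h (aunit B) = vscale A (fps_nth a 0) (aunit A)"
  using ser_eq[of 0 h "aunit B" a] pow_at_unit[of h]
  by (auto simp: pointed_def e_unit gr0_conv_Suc simp del: conv_pow.simps(2))

lemma ser_pointed: "pointed h \<Longrightarrow> fps_nth a 0 = 0 \<Longrightarrow> pointed (ser a h)"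
  by (simp add: pointed_def[of "ser a h"] ser_lin ser_at_unit)

lemma ser_1: "pointed h \<Longrightarrow> ser 1 h = e"
proof
  fix x assume "pointed h"
  then obtain N where "\<And>n. n > N \<Longrightarrow> pow h n x = 0" using pow_bound_at by blast
  from ser_eq[OF this, where a = 1] show "ser 1 h x = e x"
    by (simp add: if_distrib[of "\<lambda>c. vscale A c _"] sum.If_cases cong: if_cong)
qed

lemma ser_X: assumes "pointed h" shows "ser fps_X h = h"
proof
  fix x
  obtain N where N: "\<And>n. n > N \<Longrightarrow> pow h n x = 0" using pow_bound_at[OF assms] by blast
  then have "ser fps_X h x = (\<Sum>n\<le>Suc N. vscale A (fps_nth fps_X n) (pow h n x))"
    by (intro ser_eq) simp
  also have "\<dots> = vscale A 1 (pow h (Suc 0) x)"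
    by (subst sum.mono_neutral_right[of _ "{Suc 0}"]) (auto simp: fps_X_nth)
  finally show "ser fps_X h x = h x" using pow_1[OF pointed_lin[OF assms]] by simp
qed

lemma ser_add: assumes "pointed h" shows "ser (a + b) h x = ser a h x + ser b h x"
proof -
  obtain N where "\<And>n. n > N \<Longrightarrow> pow h n x = 0" using pow_bound_at[OF assms] by blast
  from ser_eq[OF this] show ?thesis by (simp add: A.scale_left_distrib sum.distrib)
qed

text \<open>The series on the right are truncated at \<open>N\<close>; the product of the truncations agrees with that of
  the series at \<open>x\<close>, as \<open>h ^ (i + j)\<close> vanishes at \<open>x\<close> once \<open>i + j > N\<close>.\<close>

lemma ser_mult: assumes h: "pointed h" shows "ser (a * b) h = ser a h \<star> ser b h"
proof
  fix x
  \<comment> \<open>One bound for \<open>x\<close> and for all tensor factors that occur in its coproduct.\<close>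
  let ?X = "insert x (\<Union>w\<in>Poly_Mapping.keys (comult B x). set w)"
  obtain N where N: "\<And>y n. y \<in> ?X \<Longrightarrow> n > N \<Longrightarrow> pow h n y = 0"
    using pow_bound[OF h, of ?X] by auto
  let ?f = "\<lambda>i j. vscale A (fps_nth a i * fps_nth b j) (pow h (i + j) x)"
  have ser: "ser a h y = (\<Sum>n\<le>N. vscale A (fps_nth a n) (pow h n y))" if "y \<in> ?X" for a y
    using N[OF that] by (rule ser_eq)
  have "(ser a h \<star> ser b h) x = ((\<lambda>y. \<Sum>i\<le>N. vscale A (fps_nth a i) (pow h i y)) \<star>
      (\<lambda>y. \<Sum>j\<le>N. vscale A (fps_nth b j) (pow h j y))) x"
    unfolding conv_def by (rule lin_ext2_cong[OF B.comult_pow], subst (1 2) ser) force+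
  also have "\<dots> = (\<Sum>i\<le>N. \<Sum>j\<le>N. vscale A (fps_nth a i * fps_nth b j) ((pow h i \<star> pow h j) x))"
    unfolding conv_def A.mult_sum_left unfolding A.mult_sum_right A.lin_ext2_fun_sum
    by (simp add: A.mult_scale_left A.mult_scale_right A.lin_ext2_fun_scale mult.commute)
  also have "\<dots> = (\<Sum>i\<le>N. \<Sum>j\<le>N. ?f i j)"
    by (simp add: pow_add[OF pointed_lin[OF h]])
  also have "\<dots> = (\<Sum>n\<le>N + N. \<Sum>i\<le>n. ?f i (n - i))"
    by (rule Cauchy_sum_rectangle[symmetric]) (auto simp: N)
  also have "\<dots> = (\<Sum>n\<le>N + N. vscale A (fps_nth (a * b) n) (pow h n x))"
    by (simp add: fps_mult_nth A.scale_sum_left atLeast0AtMost)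
  also have "\<dots> = ser (a * b) h x"
    by (rule ser_eq[symmetric]) (simp add: N)
  finally show "ser (a * b) h x = (ser a h \<star> ser b h) x" ..
qed

lemma pow_ser: "pointed h \<Longrightarrow> pow (ser b h) n = ser (b ^ n) h"
  by (induction n) (simp_all add: ser_1 ser_mult[symmetric] mult.commute)

text \<open>The \<open>n\<close>-th power of \<open>b\<close> has order at least \<open>n\<close>, so the powers of \<open>ser b h\<close> vanish at \<open>x\<close> beyond
  the bound for \<open>h\<close>.\<close>

lemma ser_compose:
  assumes h: "pointed h" and b: "fps_nth b 0 = 0"
  shows "ser (a oo b) h = ser a (ser b h)"
proof
  fix x
  obtain N where N: "\<And>n. n > N \<Longrightarrow> pow h n x = 0" using pow_bound_at[OF h] by blast
  have b0: "fps_nth (b ^ n) k = 0" if "k < n" for n k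
    using startsby_zero_power_prefix[OF b] that by blast
  have pow: "pow (ser b h) n x = (\<Sum>k\<le>N. vscale A (fps_nth (b ^ n) k) (pow h k x))" for n
    unfolding pow_ser[OF h] using N by (rule ser_eq)
  have "pow (ser b h) n x = 0" if "n > N" for n
    unfolding pow using that by (intro sum.neutral) (simp add: b0)
  then have "ser a (ser b h) x = (\<Sum>n\<le>N. vscale A (fps_nth a n) (pow (ser b h) n x))"
    by (rule ser_eq)
  also have "\<dots> = (\<Sum>n\<le>N. \<Sum>k\<le>N. vscale A (fps_nth a n * fps_nth (b ^ n) k) (pow h k x))"
    by (simp add: pow A.scale_sum_right)
  also have "\<dots> = (\<Sum>k\<le>N. \<Sum>n\<le>N. vscale A (fps_nth a n * fps_nth (b ^ n) k) (pow h k x))"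
    by (rule sum.swap)
  also have "\<dots> = (\<Sum>k\<le>N. vscale A (fps_nth (a oo b) k) (pow h k x))"
  proof (rule sum.cong[OF refl])
    fix k assume "k \<in> {..N}"
    then have "(\<Sum>n\<le>N. fps_nth a n * fps_nth (b ^ n) k) = fps_nth (a oo b) k"
      unfolding fps_compose_nth
      by (intro sum.mono_neutral_right) (auto simp: b0)
    then show "(\<Sum>n\<le>N. vscale A (fps_nth a n * fps_nth (b ^ n) k) (pow h k x)) =
        vscale A (fps_nth (a oo b) k) (pow h k x)"
      by (simp add: A.scale_sum_left[symmetric])
  qed
  also have "\<dots> = ser (a oo b) h x"
    using N by (rule ser_eq[symmetric])
  finally show "ser (a oo b) h x = ser a (ser b h) x" ..
qed

definition deg0_chain :: "('b \<Rightarrow> 'a) \<Rightarrow> bool" where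
  "deg0_chain f \<longleftrightarrow> f \<in> Hom_deg B A 0 \<and> (\<forall>x. adiff A (f x) = f (adiff B x))"

lemma e_deg0_chain: "deg0_chain e"
proof -
  have "e x \<in> grade A i" if "x \<in> grade B i" for x i
    using B.counit_deg[OF that] A.unit_deg
    by (cases "i = 0") (auto simp: conv_unit_def unit_map_def intro: A.grade_scale)
  then show ?thesis
    using e_lin by (auto simp: deg0_chain_def Hom_deg_def conv_unit_def unit_map_def A.diff_scale B.counit_diff)
qed

lemma pow_deg0_chain: "deg0_chain h \<Longrightarrow> deg0_chain (pow h n)"
  by (induction n) (simp_all add: e_deg0_chain[unfolded deg0_chain_def] deg0_chain_def conv_Hom_deg conv_chain_map)

lemma ser_deg0_chain:
  assumes h: "pointed h" "deg0_chain h"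
  shows "deg0_chain (ser a h)"
proof -
  note ph = pow_deg0_chain[OF h(2), unfolded deg0_chain_def]
  have "ser a h x \<in> grade A i" if "x \<in> grade B i" for x i
    using Hom_deg_gradeD[OF conjunct1[OF ph] that] unfolding conv_series_def
    by (auto intro!: A.grade_sum A.grade_scale)
  moreover have "adiff A (ser a h x) = ser a h (adiff B x)" for x
  proof -
    obtain N where N: "\<And>z n. z \<in> {x, adiff B x} \<Longrightarrow> n > N \<Longrightarrow> pow h n z = 0"
      using pow_bound[OF h(1), of "{x, adiff B x}"] by auto
    then have "ser a h z = (\<Sum>n\<le>N. vscale A (fps_nth a n) (pow h n z))" if "z \<in> {x, adiff B x}" for z
      using that by (intro ser_eq) blast
    then show ?thesis using ph by (simp add: A.diff_sum A.diff_scale)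
  qed
  ultimately show ?thesis
    using ser_lin[OF h(1)] by (auto simp: deg0_chain_def Hom_deg_def)
qed

lemma finite_conv_power: "pointed h \<Longrightarrow> finite {n. n \<ge> 1 \<and> conv_power B A h n x \<noteq> 0}"
proof -
  assume h: "pointed h"
  then obtain N where N: "\<And>n. n > N \<Longrightarrow> pow h n x = 0" using pow_bound_at by blast
  have "{n. n \<ge> 1 \<and> conv_power B A h n x \<noteq> 0} \<subseteq> {..N}"
    using N by (auto simp: conv_power_eq_pow[OF pointed_lin[OF h]] not_less[symmetric])
  then show ?thesis by (rule finite_subset) simp
qed

text \<open>\<open>finite_series\<close> starts at \<open>n = 1\<close>, which accounts for the correction by the constant term.\<close>

lemma finite_series_conv_power:
  assumes h: "pointed h" and c: "\<And>n. n \<ge> 1 \<Longrightarrow> c n = fps_nth a n"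
  shows "finite_series (\<lambda>n. vscale A (c n) (conv_power B A h n x)) = ser a h x - vscale A (fps_nth a 0) (e x)"
proof -
  obtain N where N: "\<And>n. n > N \<Longrightarrow> pow h n x = 0" using pow_bound_at[OF h] by blast
  have cp: "vscale A (c n) (conv_power B A h n x) = vscale A (fps_nth a n) (pow h n x)" if "n \<ge> 1" for n
    using that conv_power_eq_pow[OF pointed_lin[OF h] that] c by simp
  have "finite_series (\<lambda>n. vscale A (c n) (conv_power B A h n x)) =
      (\<Sum>n | n \<ge> 1 \<and> vscale A (fps_nth a n) (pow h n x) \<noteq> 0. vscale A (fps_nth a n) (pow h n x))"
    unfolding finite_series_def by (intro sum.cong Collect_cong conj_cong) (simp_all only: cp mem_Collect_eq)
  also have "\<dots> = (\<Sum>n\<in>{1..N}. vscale A (fps_nth a n) (pow h n x))"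
    by (intro sum.mono_neutral_left) (use N in \<open>auto simp: not_less[symmetric]\<close>)
  finally have "finite_series (\<lambda>n. vscale A (c n) (conv_power B A h n x)) =
      (\<Sum>n\<in>{1..N}. vscale A (fps_nth a n) (pow h n x))" .
  moreover have "ser a h x = vscale A (fps_nth a 0) (e x) + (\<Sum>n\<in>{1..N}. vscale A (fps_nth a n) (pow h n x))"
    using ser_eq[OF N] by (simp add: atLeast0AtMost[symmetric] sum.atLeast_Suc_atMost)
  ultimately show ?thesis by simp
qed

end

text \<open>A linear functional that is nonzero on a coefficient reduces the claim to the finiteness of the set of
  roots of a nonzero polynomial over the field.\<close>

lemma (in vector_space) polynomial_coeffs_zero:
  assumes char0: "inj (of_nat :: nat \<Rightarrow> 'a)"
    and zero: "\<And>n::nat. (\<Sum>k\<le>N. scale (of_nat n ^ k) (v k)) = 0" and "k \<le> N"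
  shows "v k = 0"
proof (rule ccontr)
  assume "v k \<noteq> 0"
  interpret K: vector_space "(*) :: 'a \<Rightarrow> 'a \<Rightarrow> 'a"
    by unfold_locales (simp_all add: algebra_simps)
  interpret VK: vector_space_pair scale "(*) :: 'a \<Rightarrow> 'a \<Rightarrow> 'a" ..
  have "independent {v k}" using \<open>v k \<noteq> 0\<close> by simp
  then obtain \<phi> where \<phi>: "Vector_Spaces.linear scale (*) \<phi>" and \<phi>k: "\<phi> (v k) = (1 :: 'a)"
    using VK.linear_independent_extend[of "{v k}" "\<lambda>_. 1"] by auto
  interpret \<phi>: Vector_Spaces.linear scale "(*)" \<phi> by (rule \<phi>)
  define p where "p = (\<Sum>k\<le>N. monom (\<phi> (v k)) k)"
  have "poly p (of_nat n) = \<phi> (\<Sum>k\<le>N. scale (of_nat n ^ k) (v k))" for n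
    by (simp add: p_def poly_sum poly_monom \<phi>.sum \<phi>.scale mult.commute)
  then have "range of_nat \<subseteq> {x. poly p x = 0}" using zero \<phi>.zero by auto
  moreover have "infinite (range (of_nat :: nat \<Rightarrow> 'a))" using char0 by (simp add: finite_image_iff)
  ultimately have "p = 0" using poly_roots_finite[of p] finite_subset by blast
  then have "coeff p k = 0" by simp
  then show False using \<open>k \<le> N\<close> \<phi>k by (simp add: p_def coeff_sum)
qed

section \<open>Exponential and logarithm\<close>

locale conilpotent_convolution_char_0 = conilpotent_convolution B A
  for B :: "('k::field_char_0, 'b::ab_group_add, 'l) cdg_hopf_scheme"
    and A :: "('k, 'a::ab_group_add, 'm) cdga_scheme"
begin

abbreviation reduced where "reduced g \<equiv> (\<lambda>b. g b - unit_map A (counit B b))"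

lemma THom_pointed: "\<upsilon> \<in> THom_cdgA B A \<Longrightarrow> pointed \<upsilon>"
  and THom_deg0_chain: "\<upsilon> \<in> THom_cdgA B A \<Longrightarrow> deg0_chain \<upsilon>"
  by (auto simp: THom_cdgA_iff[OF A.cdg_algebra_axioms] pointed_def deg0_chain_def Hom_deg_lin)

lemma reduced_pointed:
  assumes "g \<in> Hom_cdgA B A"
  shows "pointed (reduced g)"
proof -
  have g: "lin g" "g (aunit B) = aunit A"
    using assms by (auto simp: Hom_cdgA_iff[OF A.cdg_algebra_axioms] Hom_deg_lin)
  have "lin (\<lambda>b. g b - e b)"
    using g(1) e_lin by (simp add: lin_iff A.scale_right_diff_distrib)
  then show ?thesis using g(2) e_unit by (simp add: pointed_def conv_unit_def)
qed

lemma reduced_deg0_chain: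
  assumes "g \<in> Hom_cdgA B A"
  shows "deg0_chain (reduced g)"
proof -
  have g: "g \<in> Hom_deg B A 0" "\<And>x. adiff A (g x) = g (adiff B x)"
    using assms by (auto simp: Hom_cdgA_iff[OF A.cdg_algebra_axioms])
  have "deg0_chain (\<lambda>b. g b - e b)"
    using g pointed_lin[OF reduced_pointed[OF assms]] e_deg0_chain
    by (auto simp: deg0_chain_def Hom_deg_def A.diff_minus conv_unit_def image_subset_iff
        intro!: A.grade_diff)
  then show ?thesis by (simp add: conv_unit_def)
qed

lemma exp_map_eq: assumes "pointed \<upsilon>" shows "exp_map B A \<upsilon> = ser (fps_exp 1) \<upsilon>"
proof
  fix x
  have "finite_series (\<lambda>n. vscale A (1 / of_nat (fact n)) (conv_power B A \<upsilon> n x)) =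
      ser (fps_exp 1) \<upsilon> x - vscale A (fps_nth (fps_exp 1) 0) (e x)"
    by (rule finite_series_conv_power[OF assms]) simp
  then show "exp_map B A \<upsilon> x = ser (fps_exp 1) \<upsilon> x"
    by (simp add: exp_map_def conv_unit_def)
qed

lemma ln_map_eq: assumes "g \<in> Hom_cdgA B A" shows "ln_map B A g = ser (fps_ln 1) (reduced g)"
proof
  fix x
  have "finite_series (\<lambda>n. vscale A ((- 1) ^ n / of_nat n) (conv_power B A (reduced g) n x)) =
      ser (- fps_ln 1) (reduced g) x - vscale A (fps_nth (- fps_ln 1) 0) (e x)"
    by (rule finite_series_conv_power[OF reduced_pointed[OF assms]])
      (auto simp: fps_ln_nth power_minus_mult Suc_le_eq gr0_conv_Suc)
  moreover have "ser (- fps_ln 1) (reduced g) x + ser (fps_ln 1) (reduced g) x = 0"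
    using ser_add[OF reduced_pointed[OF assms], of "- fps_ln 1" "fps_ln 1" x] by (simp add: conv_series_def)
  then have "- ser (- fps_ln 1) (reduced g) x = ser (fps_ln 1) (reduced g) x"
    by (rule minus_unique)
  ultimately show "ln_map B A g x = ser (fps_ln 1) (reduced g) x"
    by (simp add: ln_map_def)
qed

definition dpow :: "('b \<Rightarrow> 'a) \<Rightarrow> nat \<Rightarrow> 'b \<Rightarrow> 'a" where
  "dpow h n x = vscale A (1 / fact n) (pow h n x)"

lemma dpow_Suc: "(dpow h n \<star> h) x = vscale A (of_nat (Suc n)) (dpow h (Suc n) x)"
  unfolding dpow_def[abs_def] conv_scale_left
  by (simp add: dpow_def field_simps del: of_nat_Suc)

lemma dpow_0: "dpow h 0 = e"
  by (simp add: dpow_def fun_eq_iff)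

lemma dpow_Hom_deg: "deg0_chain h \<Longrightarrow> dpow h n \<in> Hom_deg B A 0"
  using pow_deg0_chain[of h n]
  by (auto simp: deg0_chain_def Hom_deg_def dpow_def lin_iff A.scale_right_distrib mult.commute
      image_subset_iff intro!: A.grade_scale)

text \<open>The binomial formula, in which division by \<open>n!\<close> absorbs the binomial coefficients.  In the
  inductive step each of the two terms of \<open>\<upsilon>(x y)\<close> raises one of the two divided powers.\<close>

lemma dpow_mult:
  assumes \<upsilon>: "\<upsilon> \<in> THom_cdgA B A"
  shows "dpow \<upsilon> n (amult B x y) = (\<Sum>k=0..n. amult A (dpow \<upsilon> k x) (dpow \<upsilon> (n - k) y))"
proof (induction n arbitrary: x y)
  case 0
  then show ?case
    by (simp add: dpow_0 conv_unit_def unit_map_def B.counit_mult A.mult_scale_left A.mult_unit_left)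
next
  case (Suc n)
  note h = THom_deg0_chain[OF \<upsilon>]
  note d = dpow_Hom_deg[OF h]
  have \<upsilon>_deg: "\<upsilon> \<in> Hom_deg B A 0" and e_deg: "e \<in> Hom_deg B A 0"
    using h e_deg0_chain by (auto simp: deg0_chain_def)
  \<comment> \<open>The two terms of the derivation rule as a sum over \<open>bool\<close>, in the form that \<open>conv_mult\<close> expects.\<close>
  have \<upsilon>_mult: "\<upsilon> (amult B x y) =
      (\<Sum>q\<in>UNIV. amult A ((if q then e else \<upsilon>) x) ((if q then \<upsilon> else e) y))" for x y
    using \<upsilon> by (simp add: THom_cdgA_iff[OF A.cdg_algebra_axioms] UNIV_bool add.commute)
  have "vscale A (of_nat (Suc n)) (dpow \<upsilon> (Suc n) (amult B x y)) = (dpow \<upsilon> n \<star> \<upsilon>) (amult B x y)"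
    by (rule dpow_Suc[symmetric])
  also have "\<dots> = (\<Sum>k\<in>{0..n}. \<Sum>q\<in>UNIV. amult A ((dpow \<upsilon> k \<star> (if q then e else \<upsilon>)) x)
      ((dpow \<upsilon> (n - k) \<star> (if q then \<upsilon> else e)) y))"
    by (rule conv_mult[OF Hom_deg_lin[OF d] Hom_deg_lin[OF \<upsilon>_deg] Suc.IH \<upsilon>_mult])
      (auto simp: d \<upsilon>_deg e_deg)
  also have "\<dots> = (\<Sum>k=0..n. vscale A (of_nat (Suc k)) (amult A (dpow \<upsilon> (Suc k) x) (dpow \<upsilon> (n - k) y)) +
      vscale A (of_nat (Suc (n - k))) (amult A (dpow \<upsilon> k x) (dpow \<upsilon> (Suc (n - k)) y)))"
    by (simp add: UNIV_bool conv_unit_right[OF Hom_deg_lin[OF d]] dpow_Suc A.mult_scale_left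
        A.mult_scale_right add.commute del: of_nat_Suc)
  also have "\<dots> = vscale A (of_nat (Suc n)) (\<Sum>k=0..Suc n. amult A (dpow \<upsilon> k x) (dpow \<upsilon> (Suc n - k) y))"
    by (rule A.Cauchy_sum_deriv[symmetric])
  finally show ?case by (simp del: of_nat_Suc sum.atLeast0_atMost_Suc)
qed

lemma ser_exp_eq:
  assumes "\<And>n. n > N \<Longrightarrow> pow h n x = 0"
  shows "ser (fps_exp c) h x = (\<Sum>n\<le>N. vscale A (c ^ n) (dpow h n x))"
  using ser_eq[OF assms] by (simp add: dpow_def)

lemma exp_map_Hom:
  assumes \<upsilon>: "\<upsilon> \<in> THom_cdgA B A"
  shows "exp_map B A \<upsilon> \<in> Hom_cdgA B A"
proof -
  note p = THom_pointed[OF \<upsilon>]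
  have "ser (fps_exp 1) \<upsilon> (amult B x y) = amult A (ser (fps_exp 1) \<upsilon> x) (ser (fps_exp 1) \<upsilon> y)" for x y
  proof -
    obtain N where N: "\<And>z n. z \<in> {x, y, amult B x y} \<Longrightarrow> n > N \<Longrightarrow> pow \<upsilon> n z = 0"
      using pow_bound[OF p, of "{x, y, amult B x y}"] by auto
    have "ser (fps_exp 1) \<upsilon> (amult B x y) = (\<Sum>n\<le>N + N. dpow \<upsilon> n (amult B x y))"
      by (subst ser_exp_eq[of "N + N"]) (simp_all add: N)
    also have "\<dots> = (\<Sum>n\<le>N + N. \<Sum>k\<le>n. amult A (dpow \<upsilon> k x) (dpow \<upsilon> (n - k) y))"
      by (simp add: dpow_mult[OF \<upsilon>] atLeast0AtMost)
    also have "\<dots> = (\<Sum>i\<le>N. \<Sum>j\<le>N. amult A (dpow \<upsilon> i x) (dpow \<upsilon> j y))"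
      by (rule Cauchy_sum_rectangle) (auto simp: N dpow_def)
    also have "\<dots> = amult A (\<Sum>i\<le>N. dpow \<upsilon> i x) (\<Sum>j\<le>N. dpow \<upsilon> j y)"
      by (subst sum.swap) (simp add: A.mult_sum_left A.mult_sum_right)
    also have "\<dots> = amult A (ser (fps_exp 1) \<upsilon> x) (ser (fps_exp 1) \<upsilon> y)"
      using ser_exp_eq[of N \<upsilon> x 1] ser_exp_eq[of N \<upsilon> y 1] N by simp
    finally show ?thesis .
  qed
  then show ?thesis
    using ser_deg0_chain[OF p THom_deg0_chain[OF \<upsilon>], of "fps_exp 1"] ser_at_unit[OF p, of "fps_exp 1"]
    by (simp add: exp_map_eq[OF p] Hom_cdgA_iff[OF A.cdg_algebra_axioms] deg0_chain_def)
qed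

lemma exp_ln: assumes "g \<in> Hom_cdgA B A" shows "exp_map B A (ln_map B A g) = g"
proof -
  note p = reduced_pointed[OF assms]
  have "fps_exp 1 - 1 oo fps_ln 1 = (fps_X :: 'k fps)"
    using fps_inv_fps_exp_compose(2)[of "1 :: 'k"] by (simp add: fps_ln_fps_exp_inv)
  then have "fps_exp 1 oo fps_ln 1 = 1 + (fps_X :: 'k fps)"
    by (simp add: fps_compose_sub_distrib algebra_simps)
  then have "ser (fps_exp 1) (ser (fps_ln 1) (reduced g)) = ser (1 + fps_X) (reduced g)"
    using ser_compose[OF p, of "fps_ln 1" "fps_exp 1"] by simp
  also have "\<dots> = g"
    using ser_add[OF p, of 1 fps_X] by (simp add: ser_1[OF p] ser_X[OF p] fun_eq_iff conv_unit_def)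
  finally show ?thesis
    by (simp add: ln_map_eq[OF assms] exp_map_eq[OF ser_pointed[OF p]])
qed

lemma ln_exp: assumes \<upsilon>: "\<upsilon> \<in> THom_cdgA B A" shows "ln_map B A (exp_map B A \<upsilon>) = \<upsilon>"
proof -
  note p = THom_pointed[OF \<upsilon>]
  have "reduced (exp_map B A \<upsilon>) x = ser (fps_exp 1 - 1) \<upsilon> x" for x
    using ser_add[OF p, of "fps_exp 1 - 1" 1 x] by (simp add: ser_1[OF p] exp_map_eq[OF p] conv_unit_def)
  then have "ln_map B A (exp_map B A \<upsilon>) = ser (fps_ln 1) (ser (fps_exp 1 - 1) \<upsilon>)"
    by (simp add: ln_map_eq[OF exp_map_Hom[OF \<upsilon>]])
  also have "\<dots> = ser (fps_ln 1 oo (fps_exp 1 - 1)) \<upsilon>"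
    by (rule ser_compose[OF p, symmetric]) simp
  also have "fps_ln 1 oo (fps_exp 1 - 1) = (fps_X :: 'k fps)"
    using fps_inv_fps_exp_compose(1)[of "1 :: 'k"] by (simp add: fps_ln_fps_exp_inv)
  finally show ?thesis by (simp add: ser_X[OF p])
qed

text \<open>Algebra maps are closed under convolution.\<close>

lemma Hom_pow_mult:
  assumes g: "g \<in> Hom_cdgA B A"
  shows "pow g n (amult B x y) = amult A (pow g n x) (pow g n y)"
proof (induction n arbitrary: x y)
  case 0
  then show ?case
    by (simp add: conv_unit_def unit_map_def B.counit_mult A.mult_scale_left A.mult_unit_left)
next
  case (Suc n)
  have gd: "deg0_chain g" and gm: "\<And>x y. g (amult B x y) = amult A (g x) (g y)"
    using g by (auto simp: Hom_cdgA_iff[OF A.cdg_algebra_axioms] deg0_chain_def)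
  have d: "pow g n \<in> Hom_deg B A 0" "g \<in> Hom_deg B A 0"
    using pow_deg0_chain[OF gd] gd by (auto simp: deg0_chain_def)
  show ?case
    using conv_mult[OF Hom_deg_lin[OF d(1)] Hom_deg_lin[OF d(2)],
        where I = "{()}" and \<alpha> = "\<lambda>_. pow g n" and \<beta> = "\<lambda>_. pow g n"
          and J = "{()}" and \<gamma> = "\<lambda>_. g" and \<delta> = "\<lambda>_. g"]
    by (simp add: Suc.IH gm d)
qed

text \<open>The convolution powers \<open>g^n = exp (n ln g)\<close> are multiplicative for every \<open>n\<close>, and both
  sides of \<open>g^n (x y) = g^n x g^n y\<close> are polynomials in \<open>n\<close>.  Comparing the coefficients of \<open>n\<close>
  shows that \<open>ln g\<close> is a derivation along \<open>e\<close>.\<close>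

lemma ln_map_THom:
  assumes g: "g \<in> Hom_cdgA B A"
  shows "ln_map B A g \<in> THom_cdgA B A"
proof -
  define h where "h = ln_map B A g"
  note p = reduced_pointed[OF g]
  have h_eq: "h = ser (fps_ln 1) (reduced g)" by (simp add: h_def ln_map_eq[OF g])
  have hp: "pointed h" unfolding h_eq by (rule ser_pointed[OF p]) simp
  have hd: "deg0_chain h" unfolding h_eq by (rule ser_deg0_chain[OF p reduced_deg0_chain[OF g]])
  have g_eq: "g = ser (fps_exp 1) h"
    using exp_ln[OF g] exp_map_eq[OF hp] by (simp add: h_def)
  have g_pow: "pow g n = ser (fps_exp (of_nat n)) h" for n
    using pow_ser[OF hp, of "fps_exp 1" n] by (simp add: g_eq[symmetric] fps_exp_power_mult)
  have "h (amult B x y) = amult A (e x) (h y) + amult A (h x) (e y)" for x y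
  proof -
    obtain N where N: "\<And>z n. z \<in> {x, y, amult B x y} \<Longrightarrow> n > N \<Longrightarrow> pow h n z = 0"
      using pow_bound[OF hp, of "{x, y, amult B x y}"] by auto
    let ?v = "\<lambda>n. dpow h n (amult B x y) - (\<Sum>k\<le>n. amult A (dpow h k x) (dpow h (n - k) y))"
    \<comment> \<open>The successor ensures that the coefficient 1 lies in the range even for \<open>N = 0\<close>.\<close>
    let ?M = "Suc (N + N)"
    have "?v 1 = 0"
    proof (rule A.polynomial_coeffs_zero[where v = ?v and N = ?M])
      fix n :: nat
      let ?n = "of_nat n :: 'k"
      let ?f = "\<lambda>i j. amult A (vscale A (?n ^ i) (dpow h i x)) (vscale A (?n ^ j) (dpow h j y))"
      have "(\<Sum>k\<le>?M. vscale A (?n ^ k) (dpow h k (amult B x y))) = pow g n (amult B x y)"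
        unfolding g_pow by (rule ser_exp_eq[symmetric]) (simp add: N)
      also have "\<dots> = amult A (pow g n x) (pow g n y)"
        by (rule Hom_pow_mult[OF g])
      also have "pow g n x = (\<Sum>i\<le>N. vscale A (?n ^ i) (dpow h i x))"
        unfolding g_pow by (rule ser_exp_eq) (simp add: N)
      also have "pow g n y = (\<Sum>j\<le>Suc N. vscale A (?n ^ j) (dpow h j y))"
        unfolding g_pow by (rule ser_exp_eq) (simp add: N)
      also have "amult A (\<Sum>i\<le>N. vscale A (?n ^ i) (dpow h i x)) (\<Sum>j\<le>Suc N. vscale A (?n ^ j) (dpow h j y)) =
          (\<Sum>i\<le>N. \<Sum>j\<le>Suc N. ?f i j)"
        unfolding A.mult_sum_left unfolding A.mult_sum_right ..
      also have "\<dots> = (\<Sum>k\<le>N + Suc N. \<Sum>i\<le>k. ?f i (k - i))"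
        by (rule Cauchy_sum_rectangle[symmetric]) (auto simp: N dpow_def)
      also have "\<dots> = (\<Sum>k\<le>?M. vscale A (?n ^ k) (\<Sum>i\<le>k. amult A (dpow h i x) (dpow h (k - i) y)))"
        by (simp add: A.mult_scale_left A.mult_scale_right A.scale_sum_right power_add[symmetric]
            del: sum.atMost_Suc)
      finally show "(\<Sum>k\<le>?M. vscale A (?n ^ k) (?v k)) = 0"
        by (simp add: A.scale_right_diff_distrib sum_subtractf del: sum.atMost_Suc)
    qed (simp_all add: inj_of_nat)
    moreover have "dpow h 1 = h"
      using pow_1[OF pointed_lin[OF hp]] by (simp add: dpow_def fun_eq_iff del: conv_pow.simps)
    ultimately show ?thesis by (simp add: dpow_0)
  qed
  then show ?thesis
    using hp hd by (simp add: h_def[symmetric] THom_cdgA_iff[OF A.cdg_algebra_axioms] pointed_def deg0_chain_def)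
qed

end

section \<open>Naturality and homotopy invariance\<close>

lemma conilpotent_convolution_char_0I:
  "cdg_hopf_algebra B \<Longrightarrow> conilpotent B \<Longrightarrow> cdg_algebra A \<Longrightarrow> conilpotent_convolution_char_0 B A"
  by (simp add: conilpotent_convolution_char_0_def conilpotent_convolution_def
      conilpotent_convolution_axioms_def convolution_def)

lemma conv_pow_natural:
  assumes A': "cdg_algebra A'" and f: "f \<in> Hom_cdgA A A'"
  shows "f (conv_pow B A h n x) = conv_pow B A' (f \<circ> h) n x"
proof (induction n arbitrary: x)
  case 0
  show ?case using Hom_cdgA_unit_map[OF A' f] by (simp add: conv_unit_def)
next
  case (Suc n)
  note f' = f[unfolded Hom_cdgA_iff[OF A']]
  show ?case
    using f' Suc.IH by (simp add: conv_def linear_lin_ext2[OF Hom_deg_linearD[of f A A' 0]])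
qed

lemma exp_map_natural:
  fixes B :: "('k::field_char_0, 'b::ab_group_add, 'l) cdg_hopf_scheme"
    and A :: "('k, 'a::ab_group_add, 'm) cdga_scheme"
    and A' :: "('k, 'c::ab_group_add, 'n) cdga_scheme"
  assumes B: "cdg_hopf_algebra B" "conilpotent B" and A: "cdg_algebra A" and A': "cdg_algebra A'"
    and f: "f \<in> Hom_cdgA A A'" and \<upsilon>: "\<upsilon> \<in> THom_cdgA B A"
  shows "f \<circ> exp_map B A \<upsilon> = exp_map B A' (f \<circ> \<upsilon>)"
proof
  fix x
  interpret L: conilpotent_convolution_char_0 B A
    by (rule conilpotent_convolution_char_0I[OF B A])
  interpret L': conilpotent_convolution_char_0 B A'
    by (rule conilpotent_convolution_char_0I[OF B A'])
  interpret f: Vector_Spaces.linear "vscale A" "vscale A'" f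
    using f by (auto simp: Hom_cdgA_iff[OF A'] dest: Hom_deg_linearD)
  note p = L.THom_pointed[OF \<upsilon>] and p' = L'.THom_pointed[OF Hom_THom_comp[OF A A' \<upsilon> f]]
  note pow = conv_pow_natural[OF A' f, of B \<upsilon>]
  obtain N where N: "\<And>n. n > N \<Longrightarrow> conv_pow B A \<upsilon> n x = 0"
    using L.pow_bound_at[OF p] by blast
  then have N': "\<And>n. n > N \<Longrightarrow> conv_pow B A' (f \<circ> \<upsilon>) n x = 0"
    by (simp add: pow[symmetric] f.zero)
  show "(f \<circ> exp_map B A \<upsilon>) x = exp_map B A' (f \<circ> \<upsilon>) x"
    using L.ser_eq[OF N] L'.ser_eq[OF N']
    by (simp add: L.exp_map_eq[OF p] L'.exp_map_eq[OF p'] f.sum f.scale pow)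
qed

text \<open>Naturality of exp passes to its inverse.\<close>

lemma ln_map_natural:
  fixes B :: "('k::field_char_0, 'b::ab_group_add, 'l) cdg_hopf_scheme"
    and A :: "('k, 'a::ab_group_add, 'm) cdga_scheme"
    and A' :: "('k, 'c::ab_group_add, 'n) cdga_scheme"
  assumes B: "cdg_hopf_algebra B" "conilpotent B" and A: "cdg_algebra A" and A': "cdg_algebra A'"
    and f: "f \<in> Hom_cdgA A A'" and g: "g \<in> Hom_cdgA B A"
  shows "f \<circ> ln_map B A g = ln_map B A' (f \<circ> g)"
proof -
  interpret L: conilpotent_convolution_char_0 B A
    by (rule conilpotent_convolution_char_0I[OF B A])
  interpret L': conilpotent_convolution_char_0 B A'
    by (rule conilpotent_convolution_char_0I[OF B A'])
  note lng = L.ln_map_THom[OF g]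
  have "ln_map B A' (f \<circ> g) = ln_map B A' (exp_map B A' (f \<circ> ln_map B A g))"
    using exp_map_natural[OF B A A' f lng] by (simp add: L.exp_ln[OF g])
  then show ?thesis
    using L'.ln_exp[OF Hom_THom_comp[OF A A' lng f]] by simp
qed

text \<open>The exponential of a path is taken in the path algebra; evaluation at the endpoints is a morphism,
  so naturality identifies its endpoints.\<close>

lemma exp_map_homotopic:
  fixes B :: "('k::field_char_0, 'b::ab_group_add, 'l) cdg_hopf_scheme"
    and A :: "('k, 'a::ab_group_add, 'm) cdga_scheme"
  assumes B: "cdg_hopf_algebra B" "conilpotent B" and A: "cdg_algebra A"
    and h: "(\<upsilon>, \<tau>) \<in> Thomotopy_rel B A"
  shows "(exp_map B A \<upsilon>, exp_map B A \<tau>) \<in> homotopy_rel B A"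
  using h unfolding Thomotopy_rel_eq[OF B(1) A]
    homotopy_rel_eq[OF cdg_hopf_algebra.axioms(1)[OF B(1)] A]
proof (rule gen_equiv_map)
  interpret A: cdg_algebra A by fact
  note P = A.cdg_algebra_path
  note exp_Hom = conilpotent_convolution_char_0.exp_map_Hom[OF conilpotent_convolution_char_0I[OF B]]
  show "exp_map B A x \<in> Hom_cdgA B A" if "x \<in> THom_cdgA B A" for x
    by (rule exp_Hom[OF A that])
  show "(exp_map B A x, exp_map B A y) \<in> path_ends A (Hom_cdgA B (path_algebra A))"
    if "(x, y) \<in> path_ends A (THom_cdgA B (path_algebra A))" for x y
    using that exp_Hom[OF P] exp_map_natural[OF B P A A.path_eval_Hom] by (rule path_ends_map)
qed

lemma ln_map_homotopic:
  fixes B :: "('k::field_char_0, 'b::ab_group_add, 'l) cdg_hopf_scheme"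
    and A :: "('k, 'a::ab_group_add, 'm) cdga_scheme"
  assumes B: "cdg_hopf_algebra B" "conilpotent B" and A: "cdg_algebra A"
    and h: "(f, g) \<in> homotopy_rel B A"
  shows "(ln_map B A f, ln_map B A g) \<in> Thomotopy_rel B A"
  using h unfolding Thomotopy_rel_eq[OF B(1) A]
    homotopy_rel_eq[OF cdg_hopf_algebra.axioms(1)[OF B(1)] A]
proof (rule gen_equiv_map)
  interpret A: cdg_algebra A by fact
  note P = A.cdg_algebra_path
  note ln_THom = conilpotent_convolution_char_0.ln_map_THom[OF conilpotent_convolution_char_0I[OF B]]
  show "ln_map B A x \<in> THom_cdgA B A" if "x \<in> Hom_cdgA B A" for x
    by (rule ln_THom[OF A that])
  show "(ln_map B A x, ln_map B A y) \<in> path_ends A (THom_cdgA B (path_algebra A))"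
    if "(x, y) \<in> path_ends A (Hom_cdgA B (path_algebra A))" for x y
    using that ln_THom[OF P] ln_map_natural[OF B P A A.path_eval_Hom] by (rule path_ends_map)
qed

lemma exp_ho_Thtype:
  fixes B :: "('k::field_char_0, 'b::ab_group_add, 'l) cdg_hopf_scheme"
  assumes B: "cdg_hopf_algebra B" "conilpotent B" and A: "cdg_algebra A" and \<upsilon>: "\<upsilon> \<in> THom_cdgA B A"
  shows "exp_ho B A (Thtype B A \<upsilon>) = htype B A (exp_map B A \<upsilon>)"
  unfolding exp_ho_def Thtype_def
  by (rule UN_equiv_class[OF equiv_Thomotopy_rel _ \<upsilon>])
    (auto intro!: congruentI htype_eqI exp_map_homotopic[OF B A])

lemma ln_ho_htype:
  fixes B :: "('k::field_char_0, 'b::ab_group_add, 'l) cdg_hopf_scheme"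
  assumes B: "cdg_hopf_algebra B" "conilpotent B" and A: "cdg_algebra A" and g: "g \<in> Hom_cdgA B A"
  shows "ln_ho B A (htype B A g) = Thtype B A (ln_map B A g)"
  unfolding ln_ho_def htype_def
  by (rule UN_equiv_class[OF equiv_homotopy_rel _ g])
    (auto intro!: congruentI Thtype_eqI ln_map_homotopic[OF B A])

lemma Hom_ho_cases:
  assumes "\<gamma> \<in> Hom_ho C A" obtains g where "g \<in> Hom_cdgA C A" "\<gamma> = htype C A g"
  using assms unfolding Hom_ho_def htype_def by (blast elim: quotientE)

lemma THom_ho_cases:
  assumes "U \<in> THom_ho B A" obtains \<upsilon> where "\<upsilon> \<in> THom_cdgA B A" "U = Thtype B A \<upsilon>"
  using assms unfolding THom_ho_def Thtype_def by (blast elim: quotientE)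

lemma htype_in_Hom_ho: "g \<in> Hom_cdgA C A \<Longrightarrow> htype C A g \<in> Hom_ho C A"
  by (simp add: Hom_ho_def htype_def quotientI)

lemma Thtype_in_THom_ho: "\<upsilon> \<in> THom_cdgA B A \<Longrightarrow> Thtype B A \<upsilon> \<in> THom_ho B A"
  by (simp add: THom_ho_def Thtype_def quotientI)

(* The conclusion, in order: composition of homotopy types, and the actions of Hom_ho(B,-) and
   THom_ho(B,-) on them, do not depend on representatives; the two series are finite at each
   element of B; exp and ln on arbitrary representatives; they are mutually inverse bijections;
   naturality in A. *)
theorem theorem3p3:
  fixes B :: "('k::field_char_0, 'b::ab_group_add) cdg_hopf"
    and A :: "('k, 'a::ab_group_add) cdga"
    and A' :: "('k, 'c::ab_group_add) cdga"
    and A'' :: "('k, 'd::ab_group_add) cdga"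
  assumes B: "cdg_hopf_algebra B" and conil: "conilpotent B"
    and A: "cdg_algebra A" and A': "cdg_algebra A'" and A'': "cdg_algebra A''"
  shows "(\<forall>f\<in>Hom_cdgA A A'. \<forall>h\<in>Hom_cdgA A' A''.
       h \<circ> f \<in> Hom_cdgA A A'' \<and> comp_ho A A'' (htype A' A'' h) (htype A A' f) = htype A A'' (h \<circ> f)) \<and>
    (\<forall>f\<in>Hom_cdgA A A'. \<forall>g\<in>Hom_cdgA B A.
       f \<circ> g \<in> Hom_cdgA B A' \<and> comp_ho B A' (htype A A' f) (htype B A g) = htype B A' (f \<circ> g)) \<and>
    (\<forall>f\<in>Hom_cdgA A A'. \<forall>\<upsilon>\<in>THom_cdgA B A.
       f \<circ> \<upsilon> \<in> THom_cdgA B A' \<and> Tcomp_ho B A' (htype A A' f) (Thtype B A \<upsilon>) = Thtype B A' (f \<circ> \<upsilon>)) \<and>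
    (\<forall>\<upsilon>\<in>THom_cdgA B A. \<forall>x. finite {n. n \<ge> 1 \<and> conv_power B A \<upsilon> n x \<noteq> 0}) \<and>
    (\<forall>g\<in>Hom_cdgA B A. \<forall>x.
       finite {n. n \<ge> 1 \<and> conv_power B A (\<lambda>b. g b - unit_map A (counit B b)) n x \<noteq> 0}) \<and>
    (\<forall>\<upsilon>\<in>THom_cdgA B A.
       exp_map B A \<upsilon> \<in> Hom_cdgA B A \<and> exp_ho B A (Thtype B A \<upsilon>) = htype B A (exp_map B A \<upsilon>)) \<and>
    (\<forall>g\<in>Hom_cdgA B A.
       ln_map B A g \<in> THom_cdgA B A \<and> ln_ho B A (htype B A g) = Thtype B A (ln_map B A g)) \<and>
    (bij_betw (exp_ho B A) (THom_ho B A) (Hom_ho B A)) \<and>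
    (bij_betw (ln_ho B A) (Hom_ho B A) (THom_ho B A)) \<and>
    (\<forall>U\<in>THom_ho B A. ln_ho B A (exp_ho B A U) = U) \<and>
    (\<forall>\<gamma>\<in>Hom_ho B A. exp_ho B A (ln_ho B A \<gamma>) = \<gamma>) \<and>
    (\<forall>\<phi>\<in>Hom_ho A A'. \<forall>U\<in>THom_ho B A.
       exp_ho B A' (Tcomp_ho B A' \<phi> U) = comp_ho B A' \<phi> (exp_ho B A U)) \<and>
    (\<forall>\<phi>\<in>Hom_ho A A'. \<forall>\<gamma>\<in>Hom_ho B A.
       ln_ho B A' (comp_ho B A' \<phi> \<gamma>) = Tcomp_ho B A' \<phi> (ln_ho B A \<gamma>))"
proof -
  note cB = cdg_hopf_algebra.axioms(1)[OF B]
  interpret L: conilpotent_convolution_char_0 B A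
    by (rule conilpotent_convolution_char_0I[OF B conil A])
  note exp_A = exp_ho_Thtype[OF B conil A] and exp_A' = exp_ho_Thtype[OF B conil A']
  note ln_A = ln_ho_htype[OF B conil A] and ln_A' = ln_ho_htype[OF B conil A']
  note comp = comp_ho_htype[OF cB A A'] and Tcomp = Tcomp_ho_Thtype[OF B A A']
  have ln_exp: "ln_ho B A (exp_ho B A U) = U \<and> exp_ho B A U \<in> Hom_ho B A" if U: "U \<in> THom_ho B A" for U
  proof -
    obtain \<upsilon> where \<upsilon>: "\<upsilon> \<in> THom_cdgA B A" "U = Thtype B A \<upsilon>" using U by (rule THom_ho_cases)
    show ?thesis
      using htype_in_Hom_ho[OF L.exp_map_Hom[OF \<upsilon>(1)]]
      by (simp add: \<upsilon> exp_A ln_A L.exp_map_Hom L.ln_exp)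
  qed
  have exp_ln: "exp_ho B A (ln_ho B A \<gamma>) = \<gamma> \<and> ln_ho B A \<gamma> \<in> THom_ho B A" if \<gamma>: "\<gamma> \<in> Hom_ho B A" for \<gamma>
  proof -
    obtain g where g: "g \<in> Hom_cdgA B A" "\<gamma> = htype B A g" using \<gamma> by (rule Hom_ho_cases)
    show ?thesis
      using Thtype_in_THom_ho[OF L.ln_map_THom[OF g(1)]]
      by (simp add: g exp_A ln_A L.ln_map_THom L.exp_ln)
  qed
  have nat_exp: "exp_ho B A' (Tcomp_ho B A' \<phi> U) = comp_ho B A' \<phi> (exp_ho B A U)"
    if \<phi>: "\<phi> \<in> Hom_ho A A'" and U: "U \<in> THom_ho B A" for \<phi> U
  proof -
    obtain f where f: "f \<in> Hom_cdgA A A'" "\<phi> = htype A A' f" using \<phi> by (rule Hom_ho_cases)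
    obtain \<upsilon> where \<upsilon>: "\<upsilon> \<in> THom_cdgA B A" "U = Thtype B A \<upsilon>" using U by (rule THom_ho_cases)
    show ?thesis
      by (simp add: f \<upsilon> Tcomp exp_A exp_A' comp L.exp_map_Hom Hom_THom_comp[OF A A']
          exp_map_natural[OF B conil A A'])
  qed
  have nat_ln: "ln_ho B A' (comp_ho B A' \<phi> \<gamma>) = Tcomp_ho B A' \<phi> (ln_ho B A \<gamma>)"
    if \<phi>: "\<phi> \<in> Hom_ho A A'" and \<gamma>: "\<gamma> \<in> Hom_ho B A" for \<phi> \<gamma>
  proof -
    obtain f where f: "f \<in> Hom_cdgA A A'" "\<phi> = htype A A' f" using \<phi> by (rule Hom_ho_cases)
    obtain g where g: "g \<in> Hom_cdgA B A" "\<gamma> = htype B A g" using \<gamma> by (rule Hom_ho_cases)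
    show ?thesis
      by (simp add: f g Tcomp ln_A ln_A' comp L.ln_map_THom Hom_cdgA_comp[OF A A']
          ln_map_natural[OF B conil A A'])
  qed
  have bij_exp: "bij_betw (exp_ho B A) (THom_ho B A) (Hom_ho B A)"
    by (rule bij_betw_byWitness[where f' = "ln_ho B A"]) (use ln_exp exp_ln in auto)
  have bij_ln: "bij_betw (ln_ho B A) (Hom_ho B A) (THom_ho B A)"
    by (rule bij_betw_byWitness[where f' = "exp_ho B A"]) (use ln_exp exp_ln in auto)
  show ?thesis
    using bij_exp bij_ln ln_exp exp_ln nat_exp nat_ln
    by (intro conjI ballI allI)
      (auto simp: comp Tcomp exp_A ln_A comp_ho_htype[OF A A' A''] L.exp_map_Hom L.ln_map_THom
        L.finite_conv_power[OF L.THom_pointed, simplified] L.finite_conv_power[OF L.reduced_pointed, simplified]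
        intro: Hom_cdgA_comp[OF A' A''] Hom_cdgA_comp[OF A A'] Hom_THom_comp[OF A A'])
qed

end
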